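(* Let $F$ be a degree 2 Siegel modular form of weight $k\in\mathbb Z_+$, level $\mathcal N$ and character $\chi$, with Fourier expansion $F(\tau)=\sum_T a(T)\exp(2\pi i\,\mathrm{Tr}(T\tau))$. Let $p$ be an odd prime and set $D=\begin{pmatrix}1&0\\0&p\end{pmatrix}$. Let $\mathcal S$ be the set of odd primes $q$ such that $F$ is an eigenform for $T(q)$ and $\widetilde T_1(q^2)$, and either $q=p$ or $\left(\frac{-p}{q}\right)=-1$. Let $n$ be a product of powers of primes in $\mathcal S$. Then for any $m\in\mathbb Z_+$ with $(m,n)=1$ we have $$a(D)a(mnD)=a(mD)a(nD).$$ Also, $a(D)a(mnD)=0$ if $a(mD)=0$.
   Context: Let $\mathfrak h_{(2)}=\{X+iY: X,Y\text{ real symmetric }2\times2\text{ matrices}, Y>0\}$. Let $Sp_2(R)$ be the group of $4\times4$ symplectic matrices over $R$, $\mathcal N\in\mathbb Z_+$, $\Gamma=\Gamma_0(\mathcal N)=\{\begin{pmatrix}A&B\\C&D\end{pmatrix}\in Sp_2(\mathbb Z):\mathcal N\mid C\}$ (with $2\times2$ blocks), and $\chi$ a Dirichlet character modulo $\mathcal N$ (so $\chi(q)=0$ for primes $q\mid\mathcal N$). For $\gamma=\begin{pmatrix}A&B\\C&D\end{pmatrix}$ a rational symplectic matrix, or a rational symplectic similitude with positive multiplier, set $$F(\tau)|\gamma=(\det\gamma)^{k/2}\det(C\tau+D)^{-k}F((A\tau+B)(C\tau+D)^{-1}).$$ A degree 2 Siegel modular form of weight $k$, level $\mathcal N$ and character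 $\chi$ is a holomorphic $F:\mathfrak h_{(2)}\to\mathbb C$ with $F|\gamma=\chi(\det D_\gamma)F$ for all $\gamma\in\Gamma_0(\mathcal N)$, where $D_\gamma$ is the lower right block of $\gamma$; write $\chi(\gamma)=\chi(\det D_\gamma)$. Its Fourier expansion runs over $2\times2$ symmetric positive semi-definite half-integral $T$ (entries in $\frac12\mathbb Z$, integer diagonal). For $q$ prime, put $\delta(q)=\mathrm{diag}(q,q,1,1)$ and $\delta_1(q^2)=\mathrm{diag}(q,1,1/q,1)$. The Hecke operators are $$F|T(q)=q^{k-3}\sum_\gamma\overline\chi(\gamma)F|\delta(q)^{-1}\gamma,\qquad F|T_1(q^2)=q^{k-3}\sum_\gamma\overline\chi(\gamma)F|\delta_1(q^2)^{-1}\gamma,$$ where $\gamma$ runs over $(\delta(q)\Gamma\delta(q)^{-1}\cap\Gamma)\backslash\Gamma$, respectively $(\delta_1(q^2)\Gamma\delta_1(q^2)^{-1}\cap\Gamma)\backslash\Gamma$. Finally, $\widetilde T_1(q^2)=T_1(q^2)+\chi(q)q^{k-3}(q+1)$. $F$ is an eigenform for an operator if the operator maps $F$ to a complex multiple of $F$. $\left(\frac{\cdot}{q}\right)$ is the Legendre symbol. *)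

theory Defs
  imports "HOL-Analysis.Analysis" "HOL-Number_Theory.Number_Theory"
begin

section \<open>Block matrices and the symplectic group\<close>

text \<open>Index type \<open>2 + 2\<close> (a disjoint sum): \<open>Inl\<close> indexes the first block, \<open>Inr\<close> the second.\<close>

type_synonym 'a mat2 = "(('a, 2) vec, 2) vec"
type_synonym 'a mat4 = "(('a, 2 + 2) vec, 2 + 2) vec"

definition block :: "'a mat2 \<Rightarrow> 'a mat2 \<Rightarrow> 'a mat2 \<Rightarrow> 'a mat2 \<Rightarrow> 'a mat4" where
  "block A B C D = (\<chi> i j. case (i, j) of
      (Inl r, Inl s) \<Rightarrow> A $ r $ s | (Inl r, Inr s) \<Rightarrow> B $ r $ s
    | (Inr r, Inl s) \<Rightarrow> C $ r $ s | (Inr r, Inr s) \<Rightarrow> D $ r $ s)"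

definition blockA :: "'a mat4 \<Rightarrow> 'a mat2" where "blockA M = (\<chi> r s. M $ Inl r $ Inl s)"
definition blockB :: "'a mat4 \<Rightarrow> 'a mat2" where "blockB M = (\<chi> r s. M $ Inl r $ Inr s)"
definition blockC :: "'a mat4 \<Rightarrow> 'a mat2" where "blockC M = (\<chi> r s. M $ Inr r $ Inl s)"
definition blockD :: "'a mat4 \<Rightarrow> 'a mat2" where "blockD M = (\<chi> r s. M $ Inr r $ Inr s)"

definition diag2 :: "'a::zero \<Rightarrow> 'a \<Rightarrow> 'a mat2" where
  "diag2 x y = vector [vector [x, 0], vector [0, y]]"

definition symp_J :: "'a::comm_ring_1 mat4" where
  "symp_J = block 0 (mat 1) (- mat 1) 0"

definition Sp2 :: "'a::comm_ring_1 mat4 set" where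
  "Sp2 = {M. transpose M ** symp_J ** M = symp_J}"

definition Gamma0 :: "nat \<Rightarrow> int mat4 set" where
  "Gamma0 N = {M \<in> Sp2. \<forall>r s. int N dvd blockC M $ r $ s}"

definition dirichlet_character :: "nat \<Rightarrow> (int \<Rightarrow> complex) \<Rightarrow> bool" where
  "dirichlet_character N chi \<longleftrightarrow>
     (\<forall>a b. chi (a * b) = chi a * chi b) \<and>
     (\<forall>a. chi (a + int N) = chi a) \<and>
     (\<forall>a. chi a = 0 \<longleftrightarrow> \<not> coprime a (int N))"

section \<open>Siegel modular forms of degree 2\<close>

definition pos_def :: "real mat2 \<Rightarrow> bool" where
  "pos_def Y \<longleftrightarrow> transpose Y = Y \<and> (\<forall>v. v \<noteq> 0 \<longrightarrow> v \<bullet> (Y *v v) > 0)"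

definition pos_semidef :: "real mat2 \<Rightarrow> bool" where
  "pos_semidef Y \<longleftrightarrow> transpose Y = Y \<and> (\<forall>v. v \<bullet> (Y *v v) \<ge> 0)"

definition siegel_h2 :: "complex mat2 set" where
  "siegel_h2 = {(\<chi> r s. Complex (X $ r $ s) (Y $ r $ s)) | X Y. transpose X = X \<and> pos_def Y}"

text \<open>
  \<open>siegel_h2\<close> is an open subset of the three-dimensional complex vector space of symmetric
  matrices, not of the space of all matrices; hence the derivative is taken within
  \<open>siegel_h2\<close>, and only its values on symmetric matrices matter.  The product
  \<open>mat c ** Z\<close> is the scalar multiple of \<open>Z\<close> by \<open>c\<close>.
\<close>

definition siegel_holomorphic :: "(complex mat2 \<Rightarrow> complex) \<Rightarrow> bool" where
  "siegel_holomorphic F \<longleftrightarrow> (\<forall>\<tau>\<in>siegel_h2. \<exists>L.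
     (F has_derivative L) (at \<tau> within siegel_h2) \<and>
     (\<forall>c Z. L (mat c ** Z) = c * L Z))"

definition slash :: "nat \<Rightarrow> (complex mat2 \<Rightarrow> complex) \<Rightarrow> real mat4 \<Rightarrow> complex mat2 \<Rightarrow> complex" where
  "slash k F M \<tau> =
    (let A = map_matrix complex_of_real (blockA M); B = map_matrix complex_of_real (blockB M);
         C = map_matrix complex_of_real (blockC M); D = map_matrix complex_of_real (blockD M)
     in complex_of_real (det M powr (real k / 2)) * det (C ** \<tau> + D) powi (- int k)
        * F ((A ** \<tau> + B) ** matrix_inv (C ** \<tau> + D)))"

definition siegel_modular_form ::
  "nat \<Rightarrow> nat \<Rightarrow> (int \<Rightarrow> complex) \<Rightarrow> (complex mat2 \<Rightarrow> complex) \<Rightarrow> bool" where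
  "siegel_modular_form k N chi F \<longleftrightarrow> siegel_holomorphic F \<and>
     (\<forall>\<gamma>\<in>Gamma0 N. \<forall>\<tau>\<in>siegel_h2.
        slash k F (map_matrix real_of_int \<gamma>) \<tau> = chi (det (blockD \<gamma>)) * F \<tau>)"

definition fourier_index :: "real mat2 set" where
  "fourier_index = {T. pos_semidef T \<and> (\<forall>r s. 2 * T $ r $ s \<in> \<int>) \<and> (\<forall>r. T $ r $ r \<in> \<int>)}"

definition has_fourier_expansion ::
  "(complex mat2 \<Rightarrow> complex) \<Rightarrow> (real mat2 \<Rightarrow> complex) \<Rightarrow> bool" where
  "has_fourier_expansion F a \<longleftrightarrow> (\<forall>\<tau>\<in>siegel_h2.
     ((\<lambda>T. a T * exp (2 * of_real pi * \<i> * trace (map_matrix complex_of_real T ** \<tau>)))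
        has_sum F \<tau>) fourier_index)"

section \<open>Hecke operators\<close>

definition delta :: "nat \<Rightarrow> real mat4" where
  "delta q = block (diag2 (real q) (real q)) 0 0 (diag2 1 1)"

definition delta1 :: "nat \<Rightarrow> real mat4" where
  "delta1 q = block (diag2 (real q) 1) 0 0 (diag2 (1 / real q) 1)"

definition hecke_subgroup :: "nat \<Rightarrow> real mat4 \<Rightarrow> int mat4 set" where
  "hecke_subgroup N d = {\<gamma> \<in> Gamma0 N. \<exists>\<gamma>'\<in>Gamma0 N.
     map_matrix real_of_int \<gamma> = d ** map_matrix real_of_int \<gamma>' ** matrix_inv d}"

definition hecke_cosets :: "nat \<Rightarrow> real mat4 \<Rightarrow> int mat4 set set" where
  "hecke_cosets N d = (\<lambda>\<gamma>. (\<lambda>h. h ** \<gamma>) ` hecke_subgroup N d) ` Gamma0 N"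

text \<open>
  For \<open>d\<close> equal to \<open>delta q\<close> or \<open>delta1 q\<close> with \<open>q\<close> prime, the coset space is finite; on modular
  forms the summand does not depend on the representative, since conjugation by \<open>d\<close> preserves
  the determinant of the lower right block.
\<close>

definition hecke_op :: "real mat4 \<Rightarrow> nat \<Rightarrow> nat \<Rightarrow> nat \<Rightarrow> (int \<Rightarrow> complex) \<Rightarrow>
    (complex mat2 \<Rightarrow> complex) \<Rightarrow> complex mat2 \<Rightarrow> complex" where
  "hecke_op d q k N chi F \<tau> = of_nat q powi (int k - 3) *
     (\<Sum>c\<in>hecke_cosets N d. let \<gamma> = (SOME \<gamma>. \<gamma> \<in> c) in
        cnj (chi (det (blockD \<gamma>))) * slash k F (matrix_inv d ** map_matrix real_of_int \<gamma>) \<tau>)"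

definition hecke_T :: "nat \<Rightarrow> nat \<Rightarrow> nat \<Rightarrow> (int \<Rightarrow> complex) \<Rightarrow>
    (complex mat2 \<Rightarrow> complex) \<Rightarrow> complex mat2 \<Rightarrow> complex" where
  "hecke_T q = hecke_op (delta q) q"

text \<open>\<open>hecke_T1 q\<close> is the operator \<open>T\<^sub>1(q\<^sup>2)\<close>, and similarly for \<open>hecke_T1_tilde q\<close>.\<close>

definition hecke_T1 :: "nat \<Rightarrow> nat \<Rightarrow> nat \<Rightarrow> (int \<Rightarrow> complex) \<Rightarrow>
    (complex mat2 \<Rightarrow> complex) \<Rightarrow> complex mat2 \<Rightarrow> complex" where
  "hecke_T1 q = hecke_op (delta1 q) q"

definition hecke_T1_tilde :: "nat \<Rightarrow> nat \<Rightarrow> nat \<Rightarrow> (int \<Rightarrow> complex) \<Rightarrow>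
    (complex mat2 \<Rightarrow> complex) \<Rightarrow> complex mat2 \<Rightarrow> complex" where
  "hecke_T1_tilde q k N chi F \<tau> =
     hecke_T1 q k N chi F \<tau> + chi (int q) * of_nat q powi (int k - 3) * (of_nat q + 1) * F \<tau>"

definition eigenform :: "((complex mat2 \<Rightarrow> complex) \<Rightarrow> complex mat2 \<Rightarrow> complex) \<Rightarrow>
    (complex mat2 \<Rightarrow> complex) \<Rightarrow> bool" where
  "eigenform T F \<longleftrightarrow> (\<exists>c. \<forall>\<tau>\<in>siegel_h2. T F \<tau> = c * F \<tau>)"

end

(*
  For T = q^r m D with q not dividing m, let A_r be the coefficient a(q^r m D), and let S_r be the
  sum of a(q^r m D[V]) over the q + 1 integral V of determinant q up to right multiplication by
  unimodular matrices.  Comparing Fourier coefficients, T(q) yields a linear relation between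
  A_(r+1), A_r, A_(r-1) and S_(r-1), and T_1(q^2) yields one between S_r, A_r and S_(r-2); the
  coefficients do not depend on m, and those of A_(r+1) and S_r do not vanish.  If D is anisotropic
  modulo q, then S_(-1) = S_(-2) = 0, while for q = p the only isotropic line contributes a multiple
  of A_0 to S_(-1) and nothing to S_(-2).  Hence A_r = P_r A_0 with P_r independent of m, and the
  multiplicativity follows prime by prime.  If q divides the level, the terms with S drop out.
*)
theory Submission
  imports Defs
begin

section \<open>Matrices in two by two blocks\<close>

text \<open>The relation from \<open>T(q)\<close> alone does not close up, since each step brings in
  a new sum over the \<open>V\<close>; the relation from \<open>T_1(q^2)\<close> eliminates it. Both
  arise by replacing cosets with upper triangular matrices, which send \<open>\<tau>\<close> to
  \<open>s A (\<tau> + X) A^t\<close>. On a Fourier series such a map transforms the index and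
  multiplies the coefficient by a root of unity. The transformed index can leave the lattice on
  which \<open>a\<close> is meaningful, hence \<open>coeff0\<close>, and all series are compared on
  one lattice with denominators \<open>q^2\<close>. The leading coefficients are non-zero because
  the integral translations \<open>X\<close> of the leading class act trivially, so that equal terms
  add up. The only factor that could see \<open>m\<close> is an exponential sum over the fractional
  translations in \<open>T_1(q^2)\<close>. For each line modulo \<open>q\<close> it depends only on
  whether \<open>q\<close> divides \<open>q^r m\<close> times the value of the form \<open>D\<close>
  on that line, so a factor \<open>m\<close> prime to \<open>q\<close> does not change it. The
  scalar by which \<open>T_1(q^2)\<close> is shifted supplies the missing zero translation in this
  sum; being a scalar, it does not change the eigenforms.\<close>

definition m22 :: "'a::zero \<Rightarrow> 'a \<Rightarrow> 'a \<Rightarrow> 'a \<Rightarrow> 'a mat2" where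
  "m22 a b c d = vector [vector [a, b], vector [c, d]]"

lemma m22_nth [simp]:
  "m22 a b c d $ 1 $ 1 = a" "m22 a b c d $ 1 $ 2 = b"
  "m22 a b c d $ 2 $ 1 = c" "m22 a b c d $ 2 $ 2 = d"
  by (simp_all add: m22_def)

lemma mat2_eq_iff:
  "A = B \<longleftrightarrow> A $ 1 $ 1 = B $ 1 $ 1 \<and> A $ 1 $ 2 = B $ 1 $ 2 \<and> A $ 2 $ 1 = B $ 2 $ 1 \<and> A $ 2 $ 2 = B $ 2 $ 2"
  for A B :: "'a mat2"
  by (auto simp: vec_eq_iff forall_2)

lemma m22_eq_iff [simp]: "m22 a b c d = m22 a' b' c' d' \<longleftrightarrow> a = a' \<and> b = b' \<and> c = c' \<and> d = d'"
  by (simp add: mat2_eq_iff)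

lemma m22_eta: "m22 (A $ 1 $ 1) (A $ 1 $ 2) (A $ 2 $ 1) (A $ 2 $ 2) = A"
  by (simp add: mat2_eq_iff)

lemma m22_cases: obtains a b c d where "A = m22 a b c d"
  using m22_eta[of A] by metis

lemma m22_mult [simp]:
  "m22 a b c d ** m22 a' b' c' d' =
     m22 (a * a' + b * c') (a * b' + b * d') (c * a' + d * c') (c * b' + d * d')"
  for a b c d :: "'a::semiring_1"
  by (simp add: mat2_eq_iff matrix_matrix_mult_def sum_2)

lemma m22_add [simp]: "m22 a b c d + m22 a' b' c' d' = m22 (a + a') (b + b') (c + c') (d + d')"
  for a b c d :: "'a::monoid_add"
  by (simp add: mat2_eq_iff)

lemma m22_uminus [simp]: "- m22 a b c d = m22 (-a) (-b) (-c) (-d)" for a b c d :: "'a::group_add"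
  by (simp add: mat2_eq_iff)

lemma m22_scaleR [simp]: "s *\<^sub>R m22 a b c d = m22 (s *\<^sub>R a) (s *\<^sub>R b) (s *\<^sub>R c) (s *\<^sub>R d)"
  for a b c d :: "'a::real_vector"
  by (simp add: mat2_eq_iff)

lemma m22_transpose [simp]: "transpose (m22 a b c d) = m22 a c b d"
  by (simp add: mat2_eq_iff transpose_def)

lemma mat_m22: "mat x = m22 x 0 0 x"
  by (simp add: mat2_eq_iff mat_def)

lemma zero_m22: "(0 :: 'a::zero mat2) = m22 0 0 0 0"
  by (simp add: mat2_eq_iff)

lemma diag2_m22: "diag2 x y = m22 x 0 0 y"
  by (simp add: diag2_def m22_def)

lemma map_matrix_m22 [simp]: "map_matrix f (m22 a b c d) = m22 (f a) (f b) (f c) (f d)"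
  by (simp add: mat2_eq_iff)

lemma det_m22 [simp]: "det (m22 a b c d) = a * d - b * c"
  by (simp add: det_2)

lemma trace_m22 [simp]: "trace (m22 a b c d) = a + d" for a b c d :: "'a::semiring_1"
  by (simp add: trace_def sum_2)

section \<open>Four by four matrices as two by two arrays of blocks\<close>

lemma sum_plus_UNIV: "(\<Sum>i\<in>(UNIV :: ('b::finite + 'c::finite) set). f i) = (\<Sum>r\<in>UNIV. f (Inl r)) + (\<Sum>s\<in>UNIV. f (Inr s))"
  for f :: "_ \<Rightarrow> 'a::comm_monoid_add"
  by (simp add: UNIV_Plus_UNIV[symmetric] sum.Plus del: UNIV_Plus_UNIV)

lemma block_nth [simp]:
  "block A B C D $ Inl r $ Inl s = A $ r $ s" "block A B C D $ Inl r $ Inr s = B $ r $ s"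
  "block A B C D $ Inr r $ Inl s = C $ r $ s" "block A B C D $ Inr r $ Inr s = D $ r $ s"
  by (simp_all add: block_def)

lemma blocks_block [simp]:
  "blockA (block A B C D) = A" "blockB (block A B C D) = B"
  "blockC (block A B C D) = C" "blockD (block A B C D) = D"
  by (simp_all add: vec_eq_iff blockA_def blockB_def blockC_def blockD_def)

lemma mat4_eq_iff:
  "M = M' \<longleftrightarrow> blockA M = blockA M' \<and> blockB M = blockB M' \<and> blockC M = blockC M' \<and> blockD M = blockD M'"
  for M M' :: "'a mat4"
proof
  assume eq: "blockA M = blockA M' \<and> blockB M = blockB M' \<and> blockC M = blockC M' \<and> blockD M = blockD M'"
  have "M $ i $ j = M' $ i $ j" for i j
  proof (cases i; cases j)
  qed (use eq in \<open>auto simp: vec_eq_iff blockA_def blockB_def blockC_def blockD_def\<close>)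
  then show "M = M'" by (simp add: vec_eq_iff)
qed auto

lemma block_eq_iff [simp]:
  "block A B C D = block A' B' C' D' \<longleftrightarrow> A = A' \<and> B = B' \<and> C = C' \<and> D = D'"
  by (simp add: mat4_eq_iff)

lemma block_eta: "block (blockA M) (blockB M) (blockC M) (blockD M) = M"
  by (simp add: mat4_eq_iff)

lemma mat4_cases: obtains A B C D where "M = block A B C D"
  using block_eta[of M] by metis

lemma block_mult [simp]:
  "block A B C D ** block A' B' C' D' =
     block (A ** A' + B ** C') (A ** B' + B ** D') (C ** A' + D ** C') (C ** B' + D ** D')"
  for A :: "'a::semiring_1 mat2"
  by (simp add: mat4_eq_iff vec_eq_iff blockA_def blockB_def blockC_def blockD_def
      matrix_matrix_mult_def sum_plus_UNIV)

lemma transpose_block [simp]: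
  "transpose (block A B C D) = block (transpose A) (transpose C) (transpose B) (transpose D)"
  by (simp add: mat4_eq_iff vec_eq_iff blockA_def blockB_def blockC_def blockD_def transpose_def)

lemma map_matrix_block [simp]:
  "map_matrix f (block A B C D) = block (map_matrix f A) (map_matrix f B) (map_matrix f C) (map_matrix f D)"
  by (simp add: mat4_eq_iff vec_eq_iff blockA_def blockB_def blockC_def blockD_def)

lemma blocks_map_matrix:
  "blockA (map_matrix f M) = map_matrix f (blockA M)" "blockB (map_matrix f M) = map_matrix f (blockB M)"
  "blockC (map_matrix f M) = map_matrix f (blockC M)" "blockD (map_matrix f M) = map_matrix f (blockD M)"
  by (simp_all add: vec_eq_iff blockA_def blockB_def blockC_def blockD_def)

lemma mat_block: "mat x = block (mat x) 0 0 (mat x)"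
  by (simp add: mat4_eq_iff vec_eq_iff blockA_def blockB_def blockC_def blockD_def mat_def)

lemma uminus_block [simp]: "- block A B C D = block (-A) (-B) (-C) (-D)" for A :: "'a::group_add mat2"
  by (simp add: mat4_eq_iff vec_eq_iff blockA_def blockB_def blockC_def blockD_def)

lemma map_matrix_mult:
  fixes A :: "'a::semiring_1^'k^'m" and B :: "'a^'n^'k" and f :: "'a \<Rightarrow> 'b::semiring_1"
  assumes "\<And>x y. f (x * y) = f x * f y" and "\<And>x y. f (x + y) = f x + f y" and "f 0 = 0"
  shows "map_matrix f (A ** B) = map_matrix f A ** map_matrix f B"
proof -
  have "f (sum h I) = (\<Sum>i\<in>I. f (h i))" if "finite I" for h and I :: "'k set"
    using that by (induction I) (auto simp: assms)
  note this[OF finite]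
  then show ?thesis by (simp add: vec_eq_iff matrix_matrix_mult_def assms)
qed

abbreviation ratm :: "int mat4 \<Rightarrow> real mat4" where "ratm \<equiv> map_matrix real_of_int"
abbreviation cmplx :: "real mat2 \<Rightarrow> complex mat2" where "cmplx \<equiv> map_matrix complex_of_real"

lemma ratm_mult: "ratm (A ** B) = ratm A ** ratm B"
  by (rule map_matrix_mult) auto

lemma ratm_eq_iff [simp]: "ratm A = ratm B \<longleftrightarrow> A = B"
  by (simp add: vec_eq_iff)

lemma ratm_mat [simp]: "ratm (mat 1) = mat 1"
  by (simp add: vec_eq_iff mat_def)

lemma cmplx_mult: "cmplx (A ** B) = cmplx A ** cmplx B"
  by (rule map_matrix_mult) auto

lemma cmplx_add: "cmplx (A + B) = cmplx A + cmplx B"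
  by (simp add: vec_eq_iff)

lemma cmplx_mat [simp]: "cmplx (mat 1) = mat 1"
  by (simp add: vec_eq_iff mat_def)

lemma det_cmplx [simp]: "det (cmplx A) = complex_of_real (det A)"
  by (simp add: det_2)

lemma matrix_inv_eqI:
  fixes A B :: "'a::field^'n^'n"
  assumes "A ** B = mat 1"
  shows "matrix_inv A = B"
proof -
  have "B ** A = mat 1" using assms matrix_left_right_inverse by blast
  then have "matrix_inv A ** A = mat 1"
    unfolding matrix_inv_def using assms by (rule_tac someI2[of _ B]) auto
  then show ?thesis by (metis assms matrix_mul_assoc matrix_mul_lid matrix_mul_rid)
qed

lemma mult_matrix_inv:
  fixes A :: "'a::field^'n^'n"
  assumes "det A \<noteq> 0"
  shows "A ** matrix_inv A = mat 1" "matrix_inv A ** A = mat 1"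
proof -
  obtain B where "A ** B = mat 1"
    using assms by (auto simp: invertible_det_nz[symmetric] invertible_def)
  then show "A ** matrix_inv A = mat 1" "matrix_inv A ** A = mat 1"
    using matrix_inv_eqI[of A B] matrix_left_right_inverse[of A B] by auto
qed

lemma matrix_mult_uminus_left: "(- A) ** B = - (A ** B)" for A :: "'a::ring_1^'n^'m"
  by (simp add: vec_eq_iff matrix_matrix_mult_def sum_negf)

lemma matrix_mult_uminus_right: "A ** (- B) = - (A ** B)" for A :: "'a::ring_1^'n^'m"
  by (simp add: vec_eq_iff matrix_matrix_mult_def sum_negf)

section \<open>Symplectic matrices\<close>

lemma symp_J_m22: "symp_J = block (m22 0 0 0 0) (m22 1 0 0 1) (m22 (-1) 0 0 (-1)) (m22 0 0 0 0)"
  by (simp add: symp_J_def mat_m22 zero_m22)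

lemma symp_J_square: "symp_J ** symp_J = - (mat 1 :: 'a::comm_ring_1 mat4)"
  by (simp add: symp_J_m22 mat_block mat_m22 zero_m22)

lemma ratm_symp_J: "ratm symp_J = symp_J"
  by (simp add: symp_J_m22)

lemma ratm_transpose: "ratm (transpose A) = transpose (ratm A)"
  by (simp add: vec_eq_iff transpose_def)

lemma Sp2_iff_ratm: "M \<in> Sp2 \<longleftrightarrow> ratm M \<in> Sp2"
  by (simp add: Sp2_def ratm_mult[symmetric] ratm_transpose[symmetric] ratm_symp_J[symmetric])

lemma Sp2_mult: "A \<in> Sp2 \<Longrightarrow> B \<in> Sp2 \<Longrightarrow> A ** B \<in> Sp2"
  unfolding Sp2_def mem_Collect_eq matrix_transpose_mul by (metis matrix_mul_assoc)

text \<open>The inverse of a symplectic matrix in closed form; it involves no division and so stays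
  inside the integral group.\<close>

definition symp_inv :: "'a::comm_ring_1 mat4 \<Rightarrow> 'a mat4" where
  "symp_inv M = block (transpose (blockD M)) (- transpose (blockB M)) (- transpose (blockC M)) (transpose (blockA M))"

lemma symp_inv_eq: "symp_inv M = - (symp_J ** transpose M ** symp_J)"
proof -
  obtain A B C D where M: "M = block A B C D" using mat4_cases .
  obtain a b c d where A: "A = m22 a b c d" using m22_cases .
  obtain a b c d where B: "B = m22 a b c d" using m22_cases .
  obtain a b c d where C: "C = m22 a b c d" using m22_cases .
  obtain a b c d where D: "D = m22 a b c d" using m22_cases .
  show ?thesis by (simp add: symp_inv_def M A B C D symp_J_m22)
qed

lemma symp_inv_left_real: 
  fixes M :: "real mat4"
  assumes "M \<in> Sp2"
  shows "symp_inv M ** M = mat 1" "M ** symp_inv M = mat 1"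
proof -
  have "symp_inv M ** M = - (symp_J ** (transpose M ** symp_J ** M))"
    by (simp add: symp_inv_eq matrix_mul_assoc matrix_mult_uminus_left)
  also have "\<dots> = mat 1" using assms by (simp add: Sp2_def symp_J_square)
  finally show "symp_inv M ** M = mat 1" .
  then show "M ** symp_inv M = mat 1" using matrix_left_right_inverse by blast
qed

lemma ratm_symp_inv: "ratm (symp_inv M) = symp_inv (ratm M)"
  by (simp add: symp_inv_def mat4_eq_iff blocks_map_matrix vec_eq_iff transpose_def)

text \<open>Over a field a left inverse is a right inverse, so both identities are taken over the
  reals and pulled back along the injection \<open>ratm\<close>.\<close>

lemma symp_inv_left:
  fixes M :: "int mat4"
  assumes "M \<in> Sp2" 
  shows "symp_inv M ** M = mat 1" "M ** symp_inv M = mat 1"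
proof -
  have "ratm M \<in> Sp2" using assms Sp2_iff_ratm by blast
  note symp_inv_left_real[OF this]
  then show "symp_inv M ** M = mat 1" "M ** symp_inv M = mat 1"
    by (simp_all only: ratm_symp_inv[symmetric] ratm_mult[symmetric] ratm_mat[symmetric] ratm_eq_iff)
qed

lemma Sp2_symp_inv:
  fixes M :: "int mat4"
  assumes "M \<in> Sp2"
  shows "symp_inv M \<in> Sp2"
proof -
  let ?L = "symp_inv M"
  have "symp_J = transpose (M ** ?L) ** symp_J ** (M ** ?L)"
    using symp_inv_left[OF assms] by simp
  also have "\<dots> = transpose ?L ** (transpose M ** symp_J ** M) ** ?L"
    by (simp add: matrix_transpose_mul matrix_mul_assoc)
  finally show ?thesis using assms by (simp add: Sp2_def)
qed

lemma Gamma0_mult: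
  assumes "A \<in> Gamma0 N" "B \<in> Gamma0 N"
  shows "A ** B \<in> Gamma0 N"
proof -
  obtain A1 A2 A3 A4 where A: "A = block A1 A2 A3 A4" using mat4_cases .
  obtain B1 B2 B3 B4 where B: "B = block B1 B2 B3 B4" using mat4_cases .
  have "A ** B \<in> Sp2" using assms Sp2_mult by (auto simp: Gamma0_def)
  moreover have "int N dvd (A3 ** B1 + A4 ** B3) $ r $ s" for r s
    using assms by (auto simp: Gamma0_def A B matrix_matrix_mult_def intro!: dvd_add dvd_sum)
  ultimately show ?thesis by (simp add: Gamma0_def A B)
qed

lemma Gamma0_symp_inv: "M \<in> Gamma0 N \<Longrightarrow> symp_inv M \<in> Gamma0 N"
  using Sp2_symp_inv[of M] by (auto simp: Gamma0_def symp_inv_def transpose_def)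

lemma Gamma0_one: "mat 1 \<in> Gamma0 N"
proof -
  have "mat 1 \<in> (Sp2 :: int mat4 set)" by (simp add: Sp2_def)
  then show ?thesis by (simp add: Gamma0_def mat_block)
qed

lemma Gamma0_inv: "M \<in> Gamma0 N \<Longrightarrow> symp_inv M ** M = mat 1" "M \<in> Gamma0 N \<Longrightarrow> M ** symp_inv M = mat 1"
  using symp_inv_left by (auto simp: Gamma0_def)

lemma Sp2_det_sq: "M \<in> Sp2 \<Longrightarrow> det M ^ 2 = 1" for M :: "real mat4"
proof -
  assume "M \<in> Sp2"
  then have "transpose M ** symp_J ** M = symp_J" by (simp add: Sp2_def)
  then have "det M * det (symp_J :: real mat4) * det M = det (symp_J :: real mat4)"
    by (metis det_mul det_transpose)
  moreover have "det (symp_J :: real mat4) \<noteq> 0"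
  proof -
    have "symp_J ** (- symp_J) = (mat 1 :: real mat4)"
      by (simp add: symp_J_m22 mat_block mat_m22 zero_m22)
    then show ?thesis by (metis det_I det_mul mult_zero_left zero_neq_one)
  qed
  ultimately show ?thesis by (simp add: power2_eq_square)
qed

text \<open>This is \<open>M ** symp_inv M = mat 1\<close> read through \<open>symp_inv_eq\<close>.
  The coset reductions work with the resulting relations between rows.\<close>

lemma Sp2_rows:
  fixes M :: "int mat4"
  assumes "M \<in> Sp2"
  shows "M ** symp_J ** transpose M = symp_J"
proof -
  let ?P = "M ** symp_J ** transpose M"
  have "M ** symp_inv M = mat 1" using symp_inv_left[OF assms] by simp
  moreover have "M ** symp_inv M = - (?P ** symp_J)"
    by (simp add: symp_inv_eq matrix_mul_assoc matrix_mult_uminus_right)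
  ultimately have "?P ** symp_J = - mat 1" by (metis minus_equation_iff)
  then have "?P ** symp_J ** symp_J = - symp_J"
    by (simp add: matrix_mult_uminus_left)
  then have "- ?P = - symp_J"
    by (simp add: matrix_mul_assoc[symmetric] symp_J_square matrix_mult_uminus_right)
  then show ?thesis by simp
qed

section \<open>The slash action and Fourier expansions\<close>

lemma matrix_add_rdistrib: "(A + B) ** C = A ** C + B ** C" for A :: "'a::semiring_1^'n^'m"
  by (simp add: vec_eq_iff matrix_matrix_mult_def sum.distrib distrib_right)

text \<open>
  Invertibility of the automorphy factor need not be known: if its determinant is \<open>0\<close>, both
  sides vanish, because \<open>0 powi (- k) = 0\<close> for \<open>k > 0\<close>.  Likewise a determinant \<open>-1\<close> would be
  harmless, since \<open>ln\<close> is even and hence \<open>(-1) powr x = 1\<close>.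
\<close>

lemma slash_ratm_mult_upper:
  fixes g :: "int mat4" and A1 B1 D1 Di :: "real mat2"
  assumes mf: "siegel_modular_form k N chi F" and g: "g \<in> Gamma0 N" and "k > 0"
    and M: "M = ratm g ** block A1 B1 0 D1" and D1: "D1 ** Di = mat 1"
    and \<tau>': "\<tau>' = (cmplx A1 ** \<tau> + cmplx B1) ** cmplx Di" "\<tau>' \<in> siegel_h2"
  shows "slash k F M \<tau> = of_real (det M powr (real k / 2)) * of_real (det D1) powi (- int k) *
           (chi (det (blockD g)) * F \<tau>')"
proof -
  define GA GB GC GD where "GA = blockA (ratm g)" and "GB = blockB (ratm g)"
    and "GC = blockC (ratm g)" and "GD = blockD (ratm g)"
  note G_defs = GA_def GB_def GC_def GD_def
  define gA gB gC gD where "gA = cmplx GA" and "gB = cmplx GB" and "gC = cmplx GC" and "gD = cmplx GD"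
  note g_defs = gA_def gB_def gC_def gD_def
  have rg: "ratm g = block GA GB GC GD"
    unfolding G_defs by (rule block_eta[symmetric])
  have "ratm g \<in> Sp2" using g Sp2_iff_ratm by (auto simp: Gamma0_def)
  then have "det (ratm g) ^ 2 = 1" by (rule Sp2_det_sq)
  then have "det (ratm g) = 1 \<or> det (ratm g) = -1" by (simp add: power2_eq_1_iff)
  then have det_g: "det (ratm g) powr x = 1" for x
    by (auto simp: powr_def ln_minus)
  have cD: "cmplx D1 ** cmplx Di = mat 1" "cmplx Di ** cmplx D1 = mat 1"
    using D1 matrix_left_right_inverse[of D1 Di] by (simp_all add: cmplx_mult[symmetric])
  have canc: "P ** cmplx D1 ** cmplx Di = P" for P
    by (simp add: matrix_mul_assoc[symmetric] cD)
  have \<tau>'D: "cmplx A1 ** \<tau> + cmplx B1 = \<tau>' ** cmplx D1"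
    by (simp add: \<tau>'(1) matrix_mul_assoc[symmetric] cD)
  have Mb: "M = block (GA ** A1) (GA ** B1 + GB ** D1) (GC ** A1) (GC ** B1 + GD ** D1)"
    unfolding M rg by simp
  have blocks: "blockA M = GA ** A1" "blockB M = GA ** B1 + GB ** D1"
     "blockC M = GC ** A1" "blockD M = GC ** B1 + GD ** D1"
    unfolding Mb by simp_all
  \<comment> \<open>Cocycle rule: the automorphy factor of the product is that of \<open>g\<close>
    at \<open>\<tau>'\<close> times \<open>D1\<close>. The numerator acquires the same right factor,
    which then cancels in the quotient.\<close>
  have den: "cmplx (blockC M) ** \<tau> + cmplx (blockD M) = (gC ** \<tau>' + gD) ** cmplx D1"
    unfolding blocks g_defs cmplx_mult cmplx_add
    by (simp add: matrix_add_rdistrib matrix_add_ldistrib matrix_mul_assoc[symmetric] \<tau>'D[symmetric] add.assoc)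
  have num: "cmplx (blockA M) ** \<tau> + cmplx (blockB M) = (gA ** \<tau>' + gB) ** cmplx D1"
    unfolding blocks g_defs cmplx_mult cmplx_add
    by (simp add: matrix_add_rdistrib matrix_add_ldistrib matrix_mul_assoc[symmetric] \<tau>'D[symmetric] add.assoc)
  have F: "det (gC ** \<tau>' + gD) powi (- int k) * F ((gA ** \<tau>' + gB) ** matrix_inv (gC ** \<tau>' + gD))
      = chi (det (blockD g)) * F \<tau>'"
  proof -
    have "slash k F (ratm g) \<tau>' = chi (det (blockD g)) * F \<tau>'"
      using mf g \<tau>'(2) by (simp add: siegel_modular_form_def)
    then show ?thesis by (simp add: slash_def Let_def det_g g_defs G_defs)
  qed
  have "slash k F M \<tau> = of_real (det M powr (real k / 2)) * (of_real (det D1) powi (- int k) *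
      (det (gC ** \<tau>' + gD) powi (- int k) * F ((gA ** \<tau>' + gB) ** matrix_inv (gC ** \<tau>' + gD))))"
  proof (cases "det (gC ** \<tau>' + gD) = 0")
    case True
    then show ?thesis using \<open>k > 0\<close> by (simp add: slash_def den num det_mul power_int_minus)
  next
    case False
    note inv = mult_matrix_inv[OF this]
    have "matrix_inv ((gC ** \<tau>' + gD) ** cmplx D1) = cmplx Di ** matrix_inv (gC ** \<tau>' + gD)"
    proof (rule matrix_inv_eqI)
      show "(gC ** \<tau>' + gD) ** cmplx D1 ** (cmplx Di ** matrix_inv (gC ** \<tau>' + gD)) = mat 1"
        by (simp add: matrix_mul_assoc canc inv(1))
    qed
    then have "(gA ** \<tau>' + gB) ** cmplx D1 ** matrix_inv ((gC ** \<tau>' + gD) ** cmplx D1)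
        = (gA ** \<tau>' + gB) ** matrix_inv (gC ** \<tau>' + gD)"
      by (simp add: matrix_mul_assoc canc)
    then show ?thesis
      by (simp add: slash_def den num det_mul power_int_mult_distrib)
  qed
  then show ?thesis by (simp add: F mult.assoc)
qed

text \<open>The imaginary part becomes \<open>s\<close> times the congruence transform of
  \<open>Y\<close> by \<open>A\<close>, which is positive definite because
  \<open>transpose A\<close> is injective. These are the maps by which the upper triangular
  representatives act.\<close>

lemma siegel_h2_move:
  assumes "\<tau> \<in> siegel_h2" and X: "transpose X = X" and "s > 0" and A: "A ** Ai = mat 1"
  shows "cmplx (s *\<^sub>R A) ** (\<tau> + cmplx X) ** cmplx (transpose A) \<in> siegel_h2"
proof -
  obtain X0 Y where \<tau>: "\<tau> = (\<chi> r s. Complex (X0 $ r $ s) (Y $ r $ s))" and X0: "transpose X0 = X0"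
    and Y: "pos_def Y" using assms(1) unfolding siegel_h2_def by blast
  define X1 Y1 where "X1 = s *\<^sub>R (A ** (X0 + X) ** transpose A)" and "Y1 = s *\<^sub>R (A ** Y ** transpose A)"
  obtain a b c d where Am: "A = m22 a b c d" using m22_cases .
  obtain x1 x2 x3 x4 where Xm: "X = m22 x1 x2 x3 x4" using m22_cases .
  obtain y1 y2 y3 y4 where X0m: "X0 = m22 y1 y2 y3 y4" using m22_cases .
  obtain z1 z2 z3 z4 where Ym: "Y = m22 z1 z2 z3 z4" using m22_cases .
  have YS: "transpose Y = Y" using Y by (simp add: pos_def_def)
  have sym: "x3 = x2" "y3 = y2" "z3 = z2"
    using arg_cong[OF X, of "\<lambda>M. M $ 2 $ 1"] arg_cong[OF X0, of "\<lambda>M. M $ 2 $ 1"]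
      arg_cong[OF YS, of "\<lambda>M. M $ 2 $ 1"]
    by (simp_all add: Xm X0m Ym)
  have \<tau>m: "\<tau> = m22 (Complex y1 z1) (Complex y2 z2) (Complex y3 z3) (Complex y4 z4)"
    by (simp add: \<tau> mat2_eq_iff X0m Ym)
  have "cmplx (s *\<^sub>R A) ** (\<tau> + cmplx X) ** cmplx (transpose A) = (\<chi> r s. Complex (X1 $ r $ s) (Y1 $ r $ s))"
    by (simp add: \<tau>m Am Xm mat2_eq_iff X1_def Y1_def X0m Ym complex_eq_iff algebra_simps)
  moreover have "transpose X1 = X1"
    by (simp add: X1_def Am Xm X0m sym algebra_simps)
  moreover have "pos_def Y1"
    unfolding pos_def_def
  proof (intro conjI allI impI)
    show "transpose Y1 = Y1" by (simp add: Y1_def Am Ym sym algebra_simps)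
    fix v :: "real ^ 2" assume v: "v \<noteq> 0"
    define u where "u = transpose A *v v"
    have "transpose Ai ** transpose A = mat 1"
      by (simp add: matrix_transpose_mul[symmetric] A)
    then have "transpose Ai *v u = v" unfolding u_def matrix_vector_mul_assoc by simp
    then have "u \<noteq> 0" using v by auto
    then have "u \<bullet> (Y *v u) > 0" using Y by (simp add: pos_def_def)
    moreover have "v \<bullet> (Y1 *v v) = s * (u \<bullet> (Y *v u))"
      by (simp add: u_def Y1_def Am Ym inner_vec_def sum_2 matrix_vector_mult_def algebra_simps)
    ultimately show "v \<bullet> (Y1 *v v) > 0" using \<open>s > 0\<close> by simp
  qed
  ultimately show ?thesis unfolding siegel_h2_def by blast
qed

text \<open>Frequencies with denominator dividing \<open>R\<close>: they occur in \<open>F\<close> composed with a rational upper triangular matrix.\<close>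

definition half_int :: "real \<Rightarrow> real mat2 set" where
  "half_int R = {T. T $ 2 $ 1 = T $ 1 $ 2 \<and> R * T $ 1 $ 1 \<in> \<int> \<and> 2 * (R * T $ 1 $ 2) \<in> \<int> \<and> R * T $ 2 $ 2 \<in> \<int>}"

abbreviation exp_tr :: "real mat2 \<Rightarrow> complex mat2 \<Rightarrow> complex" where
  "exp_tr T \<tau> \<equiv> exp (2 * of_real pi * \<i> * trace (cmplx T ** \<tau>))"

abbreviation cis2pi :: "real \<Rightarrow> complex" where "cis2pi x \<equiv> cis (2 * pi * x)"

lemma exp_tr_add_real: "exp_tr T (\<tau> + cmplx X) = exp_tr T \<tau> * cis2pi (trace (T ** X))"
  by (cases T rule: m22_cases, cases X rule: m22_cases, cases \<tau> rule: m22_cases)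
     (simp add: exp_add[symmetric] cis_conv_exp algebra_simps)

text \<open>Orthogonality of characters of the integers modulo \<open>M\<close>: a geometric series
  in a root of unity.\<close>

lemma sum_cis2pi:
  fixes n :: int and M :: nat
  assumes "M > 0"
  shows "(\<Sum>x<M. cis2pi (real x * (of_int n / real M))) = (if int M dvd n then of_nat M else 0)"
proof -
  define z where "z = cis2pi (of_int n / real M)"
  have pw: "cis2pi (real x * (of_int n / real M)) = z ^ x" for x
    unfolding z_def Complex.DeMoivre by (simp only: mult_ac)
  have zM: "z ^ M = 1"
    using assms by (simp add: pw[symmetric])
  have "z = 1 \<longleftrightarrow> int M dvd n"
  proof -
    have "z = 1 \<longleftrightarrow> (\<exists>j::int. 2 * pi * (of_int n / real M) = of_int (2 * j) * pi)"
      by (simp add: z_def cis_conv_exp exp_eq_1)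
    also have "\<dots> \<longleftrightarrow> (\<exists>j::int. real_of_int n = real_of_int (int M * j))"
      using assms by (intro ex_cong1) (simp add: field_simps)
    also have "\<dots> \<longleftrightarrow> int M dvd n" unfolding of_int_eq_iff by (auto simp: dvd_def)
    finally show ?thesis .
  qed
  moreover have "(\<Sum>x<M. z ^ x) = 0" if "z \<noteq> 1"
    using that zM by (simp add: geometric_sum)
  ultimately show ?thesis unfolding pw by auto
qed


lemma has_sum_sum:
  fixes f :: "'i \<Rightarrow> 'a \<Rightarrow> 'b::topological_comm_monoid_add"
  assumes "finite I" and "\<And>i. i \<in> I \<Longrightarrow> (f i has_sum S i) A"
  shows "((\<lambda>x. \<Sum>i\<in>I. f i x) has_sum (\<Sum>i\<in>I. S i)) A"
  using assms by (induction I rule: finite_induct) (auto intro!: has_sum_add)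

text \<open>The sum factors into three character sums; the bounds turn divisibility by
  \<open>M\<close> into vanishing.\<close>

lemma sum_cs3:
  fixes n1 n2 n3 :: int and M :: nat
  assumes "M > 0" and "\<bar>n1\<bar> < int M" "\<bar>n2\<bar> < int M" "\<bar>n3\<bar> < int M"
  shows "(\<Sum>(x1,x2,x3) \<in> {..<M} \<times> {..<M} \<times> {..<M}.
      cis2pi (real x1 * (of_int n1 / real M) + real x2 * (of_int n2 / real M) + real x3 * (of_int n3 / real M)))
      = (if n1 = 0 \<and> n2 = 0 \<and> n3 = 0 then of_nat M ^ 3 else 0)"
proof -
  have "(\<Sum>(x1,x2,x3) \<in> {..<M} \<times> {..<M} \<times> {..<M}.
      cis2pi (real x1 * (of_int n1 / real M) + real x2 * (of_int n2 / real M) + real x3 * (of_int n3 / real M)))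
    = (\<Sum>x<M. cis2pi (real x * (of_int n1 / real M))) *
      ((\<Sum>x<M. cis2pi (real x * (of_int n2 / real M))) * (\<Sum>x<M. cis2pi (real x * (of_int n3 / real M))))"
    unfolding sum_product sum.cartesian_product
    by (intro sum.cong refl) (simp add: cis_mult ring_distribs add.assoc split: prod.splits)
  moreover have "int M dvd n \<longleftrightarrow> n = 0" if "\<bar>n\<bar> < int M" for n
    using that dvd_imp_le_int[of n "int M"] by auto
  ultimately show ?thesis
    using assms by (simp only: sum_cis2pi) (auto simp: power3_eq_cube)
qed

text \<open>
  Averaging over a finite grid of real translations isolates one coefficient up to the tail of an
  absolutely convergent series; no integration is needed.
\<close>

lemma expansion_unique:
  assumes "R > 0"
    and sum0: "\<And>\<tau>. \<tau> \<in> siegel_h2 \<Longrightarrow> ((\<lambda>T. b T * exp_tr T \<tau>) has_sum 0) (half_int R)"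
    and T0: "T0 \<in> half_int R"
  shows "b T0 = 0"
proof -
  let ?L = "half_int R"
  define \<tau>0 :: "complex mat2" where "\<tau>0 = m22 \<i> 0 0 \<i>"
  have h2: "\<tau>0 + cmplx X \<in> siegel_h2" if "transpose X = X" for X
  proof -
    have "\<tau>0 + cmplx X = (\<chi> r s. Complex (X $ r $ s) ((mat 1 :: real mat2) $ r $ s))"
      by (simp add: \<tau>0_def mat2_eq_iff complex_eq_iff mat_def)
    moreover have "pos_def (mat 1)" by (simp add: pos_def_def)
    ultimately show ?thesis unfolding siegel_h2_def using that by blast
  qed
  define c where "c T = b T * exp_tr T \<tau>0" for T
  have sumX: "((\<lambda>T. c T * cis2pi (trace (T ** X))) has_sum 0) ?L" if "transpose X = X" for X
    using sum0[OF h2[OF that]] by (simp only: c_def exp_tr_add_real mult.assoc[symmetric])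
  have "(c has_sum 0) ?L"
  proof -
    have "trace (T ** m22 0 0 0 0) = 0" for T :: "real mat2"
      by (cases T rule: m22_cases) simp
    then show ?thesis using sumX[of "m22 0 0 0 0"] by simp
  qed
  then have abs: "(\<lambda>T. norm (c T)) summable_on ?L"
    using has_sum_imp_summable summable_on_iff_abs_summable_on_complex by blast
  have "norm (c T0) \<le> 0 + \<epsilon>" if "\<epsilon> > 0" for \<epsilon>
  proof -
    \<comment> \<open>Absolute convergence leaves a tail of size at most \<open>\<epsilon>\<close>
      outside a finite set of frequencies.\<close>
    obtain K0 where K0: "finite K0" "K0 \<subseteq> ?L"
      and dist: "dist (\<Sum>T\<in>K0. norm (c T)) (infsum (\<lambda>T. norm (c T)) ?L) \<le> \<epsilon>"
      using infsum_finite_approximation[OF abs \<open>\<epsilon> > 0\<close>] by blast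
    define K where "K = insert T0 K0"
    have K: "finite K" "K \<subseteq> ?L" "T0 \<in> K" using K0 T0 by (auto simp: K_def)
    have tail: "((\<lambda>T. norm (c T)) has_sum (infsum (\<lambda>T. norm (c T)) ?L - (\<Sum>T\<in>K. norm (c T)))) (?L - K)"
      by (rule has_sum_Diff[OF has_sum_infsum[OF abs] has_sum_finite[OF K(1)] K(2)])
    have "(\<Sum>T\<in>K0. norm (c T)) \<le> (\<Sum>T\<in>K. norm (c T))"
      using K0 by (auto simp: K_def intro!: sum_mono2)
    then have tail_le: "infsum (\<lambda>T. norm (c T)) ?L - (\<Sum>T\<in>K. norm (c T)) \<le> \<epsilon>"
      using dist by (auto simp: dist_real_def)
    define n1 n2 n3 where "n1 T = \<lfloor>R * (T $ 1 $ 1 - T0 $ 1 $ 1)\<rfloor>"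
      and "n2 T = \<lfloor>2 * (R * (T $ 1 $ 2 - T0 $ 1 $ 2))\<rfloor>"
      and "n3 T = \<lfloor>R * (T $ 2 $ 2 - T0 $ 2 $ 2)\<rfloor>" for T :: "real mat2"
    have n: "of_int (n1 T) = R * (T $ 1 $ 1 - T0 $ 1 $ 1)"
      "of_int (n2 T) = 2 * (R * (T $ 1 $ 2 - T0 $ 1 $ 2))"
      "of_int (n3 T) = R * (T $ 2 $ 2 - T0 $ 2 $ 2)" if "T \<in> ?L" for T
      using that T0 by (auto simp: n1_def n2_def n3_def half_int_def of_int_floor right_diff_distrib)
    have inj: "T = T0" if "T \<in> ?L" "n1 T = 0" "n2 T = 0" "n3 T = 0" for T
      using n[OF that(1)] that T0 \<open>R > 0\<close> by (simp add: mat2_eq_iff half_int_def)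
    \<comment> \<open>Larger than every frequency difference occurring in \<open>K\<close>, so that
      on \<open>K\<close> the grid average is non-zero at \<open>T0\<close> only.\<close>
    define M where "M = nat (1 + (\<Sum>T\<in>K. \<bar>n1 T\<bar> + \<bar>n2 T\<bar> + \<bar>n3 T\<bar>))"
    have nonneg: "0 \<le> (\<Sum>T\<in>K. \<bar>n1 T\<bar> + \<bar>n2 T\<bar> + \<bar>n3 T\<bar>)" by (intro sum_nonneg) auto
    then have "M > 0" by (simp add: M_def)
    have bound: "\<bar>n1 T\<bar> < int M" "\<bar>n2 T\<bar> < int M" "\<bar>n3 T\<bar> < int M" if "T \<in> K" for T
      using member_le_sum[of T K "\<lambda>T. \<bar>n1 T\<bar> + \<bar>n2 T\<bar> + \<bar>n3 T\<bar>"] that K(1) nonneg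
      by (auto simp: M_def)
    define P :: "(nat \<times> nat \<times> nat) set" where "P = {..<M} \<times> {..<M} \<times> {..<M}"
    have P: "finite P" "card P = M ^ 3" by (simp_all add: P_def card_cartesian_product power3_eq_cube)
    \<comment> \<open>Scaled by \<open>R / M\<close> so that
      \<open>trace (T ** X x) - trace (T0 ** X x)\<close> is the sum of the
      \<open>x_i n_i / M\<close>; the off-diagonal entry counts twice in the trace, which matches
      the factor 2 in \<open>n2\<close>.\<close>
    define X where "X = (\<lambda>(x1,x2,x3). m22 (R * real x1 / M) (R * real x2 / M) (R * real x2 / M) (R * real x3 / M))"
    define \<psi> where "\<psi> T = (\<Sum>x\<in>P. cis2pi (trace (T ** X x) - trace (T0 ** X x)))" for T
    have \<psi>_eq: "\<psi> T = (if T = T0 then of_nat M ^ 3 else 0)" if "T \<in> K" for T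
    proof -
      have TL: "T \<in> ?L" using that K by auto
      have "\<psi> T = (\<Sum>(x1,x2,x3)\<in>P. cis2pi (real x1 * (of_int (n1 T) / real M) + real x2 * (of_int (n2 T) / real M)
              + real x3 * (of_int (n3 T) / real M)))"
        unfolding \<psi>_def
      proof (intro sum.cong refl)
        fix x :: "nat \<times> nat \<times> nat"
        obtain x1 x2 x3 where x: "x = (x1,x2,x3)" using prod_cases3 .
        obtain t1 t2 t3 t4 where T: "T = m22 t1 t2 t3 t4" using m22_cases .
        obtain u1 u2 u3 u4 where U: "T0 = m22 u1 u2 u3 u4" using m22_cases .
        have "t3 = t2" "u3 = u2" using TL T0 by (auto simp: half_int_def T U)
        have "trace (T ** X x) - trace (T0 ** X x) = real x1 * (of_int (n1 T) / real M)
            + real x2 * (of_int (n2 T) / real M) + real x3 * (of_int (n3 T) / real M)"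
          unfolding n[OF TL] unfolding x T U \<open>t3 = t2\<close> \<open>u3 = u2\<close> X_def
          by (simp add: diff_divide_distrib add_divide_distrib algebra_simps)
        then show "cis2pi (trace (T ** X x) - trace (T0 ** X x)) = (case x of (x1, x2, x3) \<Rightarrow>
            cis2pi (real x1 * (of_int (n1 T) / real M) + real x2 * (of_int (n2 T) / real M) + real x3 * (of_int (n3 T) / real M)))"
          by (simp add: x)
      qed
      also have "\<dots> = (if n1 T = 0 \<and> n2 T = 0 \<and> n3 T = 0 then of_nat M ^ 3 else 0)"
        unfolding P_def using bound[OF that] \<open>M > 0\<close> by (rule sum_cs3[rotated])
      also have "(n1 T = 0 \<and> n2 T = 0 \<and> n3 T = 0) = (T = T0)"
      proof
        show "n1 T = 0 \<and> n2 T = 0 \<and> n3 T = 0 \<Longrightarrow> T = T0" using inj[OF TL] by blast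
        show "T = T0 \<Longrightarrow> n1 T = 0 \<and> n2 T = 0 \<and> n3 T = 0" by (simp add: n1_def n2_def n3_def)
      qed
      finally show ?thesis .
    qed
    have norm_\<psi>: "norm (\<psi> T) \<le> real M ^ 3" for T
      unfolding \<psi>_def using sum_norm_le[of P "\<lambda>x. cis2pi (trace (T ** X x) - trace (T0 ** X x))" "\<lambda>_. 1"]
      by (simp add: P)
    have "((\<lambda>T. c T * \<psi> T) has_sum 0) ?L"
    proof -
      have tr: "transpose (X x) = X x" for x by (cases x) (simp add: X_def)
      have "((\<lambda>T. cis2pi (- trace (T0 ** X x)) * (c T * cis2pi (trace (T ** X x)))) has_sum (cis2pi (- trace (T0 ** X x)) * 0)) ?L" for x
        by (rule has_sum_cmult_right[OF sumX[OF tr]])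
      then have "((\<lambda>T. \<Sum>x\<in>P. cis2pi (- trace (T0 ** X x)) * (c T * cis2pi (trace (T ** X x)))) has_sum
          (\<Sum>x\<in>P. cis2pi (- trace (T0 ** X x)) * 0)) ?L"
        by (rule has_sum_sum[OF P(1)])
      moreover have "(\<Sum>x\<in>P. cis2pi (- trace (T0 ** X x)) * (c T * cis2pi (trace (T ** X x)))) = c T * \<psi> T" for T
        unfolding \<psi>_def sum_distrib_left
        by (intro sum.cong refl) (simp add: mult.left_commute cis_mult ring_distribs)
      ultimately show ?thesis by simp
    qed
    moreover have "((\<lambda>T. c T * \<psi> T) has_sum (\<Sum>T\<in>K. c T * \<psi> T)) K"
      using K by (simp add: has_sum_finite)
    ultimately have "((\<lambda>T. c T * \<psi> T) has_sum (0 - (\<Sum>T\<in>K. c T * \<psi> T))) (?L - K)"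
      using K by (intro has_sum_Diff)
    moreover have "(\<Sum>T\<in>K. c T * \<psi> T) = c T0 * of_nat M ^ 3"
    proof -
      have "(\<Sum>T\<in>K. c T * \<psi> T) = (\<Sum>T\<in>K. if T = T0 then c T0 * of_nat M ^ 3 else 0)"
        by (intro sum.cong refl) (simp add: \<psi>_eq)
      then show ?thesis using K by (simp add: sum.delta)
    qed
    ultimately have "((\<lambda>T. c T * \<psi> T) has_sum (- (c T0 * of_nat M ^ 3))) (?L - K)" by simp
    \<comment> \<open>The main term and the bound for the tail both carry the factor
      \<open>M ^ 3\<close>, so the estimate does not suffer from \<open>M\<close> depending on
      \<open>\<epsilon>\<close>.\<close>
    then have "norm (- (c T0 * of_nat M ^ 3)) \<le> (infsum (\<lambda>T. norm (c T)) ?L - (\<Sum>T\<in>K. norm (c T))) * real M ^ 3"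
      by (rule norm_infsum_le[OF _ has_sum_cmult_left[OF tail]]) (auto simp: norm_mult norm_\<psi> intro!: mult_left_mono)
    also have "\<dots> \<le> \<epsilon> * real M ^ 3" using tail_le by (intro mult_right_mono) auto
    finally show ?thesis using \<open>M > 0\<close> by (simp add: norm_mult norm_power)
  qed
  then have "norm (c T0) \<le> 0" by (rule field_le_epsilon)
  then show ?thesis by (simp add: c_def)
qed

text \<open>\<open>has_fourier_expansion\<close> constrains \<open>a\<close> on
  \<open>fourier_index\<close> only. The Hecke relations also produce indices outside it, where the
  coefficient has to count as 0.\<close>

definition coeff0 :: "(real mat2 \<Rightarrow> complex) \<Rightarrow> real mat2 \<Rightarrow> complex" where
  "coeff0 a T = (if T \<in> fourier_index then a T else 0)"

lemma fourier_index_half_int: "T \<in> fourier_index \<Longrightarrow> T \<in> half_int 1"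
proof -
  assume T: "T \<in> fourier_index"
  then have "transpose T = T" by (simp add: fourier_index_def pos_semidef_def)
  moreover have "T $ 2 $ 1 = transpose T $ 1 $ 2" by (simp add: transpose_def)
  ultimately have "T $ 2 $ 1 = T $ 1 $ 2" by simp
  then show ?thesis using T by (simp add: half_int_def fourier_index_def)
qed

text \<open>By cyclicity of the trace the index \<open>T\<close> turns into
  \<open>s A^t T A\<close>, and the series is reindexed along this injection. Since
  \<open>q A\<close> is integral, the new indices have denominators dividing \<open>q^2\<close>; on
  indices outside the image \<open>coeff0\<close> vanishes.\<close>

lemma expansion_move:
  fixes q s :: nat
  assumes fe: "has_fourier_expansion F a" and \<tau>: "\<tau> \<in> siegel_h2" and X: "transpose X = X" and "s > 0"
    and A: "A ** Ai = mat 1" and int: "\<And>r c. real q * A $ r $ c \<in> \<int>"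
  shows "((\<lambda>T. coeff0 a ((1 / real s) *\<^sub>R (transpose Ai ** T ** Ai)) * cis2pi (trace (T ** X)) * exp_tr T \<tau>) has_sum
     F (cmplx (real s *\<^sub>R A) ** (\<tau> + cmplx X) ** cmplx (transpose A))) (half_int (real q ^ 2))"
proof -
  define \<phi> where "\<phi> T = real s *\<^sub>R (transpose A ** T ** A)" for T :: "real mat2"
  define \<psi> where "\<psi> T = (1 / real s) *\<^sub>R (transpose Ai ** T ** Ai)" for T :: "real mat2"
  define \<tau>' where "\<tau>' = cmplx (real s *\<^sub>R A) ** (\<tau> + cmplx X) ** cmplx (transpose A)"
  define g where "g T = coeff0 a (\<psi> T) * cis2pi (trace (T ** X)) * exp_tr T \<tau>" for T
  have sc: "(x *\<^sub>R P) ** Q = x *\<^sub>R (P ** Q)" "P ** (x *\<^sub>R Q) = x *\<^sub>R (P ** Q)" for x and P Q :: "real mat2"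
    by (cases P rule: m22_cases, cases Q rule: m22_cases, simp add: algebra_simps)+
  have A': "Ai ** A = mat 1" using A matrix_left_right_inverse by blast
  have tA: "transpose Ai ** transpose A = mat 1" "transpose A ** transpose Ai = mat 1"
    by (simp_all add: matrix_transpose_mul[symmetric] A A')
  have \<psi>\<phi>: "\<psi> (\<phi> T) = T" for T
  proof -
    have "\<psi> (\<phi> T) = (transpose Ai ** transpose A) ** T ** (A ** Ai)"
      using \<open>s > 0\<close> by (simp only: \<psi>_def \<phi>_def sc matrix_mul_assoc) simp
    then show ?thesis by (simp add: A tA)
  qed
  have \<phi>\<psi>: "\<phi> (\<psi> T) = T" for T
  proof -
    have "\<phi> (\<psi> T) = (transpose A ** transpose Ai) ** T ** (Ai ** A)"
      using \<open>s > 0\<close> by (simp only: \<psi>_def \<phi>_def sc matrix_mul_assoc) simp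
    then show ?thesis by (simp add: A' tA)
  qed
  have \<phi>_half: "\<phi> T \<in> half_int (real q ^ 2)" if "T \<in> fourier_index" for T
  proof -
    obtain t1 t2 t3 t4 where T: "T = m22 t1 t2 t3 t4" using m22_cases .
    have "t3 = t2" and ti: "t1 \<in> \<int>" "2 * t2 \<in> \<int>" "t4 \<in> \<int>"
      using fourier_index_half_int[OF that] by (auto simp: half_int_def T)
    obtain a b c d where Am: "A = m22 a b c d" using m22_cases .
    have i: "real q * a \<in> \<int>" "real q * b \<in> \<int>" "real q * c \<in> \<int>" "real q * d \<in> \<int>"
      using int[of 1 1] int[of 1 2] int[of 2 1] int[of 2 2] by (simp_all add: Am)
    have "real q ^ 2 * \<phi> T $ 1 $ 1 = real s * ((real q * a) * (real q * a) * t1 + (real q * a) * (real q * c) * (2 * t2) + (real q * c) * (real q * c) * t4)"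
      by (simp add: \<phi>_def Am T \<open>t3 = t2\<close> algebra_simps power2_eq_square)
    also have "\<dots> \<in> \<int>" by (intro Ints_mult Ints_add i ti) auto
    finally have 1: "real q ^ 2 * \<phi> T $ 1 $ 1 \<in> \<int>" .
    have "real q ^ 2 * \<phi> T $ 2 $ 2 = real s * ((real q * b) * (real q * b) * t1 + (real q * b) * (real q * d) * (2 * t2) + (real q * d) * (real q * d) * t4)"
      by (simp add: \<phi>_def Am T \<open>t3 = t2\<close> algebra_simps power2_eq_square)
    also have "\<dots> \<in> \<int>" by (intro Ints_mult Ints_add i ti) auto
    finally have 2: "real q ^ 2 * \<phi> T $ 2 $ 2 \<in> \<int>" .
    have "2 * (real q ^ 2 * \<phi> T $ 1 $ 2) = real s * (2 * ((real q * a) * (real q * b)) * t1 +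
         ((real q * a) * (real q * d) + (real q * b) * (real q * c)) * (2 * t2) + 2 * ((real q * c) * (real q * d)) * t4)"
      by (simp add: \<phi>_def Am T \<open>t3 = t2\<close> algebra_simps power2_eq_square)
    also have "\<dots> \<in> \<int>" by (intro Ints_mult Ints_add i ti) auto
    finally have 3: "2 * (real q ^ 2 * \<phi> T $ 1 $ 2) \<in> \<int>" .
    have "\<phi> T $ 2 $ 1 = \<phi> T $ 1 $ 2"
      by (simp add: \<phi>_def Am T \<open>t3 = t2\<close> algebra_simps)
    with 1 2 3 show ?thesis by (simp add: half_int_def)
  qed
  have exp_tr: "exp_tr T \<tau>' = exp_tr (\<phi> T) (\<tau> + cmplx X)" for T
  proof -
    have "trace (cmplx T ** \<tau>') = trace (cmplx (\<phi> T) ** (\<tau> + cmplx X))"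
    proof -
      obtain t1 t2 t3 t4 where T: "T = m22 t1 t2 t3 t4" using m22_cases .
      obtain a b c d where Am: "A = m22 a b c d" using m22_cases .
      obtain z1 z2 z3 z4 where Z: "\<tau> + cmplx X = m22 z1 z2 z3 z4" using m22_cases .
      show ?thesis unfolding \<tau>'_def Z by (simp add: T Am \<phi>_def algebra_simps)
    qed
    then show ?thesis by simp
  qed
  have "((\<lambda>T. a T * exp_tr T \<tau>') has_sum F \<tau>') fourier_index"
    using fe siegel_h2_move[OF \<tau> X _ A, of "real s"] \<open>s > 0\<close>
    by (simp only: has_fourier_expansion_def \<tau>'_def of_nat_0_less_iff)
  moreover have "a T * exp_tr T \<tau>' = (g \<circ> \<phi>) T" if "T \<in> fourier_index" for T
    unfolding exp_tr exp_tr_add_real g_def o_def \<psi>\<phi> using that by (simp add: coeff0_def)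
  ultimately have "((g \<circ> \<phi>) has_sum F \<tau>') fourier_index"
    by (simp cong: has_sum_cong)
  moreover have "inj_on \<phi> fourier_index" by (rule inj_on_inverseI[of _ \<psi>]) (rule \<psi>\<phi>)
  ultimately have "(g has_sum F \<tau>') (\<phi> ` fourier_index)"
    by (simp add: has_sum_reindex)
  also have "?this \<longleftrightarrow> (g has_sum F \<tau>') (half_int (real q ^ 2))"
  proof (rule has_sum_cong_neutral)
    fix T assume "T \<in> half_int (real q ^ 2) - \<phi> ` fourier_index"
    then have "\<psi> T \<notin> fourier_index" using \<phi>\<psi>[of T] by (metis DiffD2 imageI)
    then show "g T = 0" by (simp add: g_def coeff0_def)
  next
    fix T assume "T \<in> \<phi> ` fourier_index - half_int (real q ^ 2)"
    then show "g T = 0" using \<phi>_half by blast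
  qed simp
  finally show ?thesis unfolding g_def[abs_def] \<tau>'_def \<psi>_def .
qed

text \<open>All series are written on the lattice with denominators \<open>q^2\<close>, where the
  difference of the two sides has sum 0 at every point, so \<open>expansion_unique\<close>
  applies.\<close>

lemma coefficient_identity:
  fixes q :: nat and s :: "'i \<Rightarrow> nat"
  assumes fe: "has_fourier_expansion F a" and "finite I" and "q > 0"
    and X: "\<And>i. i \<in> I \<Longrightarrow> transpose (X i) = X i" and s: "\<And>i. i \<in> I \<Longrightarrow> s i > 0"
    and A: "\<And>i. i \<in> I \<Longrightarrow> A i ** Ai i = mat 1"
    and int: "\<And>i r c. i \<in> I \<Longrightarrow> real q * A i $ r $ c \<in> \<int>"
    and eq: "\<And>\<tau>. \<tau> \<in> siegel_h2 \<Longrightarrow>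
      (\<Sum>i\<in>I. w i * F (cmplx (real (s i) *\<^sub>R A i) ** (\<tau> + cmplx (X i)) ** cmplx (transpose (A i)))) = c * F \<tau>"
    and T: "T \<in> fourier_index"
  shows "(\<Sum>i\<in>I. w i * (coeff0 a ((1 / real (s i)) *\<^sub>R (transpose (Ai i) ** T ** Ai i)) * cis2pi (trace (T ** X i)))) = c * a T"
proof -
  define b where "b T = (\<Sum>i\<in>I. w i * (coeff0 a ((1 / real (s i)) *\<^sub>R (transpose (Ai i) ** T ** Ai i)) * cis2pi (trace (T ** X i))))
     - c * coeff0 a T" for T
  have half: "T \<in> half_int (real q ^ 2)" if "T \<in> fourier_index" for T
  proof -
    have "real q ^ 2 * x \<in> \<int>" if "x \<in> \<int>" for x using that by auto
    moreover have "2 * (real q ^ 2 * x) = real q ^ 2 * (2 * x)" for x by simp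
    ultimately show ?thesis using fourier_index_half_int[OF that] unfolding half_int_def mem_Collect_eq by (metis mult_1)
  qed
  have "b T = 0"
  proof (rule expansion_unique)
    fix \<tau> assume \<tau>: "\<tau> \<in> siegel_h2"
    have "((\<lambda>T. a T * exp_tr T \<tau>) has_sum F \<tau>) fourier_index"
      using fe \<tau> by (simp only: has_fourier_expansion_def)
    also have "?this \<longleftrightarrow> ((\<lambda>T. coeff0 a T * exp_tr T \<tau>) has_sum F \<tau>) (half_int (real q ^ 2))"
      using half by (intro has_sum_cong_neutral) (auto simp: coeff0_def)
    finally have "((\<lambda>T. coeff0 a T * exp_tr T \<tau>) has_sum F \<tau>) (half_int (real q ^ 2))" .
    then have 1: "((\<lambda>T. - c * (coeff0 a T * exp_tr T \<tau>)) has_sum - c * F \<tau>) (half_int (real q ^ 2))"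
      by (rule has_sum_cmult_right)
    have 2: "((\<lambda>T. \<Sum>i\<in>I. w i * (coeff0 a ((1 / real (s i)) *\<^sub>R (transpose (Ai i) ** T ** Ai i)) * cis2pi (trace (T ** X i)) * exp_tr T \<tau>))
        has_sum (\<Sum>i\<in>I. w i * F (cmplx (real (s i) *\<^sub>R A i) ** (\<tau> + cmplx (X i)) ** cmplx (transpose (A i))))) (half_int (real q ^ 2))"
      by (rule has_sum_sum[OF \<open>finite I\<close>], rule has_sum_cmult_right, rule expansion_move[OF fe \<tau> X s A int])
    from has_sum_add[OF 1 2]
    show "((\<lambda>T. b T * exp_tr T \<tau>) has_sum 0) (half_int (real q ^ 2))"
      unfolding eq[OF \<tau>] by (simp add: b_def left_diff_distrib sum_distrib_right mult.assoc)
  qed (use \<open>q > 0\<close> half[OF T] in auto)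
  then show ?thesis using T by (simp add: b_def coeff0_def)
qed

section \<open>Dirichlet characters and sums over cosets\<close>

lemma chi_cong:
  assumes "dirichlet_character N chi" and "[a = b] (mod int N)"
  shows "chi a = chi b"
proof -
  have nat: "chi (x + int j * int N) = chi x" for x j
  proof (induction j)
    case (Suc j)
    have "chi (x + int j * int N + int N) = chi (x + int j * int N)"
      using assms(1) by (simp add: dirichlet_character_def)
    then show ?case using Suc by (simp add: algebra_simps)
  qed simp
  obtain c where c: "a = b + c * int N"
    using assms(2) by (metis cong_iff_lin cong_sym mult.commute)
  show ?thesis
  proof (cases "c \<ge> 0")
    case True
    then show ?thesis using nat[of b "nat c"] c by simp
  next
    case False
    then show ?thesis using nat[of a "nat (- c)"] c by simp
  qed
qed

lemma chi_mult: "dirichlet_character N chi \<Longrightarrow> chi (a * b) = chi a * chi b"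
  by (simp add: dirichlet_character_def)

lemma chi_1:
  assumes "dirichlet_character N chi"
  shows "chi 1 = 1"
proof -
  have "chi 1 \<noteq> 0" using assms by (simp add: dirichlet_character_def)
  moreover have "chi 1 = chi 1 * chi 1" using chi_mult[OF assms, of 1 1] by simp
  ultimately show ?thesis by simp
qed

text \<open>By Euler's theorem \<open>chi a\<close> is a root of unity. This cancels the conjugate
  character in the Hecke sum against the character from modularity.\<close>

lemma chi_mult_cnj:
  assumes "dirichlet_character N chi" and "N > 0" and "coprime a (int N)"
  shows "cnj (chi a) * chi a = 1"
proof -
  define b where "b = nat (a mod int N)"
  have b: "int b = a mod int N" using \<open>N > 0\<close> by (simp add: b_def)
  then have ab: "[a = int b] (mod int N)" by (simp add: cong_def)
  have "coprime (int b) (int N)" using cong_imp_coprime[OF ab] assms(3) by blast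
  then have "[b ^ totient N = 1] (mod N)" by (intro euler_theorem) (simp add: coprime_int_iff)
  then have "[int (b ^ totient N) = int 1] (mod int N)" by (simp only: cong_int_iff)
  then have "chi (int b ^ totient N) = 1"
    using chi_cong[OF assms(1)] chi_1[OF assms(1)] by fastforce
  moreover have "chi (x ^ j) = chi x ^ j" for x j
    by (induction j) (use chi_1[OF assms(1)] chi_mult[OF assms(1)] in auto)
  ultimately have "chi a ^ totient N = 1" using chi_cong[OF assms(1) ab] by simp
  then have "norm (chi a) ^ totient N = 1 ^ totient N" by (simp add: norm_power[symmetric])
  moreover have "totient N > 0" using \<open>N > 0\<close> by simp
  ultimately have "norm (chi a) = 1"
    by (subst (asm) power_eq_iff_eq_base) auto
  then show ?thesis using complex_norm_square[of "chi a"] by (simp add: mult.commute)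
qed

text \<open>Modulo \<open>N\<close> the lower left block of \<open>g\<close> vanishes, so the lower
  right blocks multiply.\<close>

lemma chi_det_mult:
  assumes chi: "dirichlet_character N chi" and "g \<in> Gamma0 N" "h \<in> Gamma0 N"
  shows "chi (det (blockD (g ** h))) = chi (det (blockD g)) * chi (det (blockD h))"
proof -
  obtain A B C D where g: "g = block A B C D" using mat4_cases .
  obtain A' B' C' D' where h: "h = block A' B' C' D'" using mat4_cases .
  obtain c1 c2 c3 c4 where C: "C = m22 c1 c2 c3 c4" using m22_cases .
  obtain d1 d2 d3 d4 where D: "D = m22 d1 d2 d3 d4" using m22_cases .
  obtain b1 b2 b3 b4 where B': "B' = m22 b1 b2 b3 b4" using m22_cases .
  obtain e1 e2 e3 e4 where D': "D' = m22 e1 e2 e3 e4" using m22_cases .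
  have "int N dvd c1" "int N dvd c2" "int N dvd c3" "int N dvd c4"
    using assms(2) by (auto simp: Gamma0_def g C forall_2)
  then have c: "[c1 = 0] (mod int N)" "[c2 = 0] (mod int N)" "[c3 = 0] (mod int N)" "[c4 = 0] (mod int N)"
    by (auto simp: cong_0_iff)
  have "[det (C ** B' + D ** D') = (0 * b1 + 0 * b3 + (d1 * e1 + d2 * e3)) * (0 * b2 + 0 * b4 + (d3 * e2 + d4 * e4))
      - (0 * b2 + 0 * b4 + (d1 * e2 + d2 * e4)) * (0 * b1 + 0 * b3 + (d3 * e1 + d4 * e3))] (mod int N)"
    unfolding C B' D D' m22_mult m22_add det_m22
    by (intro cong_diff cong_mult cong_add c cong_refl)
  also have "(0 * b1 + 0 * b3 + (d1 * e1 + d2 * e3)) * (0 * b2 + 0 * b4 + (d3 * e2 + d4 * e4))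
      - (0 * b2 + 0 * b4 + (d1 * e2 + d2 * e4)) * (0 * b1 + 0 * b3 + (d3 * e1 + d4 * e3)) = det D * det D'"
    by (simp add: D D' algebra_simps)
  finally show ?thesis
    using chi_cong[OF chi] chi_mult[OF chi] by (simp add: g h)
qed

text \<open>In blocks: \<open>A B^t\<close> and \<open>C D^t\<close> are symmetric and
  \<open>A D^t - B C^t = 1\<close>, read off from \<open>Sp2_rows\<close>.\<close>

lemma Sp2_entries:
  fixes a1 :: int
  assumes "block (m22 a1 a2 a3 a4) (m22 b1 b2 b3 b4) (m22 c1 c2 c3 c4) (m22 d1 d2 d3 d4) \<in> Sp2"
  shows "a1 * b3 + a2 * b4 - b1 * a3 - b2 * a4 = 0"
    and "a1 * d1 + a2 * d2 - b1 * c1 - b2 * c2 = 1" "a1 * d3 + a2 * d4 - b1 * c3 - b2 * c4 = 0"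
    and "a3 * d1 + a4 * d2 - b3 * c1 - b4 * c2 = 0" "a3 * d3 + a4 * d4 - b3 * c3 - b4 * c4 = 1"
    and "c1 * d3 + c2 * d4 - d1 * c3 - d2 * c4 = 0"
proof -
  let ?g = "block (m22 a1 a2 a3 a4) (m22 b1 b2 b3 b4) (m22 c1 c2 c3 c4) (m22 d1 d2 d3 d4)"
  have "?g ** symp_J ** transpose ?g =
     block (m22 0 (a1 * b3 + a2 * b4 - b1 * a3 - b2 * a4) (- (a1 * b3 + a2 * b4 - b1 * a3 - b2 * a4)) 0)
       (m22 (a1 * d1 + a2 * d2 - b1 * c1 - b2 * c2) (a1 * d3 + a2 * d4 - b1 * c3 - b2 * c4)
            (a3 * d1 + a4 * d2 - b3 * c1 - b4 * c2) (a3 * d3 + a4 * d4 - b3 * c3 - b4 * c4))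
       (- m22 (a1 * d1 + a2 * d2 - b1 * c1 - b2 * c2) (a3 * d1 + a4 * d2 - b3 * c1 - b4 * c2)
            (a1 * d3 + a2 * d4 - b1 * c3 - b2 * c4) (a3 * d3 + a4 * d4 - b3 * c3 - b4 * c4))
       (m22 0 (c1 * d3 + c2 * d4 - d1 * c3 - d2 * c4) (- (c1 * d3 + c2 * d4 - d1 * c3 - d2 * c4)) 0)"
    by (simp add: symp_J_m22 algebra_simps)
  also have "?g ** symp_J ** transpose ?g = symp_J" by (rule Sp2_rows[OF assms])
  finally show "a1 * b3 + a2 * b4 - b1 * a3 - b2 * a4 = 0"
    "a1 * d1 + a2 * d2 - b1 * c1 - b2 * c2 = 1" "a1 * d3 + a2 * d4 - b1 * c3 - b2 * c4 = 0"
    "a3 * d1 + a4 * d2 - b3 * c1 - b4 * c2 = 0" "a3 * d3 + a4 * d4 - b3 * c3 - b4 * c4 = 1"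
    "c1 * d3 + c2 * d4 - d1 * c3 - d2 * c4 = 0"
    by (simp_all only: symp_J_m22 block_eq_iff m22_eq_iff)
qed

text \<open>Since \<open>C\<close> vanishes modulo \<open>N\<close>, the relation
  \<open>A D^t - B C^t = 1\<close> becomes \<open>A D^t = 1\<close> modulo \<open>N\<close>.\<close>

lemma Gamma0_coprime_det:
  assumes "g \<in> Gamma0 N"
  shows "coprime (det (blockD g)) (int N)" "coprime (det (blockA g)) (int N)"
proof -
  obtain A B C D where g: "g = block A B C D" using mat4_cases .
  obtain a1 a2 a3 a4 where A: "A = m22 a1 a2 a3 a4" using m22_cases .
  obtain b1 b2 b3 b4 where B: "B = m22 b1 b2 b3 b4" using m22_cases .
  obtain c1 c2 c3 c4 where C: "C = m22 c1 c2 c3 c4" using m22_cases .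
  obtain d1 d2 d3 d4 where D: "D = m22 d1 d2 d3 d4" using m22_cases .
  have "int N dvd c1" "int N dvd c2" "int N dvd c3" "int N dvd c4"
    using assms by (auto simp: Gamma0_def g C forall_2)
  then have "[c1 = 0] (mod int N)" "[c2 = 0] (mod int N)" "[c3 = 0] (mod int N)" "[c4 = 0] (mod int N)"
    by (simp_all add: cong_0_iff)
  note c = this[THEN cong_sym]
  have "block (m22 a1 a2 a3 a4) (m22 b1 b2 b3 b4) (m22 c1 c2 c3 c4) (m22 d1 d2 d3 d4) \<in> Sp2"
    using assms by (simp add: Gamma0_def g A B C D)
  note eqs = Sp2_entries[OF this]
  \<comment> \<open>The determinant of \<open>A D^t - B C^t\<close> as a polynomial in the entries
    of \<open>C\<close>, which may be replaced by 0 modulo \<open>N\<close>.\<close>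
  define P where "P x1 x2 x3 x4 = (a1 * d1 + a2 * d2 - b1 * x1 - b2 * x2) * (a3 * d3 + a4 * d4 - b3 * x3 - b4 * x4)
     - (a1 * d3 + a2 * d4 - b1 * x3 - b2 * x4) * (a3 * d1 + a4 * d2 - b3 * x1 - b4 * x2)" for x1 x2 x3 x4
  have "[P 0 0 0 0 = P c1 c2 c3 c4] (mod int N)"
    unfolding P_def by (rule cong_diff; rule cong_mult; rule cong_diff; (rule cong_diff)?; (rule cong_mult)?; (rule c cong_refl)?)
  moreover have "P c1 c2 c3 c4 = 1" unfolding P_def eqs by simp
  moreover have "P 0 0 0 0 = det A * det D" by (simp add: P_def A D algebra_simps)
  ultimately have "[1 = det A * det D] (mod int N)" by (simp add: cong_sym)
  then have "coprime (det A * det D) (int N)"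
    by (rule cong_imp_coprime) simp
  then show "coprime (det (blockD g)) (int N)" "coprime (det (blockA g)) (int N)" by (simp_all add: g)
qed

section \<open>Hecke cosets as classes of matrices modulo left multiplication by
  \<open>Gamma0 N\<close>\<close>

context
  fixes N :: nat and d di :: "real mat4"
  assumes d: "d ** di = mat 1"
begin

lemma matrix_inv_conj: "matrix_inv d = di" "di ** d = mat 1"
  by (rule matrix_inv_eqI[OF d]) (rule matrix_left_right_inverse[THEN iffD1, OF d])

text \<open>The intertwining form of the conjugation condition composes directly with relations of
  the shape \<open>di ** ratm \<gamma> = ratm g ** U\<close>.\<close>

lemma hecke_subgroup_iff:
  "h \<in> hecke_subgroup N d \<longleftrightarrow> h \<in> Gamma0 N \<and> (\<exists>g\<in>Gamma0 N. di ** ratm h = ratm g ** di)"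
proof -
  have "ratm h = d ** ratm g ** di \<longleftrightarrow> di ** ratm h = ratm g ** di" for g
  proof
    assume "ratm h = d ** ratm g ** di"
    then show "di ** ratm h = ratm g ** di" by (simp add: matrix_mul_assoc matrix_inv_conj)
  next
    assume "di ** ratm h = ratm g ** di"
    then have "d ** (di ** ratm h) = d ** (ratm g ** di)" by simp
    then show "ratm h = d ** ratm g ** di" by (simp add: matrix_mul_assoc d)
  qed
  then show ?thesis by (simp add: hecke_subgroup_def matrix_inv_conj)
qed

lemma hecke_subgroup_mult:
  assumes "h \<in> hecke_subgroup N d" "h' \<in> hecke_subgroup N d"
  shows "h ** h' \<in> hecke_subgroup N d"
proof -
  obtain g g' where g: "g \<in> Gamma0 N" "di ** ratm h = ratm g ** di"
    and g': "g' \<in> Gamma0 N" "di ** ratm h' = ratm g' ** di"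
    using assms by (auto simp: hecke_subgroup_iff)
  have "di ** ratm (h ** h') = ratm (g ** g') ** di"
    unfolding ratm_mult matrix_mul_assoc g(2) by (simp only: matrix_mul_assoc[symmetric] g'(2))
  then show ?thesis using assms g(1) g'(1) Gamma0_mult by (auto simp: hecke_subgroup_iff)
qed

lemma ratm_symp_inv_cancel:
  assumes "g \<in> Gamma0 N"
  shows "ratm (symp_inv g) ** ratm g = mat 1" "ratm g ** ratm (symp_inv g) = mat 1"
  using Gamma0_inv[OF assms] by (simp_all add: ratm_mult[symmetric])

text \<open>Eliminating \<open>U\<close> from the two relations shows that
  \<open>g2 ** symp_inv g1\<close> intertwines \<open>\<gamma>2 ** symp_inv \<gamma>1\<close> with
  \<open>di\<close>.\<close>

lemma same_index_imp_subgroup: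
  assumes "\<gamma>1 \<in> Gamma0 N" "\<gamma>2 \<in> Gamma0 N" "g1 \<in> Gamma0 N" "g2 \<in> Gamma0 N"
    and 1: "di ** ratm \<gamma>1 = ratm g1 ** U" and 2: "di ** ratm \<gamma>2 = ratm g2 ** U"
  shows "\<gamma>2 ** symp_inv \<gamma>1 \<in> hecke_subgroup N d"
proof -
  have "U = ratm (symp_inv g1) ** (ratm g1 ** U)"
    by (simp add: matrix_mul_assoc ratm_symp_inv_cancel assms)
  then have U: "U = ratm (symp_inv g1) ** (di ** ratm \<gamma>1)" by (simp add: 1)
  have "di ** ratm (\<gamma>2 ** symp_inv \<gamma>1) = ratm g2 ** U ** ratm (symp_inv \<gamma>1)"
    by (simp add: ratm_mult matrix_mul_assoc 2)
  also have "\<dots> = ratm g2 ** ratm (symp_inv g1) ** di ** (ratm \<gamma>1 ** ratm (symp_inv \<gamma>1))"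
    by (subst U) (simp only: matrix_mul_assoc)
  also have "\<dots> = ratm (g2 ** symp_inv g1) ** di"
    by (simp add: ratm_symp_inv_cancel assms ratm_mult)
  finally show ?thesis
    using assms by (auto simp: hecke_subgroup_iff intro: Gamma0_mult Gamma0_symp_inv)
qed

lemma hecke_subgroup_inv:
  assumes "h \<in> hecke_subgroup N d"
  shows "symp_inv h \<in> hecke_subgroup N d"
proof -
  obtain g where g: "g \<in> Gamma0 N" "di ** ratm h = ratm g ** di" and h: "h \<in> Gamma0 N"
    using assms by (auto simp: hecke_subgroup_iff)
  have "di ** ratm (mat 1) = ratm (mat 1) ** di" by simp
  from same_index_imp_subgroup[OF h Gamma0_one g(1) Gamma0_one g(2) this] show ?thesis by simp
qed

lemma hecke_coset_eqI:
  assumes "\<gamma>1 \<in> Gamma0 N" and "\<gamma>2 ** symp_inv \<gamma>1 \<in> hecke_subgroup N d"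
  shows "(\<lambda>h. h ** \<gamma>2) ` hecke_subgroup N d = (\<lambda>h. h ** \<gamma>1) ` hecke_subgroup N d"
proof -
  define u where "u = \<gamma>2 ** symp_inv \<gamma>1"
  have u: "u \<in> hecke_subgroup N d" "symp_inv u \<in> hecke_subgroup N d" "u \<in> Gamma0 N"
    using assms hecke_subgroup_inv by (auto simp: u_def hecke_subgroup_iff)
  have g2: "\<gamma>2 = u ** \<gamma>1"
    by (simp add: u_def matrix_mul_assoc[symmetric] Gamma0_inv[OF assms(1)])
  have g1: "h ** \<gamma>1 = h ** symp_inv u ** \<gamma>2" for h
  proof -
    have "h ** symp_inv u ** \<gamma>2 = h ** (symp_inv u ** u) ** \<gamma>1"
      unfolding g2 by (simp only: matrix_mul_assoc)
    then show ?thesis by (simp add: Gamma0_inv[OF u(3)])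
  qed
  show ?thesis
  proof (intro equalityI subsetI)
    fix x assume "x \<in> (\<lambda>h. h ** \<gamma>2) ` hecke_subgroup N d"
    then obtain h where "h \<in> hecke_subgroup N d" "x = h ** u ** \<gamma>1" by (auto simp: g2 matrix_mul_assoc)
    then show "x \<in> (\<lambda>h. h ** \<gamma>1) ` hecke_subgroup N d" using hecke_subgroup_mult u(1) by blast
  next
    fix x assume "x \<in> (\<lambda>h. h ** \<gamma>1) ` hecke_subgroup N d"
    then obtain h where "h \<in> hecke_subgroup N d" "x = h ** symp_inv u ** \<gamma>2" using g1 by auto
    then show "x \<in> (\<lambda>h. h ** \<gamma>2) ` hecke_subgroup N d" using hecke_subgroup_mult u(2) by blast
  qed
qed

text \<open>A coset is determined by the class of \<open>di ** ratm \<gamma>\<close> modulo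
  \<open>Gamma0 N\<close> on the left, and the \<open>U i\<close> represent these classes. Requiring
  \<open>f \<gamma> = h i\<close> for every \<open>\<gamma>\<close> makes the summand independent of
  the element chosen by \<open>SOME\<close>.\<close>

lemma sum_hecke_cosets:
  fixes f :: "int mat4 \<Rightarrow> 'b::comm_monoid_add" and U :: "'i \<Rightarrow> real mat4"
  defines "R \<equiv> \<lambda>\<gamma> i. \<exists>g\<in>Gamma0 N. di ** ratm \<gamma> = ratm g ** U i"
  assumes ex: "\<And>\<gamma>. \<gamma> \<in> Gamma0 N \<Longrightarrow> \<exists>i\<in>I. R \<gamma> i \<and> f \<gamma> = h i"
    and surj: "\<And>i. i \<in> I \<Longrightarrow> \<exists>\<gamma>\<in>Gamma0 N. R \<gamma> i"
    and inj: "\<And>i j g. i \<in> I \<Longrightarrow> j \<in> I \<Longrightarrow> g \<in> Gamma0 N \<Longrightarrow> ratm g ** U i = U j \<Longrightarrow> i = j"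
  shows "(\<Sum>c\<in>hecke_cosets N d. f (SOME \<gamma>. \<gamma> \<in> c)) = (\<Sum>i\<in>I. h i)"
proof -
  define idx where "idx \<gamma> = (SOME i. i \<in> I \<and> R \<gamma> i \<and> f \<gamma> = h i)" for \<gamma>
  have idx: "idx \<gamma> \<in> I" "R \<gamma> (idx \<gamma>)" "f \<gamma> = h (idx \<gamma>)" if "\<gamma> \<in> Gamma0 N" for \<gamma>
    using someI_ex[of "\<lambda>i. i \<in> I \<and> R \<gamma> i \<and> f \<gamma> = h i"] ex[OF that] unfolding idx_def by blast+
  have idx_unique: "i = j" if "i \<in> I" "j \<in> I" and Ri: "R \<gamma> i" and Rj: "R \<gamma> j" for \<gamma> i j
  proof -
    obtain g where g: "g \<in> Gamma0 N" "di ** ratm \<gamma> = ratm g ** U i" using Ri by (auto simp: R_def)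
    obtain g' where g': "g' \<in> Gamma0 N" "di ** ratm \<gamma> = ratm g' ** U j" using Rj by (auto simp: R_def)
    have "ratm (symp_inv g' ** g) ** U i = ratm (symp_inv g') ** (ratm g ** U i)"
      by (simp only: ratm_mult matrix_mul_assoc)
    also have "\<dots> = ratm (symp_inv g') ** ratm g' ** U j"
      using g(2) g'(2) by (simp add: matrix_mul_assoc[symmetric])
    also have "\<dots> = U j" by (simp add: ratm_symp_inv_cancel g')
    finally show ?thesis
      using inj[OF that(1,2)] g(1) g'(1) Gamma0_mult Gamma0_symp_inv by blast
  qed
  define r where "r c = (SOME \<gamma>. \<gamma> \<in> c)" for c :: "int mat4 set"
  let ?H = "hecke_subgroup N d"
  have one: "mat 1 \<in> ?H"
  proof -
    have "di ** ratm (mat 1) = ratm (mat 1) ** di" by simp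
    then show ?thesis using Gamma0_one hecke_subgroup_iff by blast
  qed
  have r: "\<exists>h\<in>?H. r ((\<lambda>h. h ** \<gamma>) ` ?H) = h ** \<gamma>" for \<gamma>
    using someI[of "\<lambda>x. x \<in> (\<lambda>h. h ** \<gamma>) ` ?H" "mat 1 ** \<gamma>"] one unfolding r_def by blast
  have r_Gamma: "r c \<in> Gamma0 N" and r_coset: "c = (\<lambda>h. h ** r c) ` ?H" if c: "c \<in> hecke_cosets N d" for c
  proof -
    obtain \<gamma> where \<gamma>: "\<gamma> \<in> Gamma0 N" "c = (\<lambda>h. h ** \<gamma>) ` ?H" using c by (auto simp: hecke_cosets_def)
    obtain h where h: "h \<in> ?H" "r c = h ** \<gamma>" using r \<gamma>(2) by blast
    show "r c \<in> Gamma0 N" using h \<gamma> Gamma0_mult by (auto simp: hecke_subgroup_iff)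
    have "r c ** symp_inv \<gamma> = h" by (simp add: h(2) matrix_mul_assoc[symmetric] Gamma0_inv[OF \<gamma>(1)])
    then show "c = (\<lambda>h. h ** r c) ` ?H"
      using hecke_coset_eqI[of \<gamma> "r c"] \<gamma> h by simp
  qed
  have "bij_betw (\<lambda>c. idx (r c)) (hecke_cosets N d) I"
    unfolding bij_betw_def
  proof (intro conjI inj_onI)
    fix c1 c2 assume c: "c1 \<in> hecke_cosets N d" "c2 \<in> hecke_cosets N d" and eq: "idx (r c1) = idx (r c2)"
    obtain g1 where g1: "g1 \<in> Gamma0 N" "di ** ratm (r c1) = ratm g1 ** U (idx (r c1))"
      using idx(2)[OF r_Gamma[OF c(1)]] by (auto simp: R_def)
    obtain g2 where g2: "g2 \<in> Gamma0 N" "di ** ratm (r c2) = ratm g2 ** U (idx (r c1))"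
      using idx(2)[OF r_Gamma[OF c(2)]] by (auto simp: R_def eq)
    have "(\<lambda>h. h ** r c2) ` ?H = (\<lambda>h. h ** r c1) ` ?H"
      by (intro hecke_coset_eqI r_Gamma c same_index_imp_subgroup[OF _ _ g1(1) g2(1) g1(2) g2(2)])
    then show "c1 = c2" using r_coset c by metis
  next
    show "(\<lambda>c. idx (r c)) ` hecke_cosets N d = I"
    proof (intro equalityI subsetI)
    fix i assume "i \<in> (\<lambda>c. idx (r c)) ` hecke_cosets N d"
    then show "i \<in> I" using idx(1) r_Gamma by blast
  next
    fix i assume i: "i \<in> I"
    then obtain \<gamma> g where \<gamma>: "\<gamma> \<in> Gamma0 N" and g: "g \<in> Gamma0 N" "di ** ratm \<gamma> = ratm g ** U i"
      using surj[OF i] by (auto simp: R_def)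
    let ?c = "(\<lambda>h. h ** \<gamma>) ` ?H"
    have c: "?c \<in> hecke_cosets N d" using \<gamma> by (auto simp: hecke_cosets_def)
    obtain h where h: "h \<in> ?H" "r ?c = h ** \<gamma>" using r by blast
    obtain g' where g': "g' \<in> Gamma0 N" "di ** ratm h = ratm g' ** di"
      using h(1) by (auto simp: hecke_subgroup_iff)
    have "di ** ratm (r ?c) = di ** ratm h ** ratm \<gamma>" by (simp only: h(2) ratm_mult matrix_mul_assoc)
    also have "\<dots> = ratm g' ** (di ** ratm \<gamma>)" by (simp only: g'(2) matrix_mul_assoc)
    also have "\<dots> = ratm (g' ** g) ** U i" by (simp only: g(2) ratm_mult matrix_mul_assoc)
    finally have "R (r ?c) i" using Gamma0_mult g(1) g'(1) by (auto simp: R_def)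
    then have "idx (r ?c) = i"
      using idx_unique[OF idx(1) i idx(2)] r_Gamma[OF c] by blast
    then show "i \<in> (\<lambda>c. idx (r c)) ` hecke_cosets N d" using c by blast
    qed
  qed
  then have "(\<Sum>c\<in>hecke_cosets N d. h (idx (r c))) = (\<Sum>i\<in>I. h i)"
    by (rule sum.reindex_bij_betw)
  then show ?thesis using idx(3) r_Gamma by (simp add: r_def)
qed

end

text \<open>
  The representatives of the cosets are never written down.  The index \<open>i\<close> of the coset of \<open>\<gamma>\<close> is
  characterised by \<open>d\<inverse> \<gamma> \<in> Gamma0 N (E i) (p i)\<close> with \<open>(E i) (p i)\<close> upper triangular, which is all
  that is needed to evaluate the summand on a modular form.
\<close>

lemma hecke_coefficients:
  fixes E :: "'i \<Rightarrow> real mat4" and p :: "'i \<Rightarrow> int mat4" and s :: "'i \<Rightarrow> nat" and q :: nat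
  assumes chi: "dirichlet_character N chi" and "N > 0" and "k > 0" and mf: "siegel_modular_form k N chi F"
    and fe: "has_fourier_expansion F a"
    and d: "d ** di = mat 1" and "finite I" and "q > 0"
    and X: "\<And>i. i \<in> I \<Longrightarrow> transpose (X i) = X i" and s: "\<And>i. i \<in> I \<Longrightarrow> s i > 0"
    and A: "\<And>i. i \<in> I \<Longrightarrow> A i ** Ai i = mat 1"
    and int: "\<And>i r c. i \<in> I \<Longrightarrow> real q * A i $ r $ c \<in> \<int>"
    and p: "\<And>i. i \<in> I \<Longrightarrow> p i \<in> Gamma0 N" "\<And>i. i \<in> I \<Longrightarrow> det (blockD (p i)) = 1"
    and U: "\<And>i. i \<in> I \<Longrightarrow> E i ** ratm (p i) = block (A i) (A i ** X i) 0 ((1 / real (s i)) *\<^sub>R transpose (Ai i))"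
    and ex: "\<And>\<gamma>. \<gamma> \<in> Gamma0 N \<Longrightarrow> \<exists>i\<in>I. \<exists>g\<in>Gamma0 N.
       di ** ratm (\<gamma> ** symp_inv (p i)) = ratm g ** E i \<and>
       chi (det (blockD g)) = w i * chi (det (blockD (\<gamma> ** symp_inv (p i))))"
    and surj: "\<And>i. i \<in> I \<Longrightarrow> \<exists>\<gamma>\<in>Gamma0 N. \<exists>g\<in>Gamma0 N. di ** ratm \<gamma> = ratm g ** E i"
    and inj: "\<And>i j g. i \<in> I \<Longrightarrow> j \<in> I \<Longrightarrow> ratm g ** (E i ** ratm (p i)) = E j ** ratm (p j) \<Longrightarrow> i = j"
    and eig: "\<And>\<tau>. \<tau> \<in> siegel_h2 \<Longrightarrow> hecke_op d q k N chi F \<tau> = c * F \<tau>"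
  shows "\<exists>C. \<forall>T\<in>fourier_index. (\<Sum>i\<in>I. w i * of_real (det ((1 / real (s i)) *\<^sub>R transpose (Ai i))) powi (- int k) *
      (coeff0 a ((1 / real (s i)) *\<^sub>R (transpose (Ai i) ** T ** Ai i)) * cis2pi (trace (T ** X i)))) = C * a T"
proof -
  define Dm where "Dm i = (1 / real (s i)) *\<^sub>R transpose (Ai i)" for i
  \<comment> \<open>The determinant factor common to all summands. It is divided out later, so only
    its being non-zero matters.\<close>
  define \<kappa> where "\<kappa> = complex_of_real (det di powr (real k / 2))"
  have sc: "(x *\<^sub>R P) ** Q = x *\<^sub>R (P ** Q)" "P ** (x *\<^sub>R Q) = x *\<^sub>R (P ** Q)" for x and P Q :: "real mat2"
    by (cases P rule: m22_cases, cases Q rule: m22_cases, simp add: algebra_simps)+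
  have Di: "Dm i ** (real (s i) *\<^sub>R transpose (A i)) = mat 1" if "i \<in> I" for i
    using s[OF that] by (simp add: Dm_def sc matrix_transpose_mul[symmetric] A that)
  have det_ratm: "det (ratm \<gamma>) = 1 \<or> det (ratm \<gamma>) = -1" if "\<gamma> \<in> Gamma0 N" for \<gamma>
  proof -
    have "ratm \<gamma> \<in> Sp2" using that Sp2_iff_ratm by (auto simp: Gamma0_def)
    then show ?thesis using Sp2_det_sq by (simp add: power2_eq_1_iff)
  qed
  have det_powr: "complex_of_real (det (di ** ratm \<gamma>) powr (real k / 2)) = \<kappa>" if "\<gamma> \<in> Gamma0 N" for \<gamma>
    using det_ratm[OF that] by (auto simp: det_mul \<kappa>_def powr_def ln_minus)
  have "det di \<noteq> 0"
  proof
    assume "det di = 0"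
    then have "det (d ** di) = 0" by (simp add: det_mul)
    then show False by (simp add: d)
  qed
  then have "\<kappa> \<noteq> 0" by (simp add: \<kappa>_def)
  define h where "h \<tau> i = \<kappa> * (w i * of_real (det (Dm i)) powi (- int k) *
       F (cmplx (real (s i) *\<^sub>R A i) ** (\<tau> + cmplx (X i)) ** cmplx (transpose (A i))))" for \<tau> i
  define f where "f \<tau> \<gamma> = cnj (chi (det (blockD \<gamma>))) * slash k F (di ** ratm \<gamma>) \<tau>" for \<tau> \<gamma>
  have f_h: "f \<tau> \<gamma> = h \<tau> i"
    if \<tau>: "\<tau> \<in> siegel_h2" and \<gamma>: "\<gamma> \<in> Gamma0 N" and i: "i \<in> I" and g: "g \<in> Gamma0 N"
      and eq: "di ** ratm \<gamma> = ratm g ** (E i ** ratm (p i))"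
      and chi_g: "chi (det (blockD g)) = w i * chi (det (blockD \<gamma>))" for \<tau> \<gamma> i g
  proof -
    let ?\<tau> = "cmplx (real (s i) *\<^sub>R A i) ** (\<tau> + cmplx (X i)) ** cmplx (transpose (A i))"
    have h2: "?\<tau> \<in> siegel_h2" using siegel_h2_move[OF \<tau> X[OF i] _ A[OF i], of "real (s i)"] s[OF i] by simp
    have \<tau>': "?\<tau> = (cmplx (A i) ** \<tau> + cmplx (A i ** X i)) ** cmplx (real (s i) *\<^sub>R transpose (A i))"
    proof -
      obtain a b c d where Am: "A i = m22 a b c d" using m22_cases .
      obtain z1 z2 z3 z4 where Z: "\<tau> + cmplx (X i) = m22 z1 z2 z3 z4" using m22_cases .
      have "cmplx (A i) ** \<tau> + cmplx (A i ** X i) = cmplx (A i) ** (\<tau> + cmplx (X i))"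
        by (simp add: cmplx_mult matrix_add_ldistrib)
      then show ?thesis unfolding Z by (simp add: Am algebra_simps)
    qed
    have "slash k F (di ** ratm \<gamma>) \<tau> = of_real (det (di ** ratm \<gamma>) powr (real k / 2)) *
        of_real (det (Dm i)) powi (- int k) * (chi (det (blockD g)) * F ?\<tau>)"
      by (rule slash_ratm_mult_upper[OF mf g \<open>k > 0\<close> _ Di[OF i] \<tau>' h2])
         (simp only: eq U[OF i] Dm_def)
    \<comment> \<open>Modularity contributes \<open>chi (det (blockD g))\<close>, which by
      \<open>chi_g\<close> is \<open>w i\<close> times the character of \<open>\<gamma>\<close>; the
      latter cancels against the conjugate in the Hecke sum.\<close>
    then have "f \<tau> \<gamma> = (cnj (chi (det (blockD \<gamma>))) * chi (det (blockD \<gamma>))) * h \<tau> i"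
      unfolding f_def det_powr[OF \<gamma>] chi_g h_def by (simp add: mult_ac)
    then show ?thesis
      using chi_mult_cnj[OF chi \<open>N > 0\<close> Gamma0_coprime_det(1)[OF \<gamma>]] by simp
  qed
  have pinv: "ratm (symp_inv (p i)) ** ratm (p i) = mat 1" if "i \<in> I" for i
    using Gamma0_inv[OF p(1)[OF that]] by (simp add: ratm_mult[symmetric])
  have ex': "\<exists>i\<in>I. (\<exists>g\<in>Gamma0 N. di ** ratm \<gamma> = ratm g ** (E i ** ratm (p i))) \<and> f \<tau> \<gamma> = h \<tau> i"
    if \<tau>: "\<tau> \<in> siegel_h2" and \<gamma>: "\<gamma> \<in> Gamma0 N" for \<tau> \<gamma>
  proof -
    obtain i g where i: "i \<in> I" and g: "g \<in> Gamma0 N"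
      and 1: "di ** ratm (\<gamma> ** symp_inv (p i)) = ratm g ** E i"
      and 2: "chi (det (blockD g)) = w i * chi (det (blockD (\<gamma> ** symp_inv (p i))))"
      using ex[OF \<gamma>] by blast
    have "di ** ratm \<gamma> = di ** ratm \<gamma> ** (ratm (symp_inv (p i)) ** ratm (p i))"
      by (simp add: pinv i)
    also have "\<dots> = di ** ratm (\<gamma> ** symp_inv (p i)) ** ratm (p i)"
      by (simp only: ratm_mult matrix_mul_assoc)
    also have "\<dots> = ratm g ** (E i ** ratm (p i))" by (simp only: 1 matrix_mul_assoc)
    finally have eq: "di ** ratm \<gamma> = ratm g ** (E i ** ratm (p i))" .
    have "\<gamma> = \<gamma> ** symp_inv (p i) ** p i"
      by (simp add: matrix_mul_assoc[symmetric] Gamma0_inv[OF p(1)[OF i]])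
    \<comment> \<open>The factor \<open>p i\<close> has lower right determinant 1, so removing it
      does not change the character.\<close>
    then have "chi (det (blockD \<gamma>)) = chi (det (blockD (\<gamma> ** symp_inv (p i))))"
      using chi_det_mult[OF chi Gamma0_mult[OF \<gamma> Gamma0_symp_inv[OF p(1)[OF i]]] p(1)[OF i]]
        p(2)[OF i] chi_1[OF chi] by simp
    then have "f \<tau> \<gamma> = h \<tau> i" using f_h[OF \<tau> \<gamma> i g eq] 2 by simp
    then show ?thesis using i g eq by blast
  qed
  have surj': "\<exists>\<gamma>\<in>Gamma0 N. \<exists>g\<in>Gamma0 N. di ** ratm \<gamma> = ratm g ** (E i ** ratm (p i))" if i: "i \<in> I" for i
  proof -
    obtain \<gamma> g where \<gamma>: "\<gamma> \<in> Gamma0 N" and g: "g \<in> Gamma0 N" and eq: "di ** ratm \<gamma> = ratm g ** E i"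
      using surj[OF i] by blast
    have "di ** ratm (\<gamma> ** p i) = di ** ratm \<gamma> ** ratm (p i)" by (simp only: ratm_mult matrix_mul_assoc)
    then have "di ** ratm (\<gamma> ** p i) = ratm g ** (E i ** ratm (p i))" by (simp only: eq matrix_mul_assoc)
    then show ?thesis using Gamma0_mult[OF \<gamma> p(1)[OF i]] g by blast
  qed
  have op: "(\<Sum>i\<in>I. h \<tau> i) = (c / of_nat q powi (int k - 3)) * F \<tau>" if \<tau>: "\<tau> \<in> siegel_h2" for \<tau>
  proof -
    have "hecke_op d q k N chi F \<tau> = of_nat q powi (int k - 3) * (\<Sum>c\<in>hecke_cosets N d. f \<tau> (SOME \<gamma>. \<gamma> \<in> c))"
      by (simp add: hecke_op_def Let_def f_def matrix_inv_conj(1)[OF d])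
    also have "(\<Sum>c\<in>hecke_cosets N d. f \<tau> (SOME \<gamma>. \<gamma> \<in> c)) = (\<Sum>i\<in>I. h \<tau> i)"
    proof (rule sum_hecke_cosets[OF d, where U = "\<lambda>i. E i ** ratm (p i)"])
      fix i j and g :: "int mat4"
      assume "i \<in> I" "j \<in> I" "ratm g ** (E i ** ratm (p i)) = E j ** ratm (p j)"
      then show "i = j" by (rule inj)
    qed (use ex'[OF \<tau>] surj' in blast)+
    finally show ?thesis using eig[OF \<tau>] \<open>q > 0\<close> by (simp add: field_simps)
  qed
  define C where "C = c / of_nat q powi (int k - 3) / \<kappa>"
  have "(\<Sum>i\<in>I. w i * of_real (det (Dm i)) powi (- int k) *
      (coeff0 a ((1 / real (s i)) *\<^sub>R (transpose (Ai i) ** T ** Ai i)) * cis2pi (trace (T ** X i)))) = C * a T"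
    if "T \<in> fourier_index" for T
  proof (rule coefficient_identity[OF fe \<open>finite I\<close> \<open>q > 0\<close> X s A int _ that])
    fix \<tau> assume \<tau>: "\<tau> \<in> siegel_h2"
    have "\<kappa> * (\<Sum>i\<in>I. w i * of_real (det (Dm i)) powi (- int k) *
       F (cmplx (real (s i) *\<^sub>R A i) ** (\<tau> + cmplx (X i)) ** cmplx (transpose (A i)))) = \<kappa> * (C * F \<tau>)"
      using op[OF \<tau>] \<open>\<kappa> \<noteq> 0\<close> by (simp add: h_def sum_distrib_left C_def)
    then show "(\<Sum>i\<in>I. w i * of_real (det (Dm i)) powi (- int k) *
       F (cmplx (real (s i) *\<^sub>R A i) ** (\<tau> + cmplx (X i)) ** cmplx (transpose (A i)))) = C * F \<tau>"
      using \<open>\<kappa> \<noteq> 0\<close> by simp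
  qed
  then show ?thesis unfolding Dm_def by blast
qed

section \<open>Coset representatives\<close>

text \<open>The matrix \<open>g\<close> is \<open>di \<gamma> E^-1\<close>, and \<open>di\<close>
  and \<open>E\<close> are similitudes with the same multiplier \<open>x\<close>, which cancels. For
  membership in \<open>Gamma0 N\<close> only integrality and the lower left block remain.\<close>

lemma intertwine_Sp2:
  fixes E Ei di :: "real mat4" and g \<gamma> :: "int mat4"
  assumes eq: "di ** ratm \<gamma> = ratm g ** E" and \<gamma>: "\<gamma> \<in> Sp2"
    and di: "transpose di ** symp_J ** di = x *\<^sub>R symp_J" and E: "transpose E ** symp_J ** E = x *\<^sub>R symp_J"
    and Ei: "E ** Ei = mat 1"
  shows "g \<in> Sp2"
proof -
  have sc: "(y *\<^sub>R P) ** Q = y *\<^sub>R (P ** Q)" "P ** (y *\<^sub>R Q) = y *\<^sub>R (P ** Q)" for y and P Q :: "real mat4"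
    by (simp_all add: vec_eq_iff matrix_matrix_mult_def scaleR_sum_right algebra_simps sum_distrib_left)
  have \<gamma>': "transpose (ratm \<gamma>) ** symp_J ** ratm \<gamma> = symp_J"
    using \<gamma> Sp2_iff_ratm by (simp add: Sp2_def)
  have "transpose (ratm g ** E) ** symp_J ** (ratm g ** E) = transpose (di ** ratm \<gamma>) ** symp_J ** (di ** ratm \<gamma>)"
    by (simp only: eq)
  also have "\<dots> = transpose (ratm \<gamma>) ** (transpose di ** symp_J ** di) ** ratm \<gamma>"
    by (simp only: matrix_transpose_mul matrix_mul_assoc)
  also have "\<dots> = x *\<^sub>R symp_J" by (simp only: di sc \<gamma>')
  finally have "transpose Ei ** (transpose (ratm g ** E) ** symp_J ** (ratm g ** E)) ** Ei
     = transpose Ei ** (transpose E ** symp_J ** E) ** Ei"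
    by (simp only: E)
  also have "transpose Ei ** (transpose (ratm g ** E) ** symp_J ** (ratm g ** E)) ** Ei =
      transpose (ratm g ** (E ** Ei)) ** symp_J ** (ratm g ** (E ** Ei))"
    by (simp only: matrix_transpose_mul matrix_mul_assoc)
  also have "transpose Ei ** (transpose E ** symp_J ** E) ** Ei = transpose (E ** Ei) ** symp_J ** (E ** Ei)"
    by (simp only: matrix_transpose_mul matrix_mul_assoc)
  finally have "ratm g \<in> Sp2" by (simp add: Ei Sp2_def)
  then show ?thesis using Sp2_iff_ratm by blast
qed

section \<open>Base representatives and the divisibility patterns leading to them\<close>

abbreviation Z2 :: "'a::zero mat2" where "Z2 \<equiv> m22 0 0 0 0"

lemma scaleR_block [simp]: "x *\<^sub>R block A B C D = block (x *\<^sub>R A) (x *\<^sub>R B) (x *\<^sub>R C) (x *\<^sub>R D)"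
  for A :: "real mat2"
  by (simp add: mat4_eq_iff vec_eq_iff blockA_def blockB_def blockC_def blockD_def)

lemma Gamma0_m22_iff:
  "block A B (m22 c1 c2 c3 c4) D \<in> Gamma0 N \<longleftrightarrow>
     block A B (m22 c1 c2 c3 c4) D \<in> Sp2 \<and> int N dvd c1 \<and> int N dvd c2 \<and> int N dvd c3 \<and> int N dvd c4"
  by (auto simp: Gamma0_def forall_2)

text \<open>The representatives for \<open>T(q)\<close> up to integral upper triangular factors on
  the right. All have multiplier \<open>1 / q\<close>, like \<open>T_base1 q\<close>, which is the
  inverse of \<open>delta q\<close>.\<close>

definition T_base1 :: "nat \<Rightarrow> real mat4" where
  "T_base1 q = block (m22 (1 / q) 0 0 (1 / q)) Z2 Z2 (m22 1 0 0 1)"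
definition T_base2 :: "nat \<Rightarrow> real mat4" where
  "T_base2 q = block (m22 (1 / q) 0 0 1) Z2 Z2 (m22 1 0 0 (1 / q))"
definition T_base3 :: "nat \<Rightarrow> real mat4" where
  "T_base3 q = block (m22 1 0 0 1) Z2 Z2 (m22 (1 / q) 0 0 (1 / q))"
text \<open>The analogues for \<open>T_1(q^2)\<close>, of multiplier 1; \<open>T1_base1 q\<close> is
  the inverse of \<open>delta1 q\<close>. In \<open>T1_base2\<close> the only trace of
  \<open>q\<close> is a fractional translation.\<close>

definition T1_base1 :: "nat \<Rightarrow> real mat4" where
  "T1_base1 q = block (m22 (1 / q) 0 0 1) Z2 Z2 (m22 q 0 0 1)"
definition T1_base2 :: "nat \<Rightarrow> nat \<Rightarrow> real mat4" where
  "T1_base2 q y = block (m22 1 0 0 1) (m22 0 0 0 (y / q)) Z2 (m22 1 0 0 1)"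
definition T1_base3 :: "nat \<Rightarrow> real mat4" where
  "T1_base3 q = block (m22 1 0 0 q) Z2 Z2 (m22 1 0 0 (1 / q))"

text \<open>Here and in the next five lemmas \<open>g\<close> is \<open>di \<gamma> E^-1\<close> in
  coordinates, and the divisibility pattern assumed of \<open>\<gamma>\<close> makes it integral.
  The relation between the determinants gives the power of \<open>chi (int q)\<close> attached to
  the class.\<close>

lemma T_base1_intertwine:
  assumes "q > 0" and \<gamma>: "\<gamma> = block (m22 a1 a2 a3 a4) (m22 (int q * b1) (int q * b2) (int q * b3) (int q * b4))
      (m22 c1 c2 c3 c4) (m22 d1 d2 d3 d4)" "\<gamma> \<in> Gamma0 N"
  shows "\<exists>g\<in>Gamma0 N. T_base1 q ** ratm \<gamma> = ratm g ** T_base1 q \<and> det (blockD g) = det (blockD \<gamma>)"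
proof -
  define g where "g = block (m22 a1 a2 a3 a4) (m22 b1 b2 b3 b4)
     (m22 (int q * c1) (int q * c2) (int q * c3) (int q * c4)) (m22 d1 d2 d3 d4)"
  have eq: "T_base1 q ** ratm \<gamma> = ratm g ** T_base1 q"
    using \<open>q > 0\<close> by (simp add: T_base1_def \<gamma>(1) g_def)
  have "g \<in> Sp2"
    by (rule intertwine_Sp2[OF eq _ _ _, of "1 / q" "block (m22 q 0 0 q) Z2 Z2 (m22 1 0 0 1)"])
       (use \<gamma>(2) \<open>q > 0\<close> in \<open>simp_all add: T_base1_def symp_J_m22 mat_block mat_m22 zero_m22 Gamma0_def\<close>)
  then have "g \<in> Gamma0 N" using \<gamma> by (simp add: g_def Gamma0_m22_iff)
  then show ?thesis using eq by (intro bexI[of _ g]) (simp_all add: g_def \<gamma>(1))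
qed

lemma T_base2_intertwine:
  assumes "q > 0" and \<gamma>: "\<gamma> = block (m22 a1 (int q * a2) a3 (int q * a4)) (m22 (int q * b1) b2 (int q * b3) b4)
      (m22 c1 c2 c3 c4) (m22 d1 d2 d3 d4)" "\<gamma> \<in> Gamma0 N"
  shows "\<exists>g\<in>Gamma0 N. T_base1 q ** ratm \<gamma> = ratm g ** T_base2 q \<and> det (blockD g) = int q * det (blockD \<gamma>)"
proof -
  define g where "g = block (m22 a1 a2 a3 a4) (m22 b1 b2 b3 b4)
     (m22 (int q * c1) c2 (int q * c3) c4) (m22 d1 (int q * d2) d3 (int q * d4))"
  have eq: "T_base1 q ** ratm \<gamma> = ratm g ** T_base2 q"
    using \<open>q > 0\<close> by (simp add: T_base1_def T_base2_def \<gamma>(1) g_def)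
  have "g \<in> Sp2"
    by (rule intertwine_Sp2[OF eq _ _ _, of "1 / q" "block (m22 q 0 0 1) Z2 Z2 (m22 1 0 0 q)"])
       (use \<gamma>(2) \<open>q > 0\<close> in \<open>simp_all add: T_base1_def T_base2_def symp_J_m22 mat_block mat_m22 zero_m22 Gamma0_def\<close>)
  then have "g \<in> Gamma0 N" using \<gamma> by (simp add: g_def Gamma0_m22_iff)
  then show ?thesis using eq by (intro bexI[of _ g]) (simp_all add: g_def \<gamma>(1) algebra_simps)
qed

lemma T_base3_intertwine:
  assumes "q > 0" and \<gamma>: "\<gamma> = block (m22 (int q * a1) (int q * a2) (int q * a3) (int q * a4)) (m22 b1 b2 b3 b4)
      (m22 c1 c2 c3 c4) (m22 d1 d2 d3 d4)" "\<gamma> \<in> Gamma0 N"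
  shows "\<exists>g\<in>Gamma0 N. T_base1 q ** ratm \<gamma> = ratm g ** T_base3 q \<and> det (blockD g) = int q ^ 2 * det (blockD \<gamma>)"
proof -
  define g where "g = block (m22 a1 a2 a3 a4) (m22 b1 b2 b3 b4)
     (m22 c1 c2 c3 c4) (m22 (int q * d1) (int q * d2) (int q * d3) (int q * d4))"
  have eq: "T_base1 q ** ratm \<gamma> = ratm g ** T_base3 q"
    using \<open>q > 0\<close> by (simp add: T_base1_def T_base3_def \<gamma>(1) g_def)
  have "g \<in> Sp2"
    by (rule intertwine_Sp2[OF eq _ _ _, of "1 / q" "block (m22 1 0 0 1) Z2 Z2 (m22 q 0 0 q)"])
       (use \<gamma>(2) \<open>q > 0\<close> in \<open>simp_all add: T_base1_def T_base3_def symp_J_m22 mat_block mat_m22 zero_m22 Gamma0_def\<close>)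
  then have "g \<in> Gamma0 N" using \<gamma> by (simp add: g_def Gamma0_m22_iff)
  then show ?thesis using eq by (intro bexI[of _ g]) (simp_all add: g_def \<gamma>(1) algebra_simps power2_eq_square)
qed

lemma T1_base1_intertwine:
  assumes "q > 0" and \<gamma>: "\<gamma> = block (m22 a1 (int q * a2) a3 a4) (m22 (int q ^ 2 * b1) (int q * b2) (int q * b3) b4)
      (m22 c1 c2 c3 c4) (m22 d1 d2 (int q * d3) d4)" "\<gamma> \<in> Gamma0 N"
  shows "\<exists>g\<in>Gamma0 N. T1_base1 q ** ratm \<gamma> = ratm g ** T1_base1 q \<and> det (blockD g) = det (blockD \<gamma>)"
proof -
  define g where "g = block (m22 a1 a2 (int q * a3) a4) (m22 b1 b2 b3 b4)
     (m22 (int q ^ 2 * c1) (int q * c2) (int q * c3) c4) (m22 d1 (int q * d2) d3 d4)"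
  have eq: "T1_base1 q ** ratm \<gamma> = ratm g ** T1_base1 q"
    using \<open>q > 0\<close> by (simp add: T1_base1_def \<gamma>(1) g_def power2_eq_square)
  have "g \<in> Sp2"
    by (rule intertwine_Sp2[OF eq _ _ _, of "1" "block (m22 q 0 0 1) Z2 Z2 (m22 (1 / q) 0 0 1)"])
       (use \<gamma>(2) \<open>q > 0\<close> in \<open>simp_all add: T1_base1_def symp_J_m22 mat_block mat_m22 zero_m22 Gamma0_def\<close>)
  then have "g \<in> Gamma0 N" using \<gamma> by (simp add: g_def Gamma0_m22_iff)
  then show ?thesis using eq by (intro bexI[of _ g]) (simp_all add: g_def \<gamma>(1) algebra_simps)
qed

lemma T1_base2_intertwine:
  assumes "q > 0" and \<gamma>: "\<gamma> = block (m22 (int q * a1) (int q * a2) a3 (int q * a4))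
      (m22 (int q * b1) (int q * b2 + a2 * int y) b3 b4)
      (m22 c1 c2 c3 (int q * c4)) (m22 d1 d2 d3 d4)" "\<gamma> \<in> Gamma0 N" and "coprime (int q) (int N)"
  shows "\<exists>g\<in>Gamma0 N. T1_base1 q ** ratm \<gamma> = ratm g ** T1_base2 q y \<and>
     [det (blockD g) = int q * det (blockD \<gamma>)] (mod int N)"
proof -
  define g where "g = block (m22 a1 a2 a3 (int q * a4)) (m22 b1 b2 b3 (b4 - a4 * int y))
     (m22 (int q * c1) (int q * c2) c3 (int q * c4)) (m22 (int q * d1) (int q * d2 - c2 * int y) d3 (d4 - c4 * int y))"
  have eq: "T1_base1 q ** ratm \<gamma> = ratm g ** T1_base2 q y"
    using \<open>q > 0\<close> by (simp add: T1_base1_def T1_base2_def \<gamma>(1) g_def field_simps)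
  have "g \<in> Sp2"
    by (rule intertwine_Sp2[OF eq _ _ _, of "1" "block (m22 1 0 0 1) (m22 0 0 0 (- (y / q))) Z2 (m22 1 0 0 1)"])
       (use \<gamma>(2) \<open>q > 0\<close> in \<open>simp_all add: T1_base1_def T1_base2_def symp_J_m22 mat_block mat_m22 zero_m22 Gamma0_def\<close>)
  then have "g \<in> Gamma0 N" using \<gamma> by (simp add: g_def Gamma0_m22_iff)
  \<comment> \<open>The fractional translation mixes lower left entries into the lower right block
    of \<open>g\<close>, so the determinants are compared modulo \<open>N\<close> only.\<close>
  have "int q * det (blockD \<gamma>) - det (blockD g) = d1 * (int q * c4) * int y - c2 * int y * d3"
    by (simp add: g_def \<gamma>(1) algebra_simps)
  moreover have "int N dvd d1 * (int q * c4) * int y - c2 * int y * d3"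
    using \<gamma> by (intro dvd_diff) (auto simp: Gamma0_m22_iff)
  ultimately have "[int q * det (blockD \<gamma>) = det (blockD g)] (mod int N)"
    by (simp only: cong_iff_dvd_diff)
  then show ?thesis using eq \<open>g \<in> Gamma0 N\<close> by (intro bexI[of _ g]) (simp_all add: cong_sym)
qed

lemma T1_base3_intertwine:
  assumes "q > 0" and \<gamma>: "\<gamma> = block (m22 (int q * a1) (int q ^ 2 * a2) a3 (int q * a4)) (m22 (int q * b1) b2 b3 b4)
      (m22 c1 c2 c3 (int q * c4)) (m22 d1 d2 d3 d4)" "\<gamma> \<in> Gamma0 N" and "coprime (int q) (int N)"
  shows "\<exists>g\<in>Gamma0 N. T1_base1 q ** ratm \<gamma> = ratm g ** T1_base3 q \<and> det (blockD g) = int q ^ 2 * det (blockD \<gamma>)"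
proof -
  define g where "g = block (m22 a1 a2 a3 a4) (m22 b1 b2 b3 (int q * b4))
     (m22 (int q * c1) c2 c3 c4) (m22 (int q * d1) (int q ^ 2 * d2) d3 (int q * d4))"
  have eq: "T1_base1 q ** ratm \<gamma> = ratm g ** T1_base3 q"
    using \<open>q > 0\<close> by (simp add: T1_base1_def T1_base3_def \<gamma>(1) g_def power2_eq_square)
  have "g \<in> Sp2"
    by (rule intertwine_Sp2[OF eq _ _ _, of "1" "block (m22 1 0 0 (1 / q)) Z2 Z2 (m22 1 0 0 q)"])
       (use \<gamma>(2) \<open>q > 0\<close> in \<open>simp_all add: T1_base1_def T1_base3_def symp_J_m22 mat_block mat_m22 zero_m22 Gamma0_def\<close>)
  \<comment> \<open>This entry of \<open>g\<close> is an entry of \<open>\<gamma>\<close> divided by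
    \<open>q\<close>; divisibility by \<open>N\<close> survives because \<open>q\<close> is prime to
    \<open>N\<close>.\<close>
  moreover have "int N dvd c4"
    using \<gamma> assms(4) by (simp add: Gamma0_m22_iff coprime_commute coprime_dvd_mult_right_iff)
  ultimately have "g \<in> Gamma0 N" using \<gamma> by (simp add: g_def Gamma0_m22_iff)
  then show ?thesis using eq by (intro bexI[of _ g]) (simp_all add: g_def \<gamma>(1) algebra_simps power2_eq_square)
qed

section \<open>Lines modulo \<open>q\<close>\<close>

lemma lin_solve:
  assumes "coprime a (int M)" and "M > 0"
  obtains t :: nat where "t < M" "int M dvd a * int t + b"
proof -
  obtain u where u: "[a * u = 1] (mod int M)" using cong_solve_coprime_int[OF assms(1)] by blast
  define t where "t = nat ((- b * u) mod int M)"
  have t: "int t = (- b * u) mod int M" using \<open>M > 0\<close> by (simp add: t_def)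
  have "t < M" using t \<open>M > 0\<close> by (metis of_nat_0_less_iff of_nat_less_iff pos_mod_bound)
  have "[int t = - b * u] (mod int M)" unfolding t by (simp add: cong_def)
  then have "[a * int t + b = a * (- b * u) + b] (mod int M)" by (intro cong_add cong_mult cong_refl)
  also have "a * (- b * u) + b = b * (1 - a * u)" by (simp add: algebra_simps)
  also have "[b * (1 - a * u) = b * (1 - 1)] (mod int M)" using u by (intro cong_mult cong_diff cong_refl)
  finally have "int M dvd a * int t + b" by (simp add: cong_0_iff)
  with \<open>t < M\<close> show ?thesis by (rule that)
qed

text \<open>
  The second column of \<open>lineI q t\<close>, which is \<open>(t, 1)\<close> for \<open>t < q\<close> and \<open>(1, 0)\<close> for \<open>t = q\<close>, runs
  over the points of the projective line over the field with \<open>q\<close> elements.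
\<close>

definition lineM :: "nat \<Rightarrow> nat \<Rightarrow> 'a::comm_ring_1 mat2" where
  "lineM q t = (if t < q then m22 1 (- of_nat t) 0 1 else m22 0 (-1) 1 0)"
definition lineI :: "nat \<Rightarrow> nat \<Rightarrow> 'a::comm_ring_1 mat2" where
  "lineI q t = (if t < q then m22 1 (of_nat t) 0 1 else m22 0 1 (-1) 0)"

lemma line_mat_inverse [simp]: "lineM q t ** lineI q t = mat 1" "lineI q t ** lineM q t = mat 1"
  by (simp_all add: lineM_def lineI_def mat_m22)

lemma realm_lineM [simp]: "map_matrix real_of_int (lineM q t) = lineM q t" "map_matrix real_of_int (lineI q t) = lineI q t"
  by (simp_all add: lineM_def lineI_def)

lemma coprime_primeI: "prime q \<Longrightarrow> \<not> int q dvd x \<Longrightarrow> coprime x (int q)"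
  using prime_imp_coprime[of "int q" x] by (simp add: coprime_commute)

lemma line_exists:
  fixes x y :: int
  assumes "prime q"
  obtains t where "t \<le> q" "int q dvd x * lineI q t $ 1 $ 2 + y * lineI q t $ 2 $ 2"
proof (cases "int q dvd x")
  case True
  then show ?thesis by (intro that[of q]) (simp_all add: lineI_def)
next
  case False
  then have "coprime x (int q)" using assms by (simp add: coprime_primeI)
  then obtain t where "t < q" "int q dvd x * int t + y"
    using lin_solve[of x q y] assms prime_gt_0_nat by blast
  then show ?thesis by (intro that[of t]) (simp_all add: lineI_def)
qed

text \<open>The first row of \<open>lineM q t\<close> is the linear form vanishing on the line
  \<open>t\<close>, so the condition says that \<open>(x, y)\<close> lies on that line modulo
  \<open>q\<close>.\<close>

lemma dual_line_exists:
  fixes x y :: int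
  assumes "prime q"
  obtains t where "t \<le> q" "int q dvd x * lineM q t $ 1 $ 1 + y * lineM q t $ 1 $ 2"
proof (cases "int q dvd y")
  case True
  then show ?thesis by (intro that[of q]) (simp_all add: lineM_def)
next
  case False
  then have "coprime (- y) (int q)" using assms by (simp add: coprime_primeI)
  then obtain t where "t < q" "int q dvd (- y) * int t + x"
    using lin_solve[of "- y" q x] assms prime_gt_0_nat by blast
  then show ?thesis by (intro that[of t]) (simp_all add: lineM_def algebra_simps)
qed

text \<open>The upper right entry is the form cutting out the line \<open>t'\<close>, evaluated on
  the line \<open>t\<close>; it vanishes modulo \<open>q\<close> only if the lines coincide.\<close>

lemma line_unique:
  fixes z :: int
  assumes "t \<le> q" "t' \<le> q" and "q > 1" and "int q * z = (lineM q t' ** lineI q t) $ 1 $ 2"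
  shows "t = t'"
proof -
  have dvd: "int q dvd (lineM q t' ** lineI q t) $ 1 $ 2" using assms(4) by (metis dvd_triv_left)
  consider "t < q" "t' < q" | "t = q" "t' < q" | "t < q" "t' = q" | "t = q" "t' = q" using assms(1,2) by linarith
  then show ?thesis
  proof cases
    case 1
    then have "int q dvd int t - int t'" using dvd by (simp add: lineM_def lineI_def)
    then show ?thesis using 1 by (metis cong_iff_dvd_diff cong_int_iff cong_less_modulus_unique_nat)
  qed (use dvd \<open>q > 1\<close> in \<open>auto simp: lineM_def lineI_def\<close>)
qed

section \<open>Integral upper triangular matrices and the separation of representatives\<close>

abbreviation realm :: "int mat2 \<Rightarrow> real mat2" where "realm \<equiv> map_matrix real_of_int"

lemma realm_mult: "realm (A ** B) = realm A ** realm B"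
  by (rule map_matrix_mult) auto

definition translation :: "int mat2 \<Rightarrow> int mat4" where
  "translation Y = block (m22 1 0 0 1) Y Z2 (m22 1 0 0 1)"
definition line_embed :: "nat \<Rightarrow> nat \<Rightarrow> int mat4" where
  "line_embed q t = block (lineM q t) Z2 Z2 (transpose (lineI q t))"

lemma translation_Gamma0: "translation (m22 y1 y2 y2 y3) \<in> Gamma0 N"
  by (simp add: translation_def Gamma0_m22_iff Sp2_def symp_J_m22)

lemma line_embed_Gamma0: "line_embed q t \<in> Gamma0 N"
  by (simp add: line_embed_def lineM_def lineI_def Gamma0_m22_iff Sp2_def symp_J_m22)

lemma det_blockD_translation_line_embed: "det (blockD (translation Y ** line_embed q t)) = 1"
  by (cases Y rule: m22_cases) (simp add: translation_def line_embed_def lineI_def)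

lemma symp_inv_translation_line_embed:
  "symp_inv (translation (m22 y1 y2 y2 y3) ** line_embed q t) = symp_inv (line_embed q t) ** translation (m22 (-y1) (-y2) (-y2) (-y3))"
  by (simp add: translation_def line_embed_def lineI_def lineM_def symp_inv_def)

lemma mult_translation_uminus:
  "block (m22 a1 a2 a3 a4) (m22 b1 b2 b3 b4) (m22 c1 c2 c3 c4) (m22 d1 d2 d3 d4) ** translation (m22 (-y1) (-y2) (-y2) (-y3))
   = block (m22 a1 a2 a3 a4) (m22 (b1 - (a1 * y1 + a2 * y2)) (b2 - (a1 * y2 + a2 * y3)) (b3 - (a3 * y1 + a4 * y2)) (b4 - (a3 * y2 + a4 * y3)))
      (m22 c1 c2 c3 c4) (m22 (d1 - (c1 * y1 + c2 * y2)) (d2 - (c1 * y2 + c2 * y3)) (d3 - (c3 * y1 + c4 * y2)) (d4 - (c3 * y2 + c4 * y3)))"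
  by (simp add: translation_def algebra_simps)

text \<open>Invertibility of \<open>A\<close> kills the lower left block of \<open>g\<close>, so
  equivalence of representatives reduces to integral blocks \<open>P\<close>, \<open>Q\<close>,
  \<open>R\<close>.\<close>

lemma upper_triangular_int:
  assumes eq: "ratm g ** block A B 0 D = block A' B' 0 D'" and A: "A ** Ai = mat 1"
  obtains P Q R where "realm P ** A = A'" "realm P ** B + realm Q ** D = B'" "realm R ** D = D'"
proof -
  obtain P Q V R where g: "g = block P Q V R" using mat4_cases .
  have z: "M ** (0 :: real mat2) = 0" "0 ** M = 0" for M :: "real mat2"
    by (cases M rule: m22_cases, simp add: zero_m22)+
  have 1: "realm P ** A = A'" "realm P ** B + realm Q ** D = B'" "realm V ** A = 0" "realm V ** B + realm R ** D = D'"
    using eq by (simp_all add: g z)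
  have "realm V = realm V ** A ** Ai" by (simp add: matrix_mul_assoc[symmetric] A)
  then have "realm V = 0" by (simp add: 1(3) z)
  then have "realm R ** D = D'" using 1(4) by (simp add: z)
  then show ?thesis using that 1(1,2) by blast
qed

text \<open>The integer \<open>z\<close> is positive, hence at least 1. Applied to the determinants
  of both diagonal blocks, this separates representatives of different type.\<close>

lemma exponent_le_of_int:
  assumes "real_of_int z * real q ^ m = real q ^ n" and "q > 1"
  shows "m \<le> n"
proof -
  have "z > 0" using assms by (metis of_int_0_less_iff of_nat_0_less_iff zero_less_mult_pos2 zero_less_power order.strict_trans zero_less_one)
  then have "real q ^ m \<le> real_of_int z * real q ^ m" using assms(2) by (simp add: mult_le_cancel_right1)
  then have "real q ^ m \<le> real q ^ n" using assms(1) by simp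
  then show ?thesis using assms(2) by simp
qed

lemma eq_of_diff_multiple:
  fixes y y' M :: nat
  assumes "real y + real M * real_of_int z = real y'" "y < M" "y' < M"
  shows "y = y'"
proof -
  have "real_of_int (int y + int M * z) = real_of_int (int y')" using assms(1) by simp
  then have "int y + int M * z = int y'" by (simp only: of_int_eq_iff)
  then have "[int y = int y'] (mod int M)" by (metis cong_add_lcancel_0 cong_mult_self_left cong_sym)
  then show ?thesis using assms(2,3) by (metis cong_int_iff cong_less_modulus_unique_nat)
qed

text \<open>After cancelling \<open>lineM q t\<close>, integrality of the upper right entry of
  \<open>P\<close> says that \<open>q\<close> divides the upper right entry of
  \<open>lineM q t' ** lineI q t\<close>, and \<open>line_unique\<close> applies.\<close>

lemma line_of_int:
  assumes eq: "realm P ** (m22 (1 / q) 0 0 1 ** lineM q t) = m22 (1 / q) 0 0 1 ** lineM q t'"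
    and t: "t \<le> q" "t' \<le> q" and "q > 1"
  shows "t = t' \<and> P = mat 1"
proof -
  obtain p1 p2 p3 p4 where P: "P = m22 p1 p2 p3 p4" using m22_cases .
  obtain h1 h2 h3 h4 where h: "lineM q t' ** lineI q t = (m22 h1 h2 h3 h4 :: int mat2)" using m22_cases .
  have h': "lineM q t' ** lineI q t = (m22 (of_int h1) (of_int h2) (of_int h3) (of_int h4) :: real mat2)"
  proof -
    have "lineM q t' ** lineI q t = realm (lineM q t' ** lineI q t)" by (simp only: realm_mult realm_lineM)
    then show ?thesis by (simp add: h)
  qed
  have "realm P ** m22 (1 / q) 0 0 1 ** (lineM q t ** lineI q t) = m22 (1 / q) 0 0 1 ** (lineM q t' ** lineI q t)"
    using arg_cong[OF eq, of "\<lambda>M. M ** lineI q t"] by (simp only: matrix_mul_assoc)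
  then have PH: "m22 (p1 / q) (of_int p2) (p3 / q) (of_int p4) = m22 (h1 / q) (h2 / q) (of_int h3) (of_int h4)"
    by (simp add: h' P)
  then have "real_of_int (int q * p2) = real_of_int h2" using \<open>q > 1\<close> by (simp add: field_simps)
  then have "int q * p2 = h2" by (simp only: of_int_eq_iff)
  then have tt: "t = t'" using line_unique[OF t \<open>q > 1\<close>, of p2] by (simp add: h)
  then have "m22 h1 h2 h3 h4 = mat 1" using h by simp
  then show ?thesis using PH \<open>q > 1\<close> tt by (simp add: mat_m22 P)
qed

text \<open>A half-integral \<open>T\<close> paired with an integral symmetric matrix has integral
  trace, so integral translations leave Fourier coefficients unchanged.\<close>

lemma cis2pi_trace_int:
  assumes "T \<in> fourier_index" 
  shows "cis2pi (trace (T ** realm (m22 x1 x2 x2 x3))) = 1"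
proof -
  obtain t1 t2 t3 t4 where T: "T = m22 t1 t2 t3 t4" using m22_cases .
  have "t3 = t2" and i: "t1 \<in> \<int>" "2 * t2 \<in> \<int>" "t4 \<in> \<int>"
    using fourier_index_half_int[OF assms] by (auto simp: half_int_def T)
  have "trace (T ** realm (m22 x1 x2 x2 x3)) = t1 * x1 + (2 * t2) * x2 + t4 * x3"
    by (simp add: T \<open>t3 = t2\<close>)
  also have "\<dots> \<in> \<int>" by (intro Ints_add Ints_mult[OF i(1)] Ints_mult[OF i(2)] Ints_mult[OF i(3)]) auto
  finally show ?thesis by (rule cis_multiple_2pi)
qed

text \<open>The matrices \<open>V\<close> of determinant \<open>q\<close>: the columns span the
  sublattice of index \<open>q\<close> whose reduction modulo \<open>q\<close> is the line
  \<open>t\<close>.\<close>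

definition lineV :: "nat \<Rightarrow> nat \<Rightarrow> real mat2" where
  "lineV q t = lineI q t ** m22 q 0 0 1"

lemma bezout_coprime:
  assumes "coprime (x :: int) y"
  obtains d b where "x * d - b * y = 1"
proof -
  obtain u v where "u * x + v * y = 1" using assms bezout_int[of x y] by (auto simp: coprime_iff_gcd_eq_1)
  then show ?thesis by (intro that[of u "- v"]) (simp add: algebra_simps)
qed

section \<open>The operator \<open>T(q)\<close>\<close>

text \<open>
  For \<open>\<gamma>\<close> with upper blocks \<open>A\<close>, \<open>B\<close> the three summands correspond to the rank 2, 1, 0 of \<open>A\<close> modulo \<open>q\<close>.
  Only rank 2 occurs if \<open>q\<close> divides the level.
\<close>

type_synonym coset_index = "(nat \<times> nat \<times> nat) + ((nat \<times> nat) + nat)"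

definition T_unip :: "nat \<Rightarrow> coset_index \<Rightarrow> int mat4" where
  "T_unip q = case_sum (\<lambda>(y1, y2, y3). translation (m22 (int y1) (int y2) (int y2) (int y3)) ** line_embed q 0)
     (case_sum (\<lambda>(t, y). translation (m22 (int y) 0 0 0) ** line_embed q t) (\<lambda>_. translation (m22 0 0 0 0) ** line_embed q 0))"
definition T_base :: "nat \<Rightarrow> coset_index \<Rightarrow> real mat4" where
  "T_base q = case_sum (\<lambda>_. T_base1 q) (case_sum (\<lambda>_. T_base2 q) (\<lambda>_. T_base3 q))"

lemma lineM_0: "q > 0 \<Longrightarrow> lineM q 0 = m22 1 0 0 1" "q > 0 \<Longrightarrow> lineI q 0 = m22 1 0 0 1"
  by (simp_all add: lineM_def lineI_def)

lemma line_embed_0: "q > 0 \<Longrightarrow> line_embed q 0 = mat 1"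
  by (simp add: line_embed_def lineM_0 mat_block mat_m22 zero_m22)

lemma symp_inv_one: "symp_inv (mat 1) = (mat 1 :: int mat4)"
  by (simp add: symp_inv_def mat_block mat_m22 zero_m22)

text \<open>For \<open>q\<close> prime to the level these are
  \<open>q^3 + q (q + 1) + 1 = (q + 1) (q^2 + 1)\<close> indices, the number of Lagrangian planes in
  the symplectic space of dimension 4 over the field with \<open>q\<close> elements.\<close>

definition T_index :: "nat \<Rightarrow> nat \<Rightarrow> coset_index set" where
  "T_index N q = ({..<q} \<times> {..<q} \<times> {..<q}) <+> (if q dvd N then {} else ({..q} \<times> {..<q}) <+> {0})"

lemma T_indexI:
  "y1 < q \<Longrightarrow> y2 < q \<Longrightarrow> y3 < q \<Longrightarrow> Inl (y1, y2, y3) \<in> T_index N q"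
  "\<not> q dvd N \<Longrightarrow> t \<le> q \<Longrightarrow> y < q \<Longrightarrow> Inr (Inl (t, y)) \<in> T_index N q"
  "\<not> q dvd N \<Longrightarrow> Inr (Inr 0) \<in> T_index N q"
  by (auto simp: T_index_def)

lemma T_coset_exists:
  assumes q: "prime q" and \<gamma>: "\<gamma> \<in> Gamma0 N" and chi: "dirichlet_character N chi"
  shows "\<exists>i\<in>T_index N q. \<exists>g\<in>Gamma0 N.
       T_base1 q ** ratm (\<gamma> ** symp_inv (T_unip q i)) = ratm g ** T_base q i \<and>
       chi (det (blockD g)) = case_sum (\<lambda>_. 1) (case_sum (\<lambda>_. chi (int q)) (\<lambda>_. chi (int q) ^ 2)) i
          * chi (det (blockD (\<gamma> ** symp_inv (T_unip q i))))"
proof -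
  have "q > 0" "q > 1" using q prime_gt_0_nat prime_gt_1_nat by blast+
  have pq: "prime (int q)" using q by simp
  obtain A B C D where gb: "\<gamma> = block A B C D" using mat4_cases .
  obtain a1 a2 a3 a4 where A: "A = m22 a1 a2 a3 a4" using m22_cases .
  obtain b1 b2 b3 b4 where B: "B = m22 b1 b2 b3 b4" using m22_cases .
  obtain c1 c2 c3 c4 where C: "C = m22 c1 c2 c3 c4" using m22_cases .
  obtain d1 d2 d3 d4 where D: "D = m22 d1 d2 d3 d4" using m22_cases .
  note \<gamma>_eq = gb[unfolded A B C D]
  have G0: "\<gamma> ** symp_inv (translation (m22 y1 y2 y2 y3) ** line_embed q 0) = \<gamma> ** translation (m22 (-y1) (-y2) (-y2) (-y3))" for y1 y2 y3
    unfolding symp_inv_translation_line_embed by (simp add: line_embed_0 \<open>q > 0\<close> symp_inv_one)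
  have rel: "a1 * b3 + a2 * b4 - b1 * a3 - b2 * a4 = 0"
    by (rule Sp2_entries(1)[of _ _ _ _ _ _ _ _ c1 c2 c3 c4 d1 d2 d3 d4])
       (use \<gamma> in \<open>simp add: Gamma0_def \<gamma>_eq\<close>)
  let ?det = "a1 * a4 - a2 * a3"
  show ?thesis
  proof (cases "int q dvd ?det")
    case False
    then have cop: "coprime ?det (int q)" using q by (simp add: coprime_primeI)
    \<comment> \<open>Cramer's rule for a symmetric solution \<open>Y\<close> of
      \<open>A Y = B\<close> modulo \<open>q\<close>.\<close>
    obtain y1 where y1: "y1 < q" "int q dvd ?det * int y1 + - (a4 * b1 - a2 * b3)"
      using lin_solve[OF cop \<open>q > 0\<close>] by blast
    obtain y2 where y2: "y2 < q" "int q dvd ?det * int y2 + - (a4 * b2 - a2 * b4)"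
      using lin_solve[OF cop \<open>q > 0\<close>] by blast
    obtain y3 where y3: "y3 < q" "int q dvd ?det * int y3 + - (a1 * b4 - a3 * b2)"
      using lin_solve[OF cop \<open>q > 0\<close>] by blast
    \<comment> \<open>Cramer's rule gives two formulas for the off-diagonal entry of
      \<open>Y\<close>; they agree because \<open>A B^t\<close> is symmetric.\<close>
    have y2': "int q dvd ?det * int y2 + - (a1 * b3 - a3 * b1)"
    proof -
      have "a1 * b3 - a3 * b1 = a4 * b2 - a2 * b4" using rel by (simp add: algebra_simps)
      then show ?thesis using y2(2) by simp
    qed
    have canc: "int q dvd ?det * x \<Longrightarrow> int q dvd x" for x
      using False pq by (simp add: prime_dvd_mult_iff)
    have "int q dvd b1 - (a1 * int y1 + a2 * int y2)"
    proof (rule canc)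
      have "?det * (b1 - (a1 * int y1 + a2 * int y2)) = - a1 * (?det * int y1 + - (a4 * b1 - a2 * b3))
          - a2 * (?det * int y2 + - (a1 * b3 - a3 * b1))" by (simp add: algebra_simps)
      then show "int q dvd ?det * (b1 - (a1 * int y1 + a2 * int y2))"
        using y1(2) y2' by (simp only: dvd_diff dvd_mult)
    qed
    then obtain b1' where b1': "b1 - (a1 * int y1 + a2 * int y2) = int q * b1'" by (elim dvdE)
    have "int q dvd b2 - (a1 * int y2 + a2 * int y3)"
    proof (rule canc)
      have "?det * (b2 - (a1 * int y2 + a2 * int y3)) = - a1 * (?det * int y2 + - (a4 * b2 - a2 * b4))
          - a2 * (?det * int y3 + - (a1 * b4 - a3 * b2))" by (simp add: algebra_simps)
      then show "int q dvd ?det * (b2 - (a1 * int y2 + a2 * int y3))"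
        using y2(2) y3(2) by (simp only: dvd_diff dvd_mult)
    qed
    then obtain b2' where b2': "b2 - (a1 * int y2 + a2 * int y3) = int q * b2'" by (elim dvdE)
    have "int q dvd b3 - (a3 * int y1 + a4 * int y2)"
    proof (rule canc)
      have "?det * (b3 - (a3 * int y1 + a4 * int y2)) = - a3 * (?det * int y1 + - (a4 * b1 - a2 * b3))
          - a4 * (?det * int y2 + - (a1 * b3 - a3 * b1))" by (simp add: algebra_simps)
      then show "int q dvd ?det * (b3 - (a3 * int y1 + a4 * int y2))"
        using y1(2) y2' by (simp only: dvd_diff dvd_mult)
    qed
    then obtain b3' where b3': "b3 - (a3 * int y1 + a4 * int y2) = int q * b3'" by (elim dvdE)
    have "int q dvd b4 - (a3 * int y2 + a4 * int y3)"
    proof (rule canc)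
      have "?det * (b4 - (a3 * int y2 + a4 * int y3)) = - a3 * (?det * int y2 + - (a4 * b2 - a2 * b4))
          - a4 * (?det * int y3 + - (a1 * b4 - a3 * b2))" by (simp add: algebra_simps)
      then show "int q dvd ?det * (b4 - (a3 * int y2 + a4 * int y3))"
        using y2(2) y3(2) by (simp only: dvd_diff dvd_mult)
    qed
    then obtain b4' where b4': "b4 - (a3 * int y2 + a4 * int y3) = int q * b4'" by (elim dvdE)
    let ?i = "Inl (y1, y2, y3) :: coset_index"
    have p: "\<gamma> ** symp_inv (T_unip q ?i) = \<gamma> ** translation (m22 (- int y1) (- int y2) (- int y2) (- int y3))"
      by (simp add: T_unip_def G0)
    have "\<gamma> ** symp_inv (T_unip q ?i) \<in> Gamma0 N" unfolding p by (intro Gamma0_mult \<gamma> translation_Gamma0)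
    moreover note p[unfolded \<gamma>_eq mult_translation_uminus b1' b2' b3' b4', folded \<gamma>_eq]
    ultimately obtain g where "g \<in> Gamma0 N" "T_base1 q ** ratm (\<gamma> ** symp_inv (T_unip q ?i)) = ratm g ** T_base1 q"
      "det (blockD g) = det (blockD (\<gamma> ** symp_inv (T_unip q ?i)))"
      using T_base1_intertwine[OF \<open>q > 0\<close>] by blast
    then show ?thesis
      using T_indexI(1)[OF y1(1) y2(1) y3(1)] by (intro bexI[of _ ?i] bexI[of _ g]) (simp_all add: T_base_def)
  next
    case True
    have "\<not> q dvd N"
    proof
      assume "q dvd N"
      have "coprime ?det (int N)" using Gamma0_coprime_det(2)[OF \<gamma>] by (simp add: \<gamma>_eq)
      then have "is_unit (int q)" using True \<open>q dvd N\<close> coprime_common_divisor by (metis of_nat_dvd_iff)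
      then show False using pq not_prime_unit by blast
    qed
    show ?thesis
    proof (cases "int q dvd a1 \<and> int q dvd a2 \<and> int q dvd a3 \<and> int q dvd a4")
      case all: True
      then obtain a1' a2' a3' a4' where a': "a1 = int q * a1'" "a2 = int q * a2'" "a3 = int q * a3'" "a4 = int q * a4'"
        by (elim conjE dvdE)
      let ?i = "Inr (Inr 0) :: coset_index"
      have p: "\<gamma> ** symp_inv (T_unip q ?i) = \<gamma>"
      proof -
        have "translation Z2 = mat 1" by (simp add: translation_def mat_block mat_m22 zero_m22)
        then show ?thesis by (simp add: T_unip_def line_embed_0 \<open>q > 0\<close> symp_inv_one)
      qed
      obtain g where "g \<in> Gamma0 N" "T_base1 q ** ratm \<gamma> = ratm g ** T_base3 q"
        "det (blockD g) = int q ^ 2 * det (blockD \<gamma>)"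
        using T_base3_intertwine[OF \<open>q > 0\<close> _ \<gamma>] \<gamma>_eq[unfolded a'] by blast
      then show ?thesis
        using T_indexI(3)[OF \<open>\<not> q dvd N\<close>] chi_mult[OF chi]
        by (intro bexI[of _ ?i] bexI[of _ g]) (simp_all add: T_base_def p power2_eq_square)
    next
      case nall: False
      \<comment> \<open>Here \<open>A\<close> has rank 1 modulo \<open>q\<close>. A line killed by a
        non-zero row is killed by the other row too, as the determinant vanishes;
        \<open>lineI q t\<close> moves this kernel to the second coordinate.\<close>
      have "\<exists>t\<le>q. int q dvd a1 * lineI q t $ 1 $ 2 + a2 * lineI q t $ 2 $ 2 \<and> int q dvd a3 * lineI q t $ 1 $ 2 + a4 * lineI q t $ 2 $ 2"
      proof (cases "int q dvd a1 \<and> int q dvd a2")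
        case False
        obtain t where t: "t \<le> q" "int q dvd a1 * lineI q t $ 1 $ 2 + a2 * lineI q t $ 2 $ 2"
          using line_exists[OF q] by blast
        define v1 v2 where "v1 = (lineI q t $ 1 $ 2 :: int)" and "v2 = (lineI q t $ 2 $ 2 :: int)"
        have 1: "int q dvd a1 * (a3 * v1 + a4 * v2)"
        proof -
          have "a1 * (a3 * v1 + a4 * v2) = a3 * (a1 * v1 + a2 * v2) + v2 * ?det" by (simp add: algebra_simps)
          then show ?thesis using t(2) True by (simp only: dvd_add dvd_mult v1_def v2_def)
        qed
        have 2: "int q dvd a2 * (a3 * v1 + a4 * v2)"
        proof -
          have "a2 * (a3 * v1 + a4 * v2) = a4 * (a1 * v1 + a2 * v2) - v1 * ?det" by (simp add: algebra_simps)
          then show ?thesis using t(2) True by (simp only: dvd_diff dvd_mult v1_def v2_def)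
        qed
        from 1 2 False have "int q dvd a3 * v1 + a4 * v2" using pq by (auto simp only: prime_dvd_mult_iff)
        then show ?thesis using t by (auto simp: v1_def v2_def)
      next
        case c12: True
        then have False: "\<not> (int q dvd a3 \<and> int q dvd a4)" using nall by blast
        obtain t where t: "t \<le> q" "int q dvd a3 * lineI q t $ 1 $ 2 + a4 * lineI q t $ 2 $ 2"
          using line_exists[OF q] by blast
        moreover have "int q dvd a1 * lineI q t $ 1 $ 2 + a2 * lineI q t $ 2 $ 2"
          using c12 by (intro dvd_add dvd_mult2) auto
        ultimately show ?thesis by blast
      qed
      then obtain t where t: "t \<le> q" "int q dvd a1 * lineI q t $ 1 $ 2 + a2 * lineI q t $ 2 $ 2"
         "int q dvd a3 * lineI q t $ 1 $ 2 + a4 * lineI q t $ 2 $ 2" by blast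
      define \<gamma>' where "\<gamma>' = \<gamma> ** symp_inv (line_embed q t)"
      have \<gamma>': "\<gamma>' \<in> Gamma0 N" unfolding \<gamma>'_def by (intro Gamma0_mult \<gamma> Gamma0_symp_inv line_embed_Gamma0)
      obtain A' B' C' D' where gb': "\<gamma>' = block A' B' C' D'" using mat4_cases .
      have A'_eq: "A' = m22 a1 a2 a3 a4 ** lineI q t"
        using gb' by (simp add: \<gamma>'_def \<gamma>_eq line_embed_def symp_inv_def lineI_def split: if_splits)
      obtain e1 e2 e3 e4 where A': "A' = m22 e1 e2 e3 e4" using m22_cases .
      obtain f1 f2 f3 f4 where B': "B' = m22 f1 f2 f3 f4" using m22_cases .
      obtain u1 u2 u3 u4 where C': "C' = m22 u1 u2 u3 u4" using m22_cases .
      obtain v1 v2 v3 v4 where D': "D' = m22 v1 v2 v3 v4" using m22_cases .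
      note \<gamma>'_eq = gb'[unfolded A' B' C' D']
      have e2: "int q dvd e2" and e4: "int q dvd e4"
      proof -
        obtain g1 g2 g3 g4 where gg: "lineI q t = (m22 g1 g2 g3 g4 :: int mat2)" using m22_cases .
        have "e2 = a1 * lineI q t $ 1 $ 2 + a2 * lineI q t $ 2 $ 2" "e4 = a3 * lineI q t $ 1 $ 2 + a4 * lineI q t $ 2 $ 2"
          using A'_eq by (simp_all add: A' gg)
        then show "int q dvd e2" "int q dvd e4" using t by simp_all
      qed
      then obtain e2' e4' where e': "e2 = int q * e2'" "e4 = int q * e4'" by (elim dvdE)
      have e13: "\<not> (int q dvd e1 \<and> int q dvd e3)"
      proof
        assume "int q dvd e1 \<and> int q dvd e3"
        then obtain e1' e3' where "e1 = int q * e1'" "e3 = int q * e3'" by (elim conjE dvdE)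
        moreover have "m22 a1 a2 a3 a4 = A' ** lineM q t" by (simp add: A'_eq matrix_mul_assoc[symmetric])
        ultimately have "int q dvd a1 \<and> int q dvd a2 \<and> int q dvd a3 \<and> int q dvd a4"
          using e' by (cases "lineM q t :: int mat2" rule: m22_cases)
             (simp add: A' distrib_left[symmetric] mult.assoc)
        then show False using nall by blast
      qed
      have rel': "e1 * f3 + e2 * f4 - f1 * e3 - f2 * e4 = 0"
        by (rule Sp2_entries(1)[of _ _ _ _ _ _ _ _ u1 u2 u3 u4 v1 v2 v3 v4])
           (use \<gamma>' in \<open>simp add: Gamma0_def \<gamma>'_eq\<close>)
      \<comment> \<open>With the second column of the upper left block zero modulo \<open>q\<close>,
        symmetry of \<open>A B^t\<close> makes the first column of the upper right block
        proportional to that of the upper left one; \<open>y\<close> is the ratio.\<close>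
      have rel'': "int q dvd e1 * f3 - e3 * f1"
      proof -
        have "e1 * f3 - e3 * f1 = int q * (f2 * e4' - e2' * f4)" using rel' e' by (simp add: algebra_simps)
        then show ?thesis by simp
      qed
      have "\<exists>y<q. int q dvd f1 - e1 * int y \<and> int q dvd f3 - e3 * int y"
      proof (cases "int q dvd e1")
        case False
        then have "coprime e1 (int q)" using q by (simp add: coprime_primeI)
        then obtain y where y: "y < q" "int q dvd e1 * int y + - f1" using lin_solve[OF _ \<open>q > 0\<close>] by blast
        have "e1 * (f3 - e3 * int y) = (e1 * f3 - e3 * f1) - e3 * (e1 * int y + - f1)" by (simp add: algebra_simps)
        then have "int q dvd e1 * (f3 - e3 * int y)" using y(2) rel'' by (simp only: dvd_diff dvd_mult)
        then have "int q dvd f3 - e3 * int y" using False pq by (simp only: prime_dvd_mult_iff) simp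
        moreover have "int q dvd f1 - e1 * int y" using y(2) by (metis add_uminus_conv_diff dvd_minus_iff minus_diff_eq)
        ultimately show ?thesis using y(1) by blast
      next
        case True
        then have F3: "\<not> int q dvd e3" using e13 by blast
        then have "coprime e3 (int q)" using q by (simp add: coprime_primeI)
        then obtain y where y: "y < q" "int q dvd e3 * int y + - f3" using lin_solve[OF _ \<open>q > 0\<close>] by blast
        have "e3 * (f1 - e1 * int y) = - (e1 * f3 - e3 * f1) - e1 * (e3 * int y + - f3)" by (simp add: algebra_simps)
        then have "int q dvd e3 * (f1 - e1 * int y)" using y(2) rel'' by (simp only: dvd_diff dvd_mult dvd_minus_iff)
        then have "int q dvd f1 - e1 * int y" using F3 pq by (simp only: prime_dvd_mult_iff) simp
        moreover have "int q dvd f3 - e3 * int y" using y(2) by (metis add_uminus_conv_diff dvd_minus_iff minus_diff_eq)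
        ultimately show ?thesis using y(1) by blast
      qed
      then obtain y f1' f3' where y: "y < q" and f': "f1 - e1 * int y = int q * f1'" "f3 - e3 * int y = int q * f3'"
        by (elim exE conjE dvdE)
      let ?i = "Inr (Inl (t, y)) :: coset_index"
      have p: "\<gamma> ** symp_inv (T_unip q ?i) = \<gamma>' ** translation (m22 (- int y) (- 0) (- 0) (- 0))"
        using symp_inv_translation_line_embed[of "int y" 0 0] by (simp add: T_unip_def \<gamma>'_def matrix_mul_assoc)
      have mem: "\<gamma> ** symp_inv (T_unip q ?i) \<in> Gamma0 N" unfolding p by (intro Gamma0_mult \<gamma>' translation_Gamma0)
      have form: "\<gamma> ** symp_inv (T_unip q ?i) = block (m22 e1 (int q * e2') e3 (int q * e4')) (m22 (int q * f1') f2 (int q * f3') f4)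
           (m22 u1 u2 u3 u4) (m22 (v1 - u1 * int y) v2 (v3 - u3 * int y) v4)"
        unfolding p \<gamma>'_eq mult_translation_uminus by (simp add: f' e')
      obtain g where "g \<in> Gamma0 N" "T_base1 q ** ratm (\<gamma> ** symp_inv (T_unip q ?i)) = ratm g ** T_base2 q"
        "det (blockD g) = int q * det (blockD (\<gamma> ** symp_inv (T_unip q ?i)))"
        using T_base2_intertwine[OF \<open>q > 0\<close> form mem] by blast
      then show ?thesis
        using T_indexI(2)[OF \<open>\<not> q dvd N\<close> t(1) y] chi_mult[OF chi]
        by (intro bexI[of _ ?i] bexI[of _ g]) (simp_all add: T_base_def)
    qed
  qed
qed

text \<open>With \<open>T_Ainv\<close> and \<open>T_X\<close>, the blocks of the representatives in
  the shape that \<open>hecke_coefficients\<close> expects, with \<open>s = q\<close>.\<close>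

definition T_A :: "nat \<Rightarrow> coset_index \<Rightarrow> real mat2" where
  "T_A q = case_sum (\<lambda>_. m22 (1 / q) 0 0 (1 / q)) (case_sum (\<lambda>(t, y). m22 (1 / q) 0 0 1 ** lineM q t) (\<lambda>_. m22 1 0 0 1))"
definition T_Ainv :: "nat \<Rightarrow> coset_index \<Rightarrow> real mat2" where
  "T_Ainv q = case_sum (\<lambda>_. m22 q 0 0 q) (case_sum (\<lambda>(t, y). lineV q t) (\<lambda>_. m22 1 0 0 1))"
definition T_X :: "nat \<Rightarrow> coset_index \<Rightarrow> real mat2" where
  "T_X q = case_sum (\<lambda>(y1, y2, y3). realm (m22 y1 y2 y2 y3))
     (case_sum (\<lambda>(t, y). realm (lineI q t ** m22 y 0 0 0 ** transpose (lineI q t))) (\<lambda>_. realm (m22 0 0 0 0)))"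

lemma T_index_cases:
  assumes "i \<in> T_index N q"
  obtains (1) y1 y2 y3 where "i = Inl (y1, y2, y3)" "y1 < q" "y2 < q" "y3 < q"
    | (2) t y where "i = Inr (Inl (t, y))" "t \<le> q" "y < q" "\<not> q dvd N"
    | (3) "i = Inr (Inr 0)" "\<not> q dvd N"
  using assms by (auto simp: T_index_def split: if_splits)

lemma T_A_Ainv: "q > 0 \<Longrightarrow> T_A q i ** T_Ainv q i = mat 1"
  by (auto simp: T_A_def T_Ainv_def lineV_def lineM_def lineI_def mat_m22 split: sum.splits)

lemma T_A_int: "q > 0 \<Longrightarrow> real q * T_A q i $ r $ c \<in> \<int>"
proof -
  assume "q > 0"
  then have "\<forall>r c. real q * T_A q i $ r $ c \<in> \<int>"
    unfolding forall_2 by (auto simp: T_A_def lineM_def split: sum.splits)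
  then show ?thesis by blast
qed

lemma T_X_sym: "transpose (T_X q i) = T_X q i"
  by (auto simp: T_X_def lineI_def split: sum.splits)

lemma T_unip_Gamma0: "T_unip q i \<in> Gamma0 N" "det (blockD (T_unip q i)) = 1"
proof -
  show "T_unip q i \<in> Gamma0 N"
    by (auto simp: T_unip_def intro!: Gamma0_mult translation_Gamma0 line_embed_Gamma0 split: sum.splits)
  show "det (blockD (T_unip q i)) = 1"
    by (auto simp: T_unip_def det_blockD_translation_line_embed split: sum.splits)
qed

lemma T_rep_eq:
  assumes "q > 0"
  shows "T_base q i ** ratm (T_unip q i) = block (T_A q i) (T_A q i ** T_X q i) 0 ((1 / real q) *\<^sub>R transpose (T_Ainv q i))"
  using assms
  by (auto simp: T_base_def T_unip_def T_A_def T_X_def T_Ainv_def T_base1_def T_base2_def T_base3_def translation_def line_embed_def lineV_def lineM_def lineI_def zero_m22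
      field_simps split: sum.splits)

text \<open>The Bezout relation gives a two by two matrix with rows \<open>(q, b)\<close> and
  \<open>(N, d)\<close> of determinant 1. Embedded in one coordinate it lowers the rank of
  \<open>A\<close> modulo \<open>q\<close> by one, in both coordinates by two.\<close>

lemma T_coset_surj:
  assumes q: "prime q" and i: "i \<in> T_index N q"
  shows "\<exists>\<gamma>\<in>Gamma0 N. \<exists>g\<in>Gamma0 N. T_base1 q ** ratm \<gamma> = ratm g ** T_base q i"
proof -
  have "q > 0" using q prime_gt_0_nat by blast
  have bez: "\<exists>b d. int q * d - b * int N = 1" if "\<not> q dvd N"
    by (metis bezout_coprime coprime_primeI coprime_commute q that of_nat_dvd_iff)
  from i show ?thesis
  proof (cases rule: T_index_cases)
    case 1
    have "T_base1 q ** ratm (mat 1) = ratm (mat 1) ** T_base q i" by (simp add: T_base_def 1)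
    then show ?thesis using Gamma0_one by blast
  next
    case 2
    then obtain b d where bd: "int q * d - b * int N = 1" using bez by blast
    let ?\<gamma> = "block (m22 1 (int q * 0) 0 (int q * 1)) (m22 (int q * 0) 0 (int q * 0) b)
      (m22 0 0 0 (int N)) (m22 1 0 0 d)"
    have mem: "?\<gamma> \<in> Gamma0 N" using bd by (simp add: Gamma0_m22_iff Sp2_def symp_J_m22 mult.commute)
    have "T_base q i = T_base2 q" by (simp add: T_base_def 2)
    then show ?thesis using T_base2_intertwine[OF \<open>q > 0\<close> refl mem] mem by metis
  next
    case 3
    then obtain b d where bd: "int q * d - b * int N = 1" using bez by blast
    let ?\<gamma> = "block (m22 (int q * 1) (int q * 0) (int q * 0) (int q * 1)) (m22 b 0 0 b)
      (m22 (int N) 0 0 (int N)) (m22 d 0 0 d)"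
    have mem: "?\<gamma> \<in> Gamma0 N" using bd by (simp add: Gamma0_m22_iff Sp2_def symp_J_m22 mult.commute)
    have "T_base q i = T_base3 q" by (simp add: T_base_def 3)
    then show ?thesis using T_base3_intertwine[OF \<open>q > 0\<close> refl mem] mem by metis
  qed
qed

lemma det_realm: "det (realm P) = of_int (det P)"
  by (cases P rule: m22_cases) simp

text \<open>Integrality of \<open>P\<close> and of \<open>R\<close> bounds the exponents of the
  determinants in opposite directions, so the types agree. Then \<open>P = mat 1\<close> and the
  lines agree where they occur, and the translations agree modulo \<open>q\<close>.\<close>

lemma T_coset_inj:
  assumes "q > 1" and i: "i \<in> T_index N q" and j: "j \<in> T_index N q"
    and eq: "ratm g ** (T_base q i ** ratm (T_unip q i)) = T_base q j ** ratm (T_unip q j)"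
  shows "i = j"
proof -
  have "q > 0" using \<open>q > 1\<close> by simp
  \<comment> \<open>The type of the coset: \<open>det (T_A q i)\<close> is \<open>q\<close> to the
    power \<open>e i - 2\<close>.\<close>
  define e where "e = case_sum (\<lambda>_ :: nat \<times> nat \<times> nat. 0 :: nat) (case_sum (\<lambda>_. 1) (\<lambda>_. 2) :: (nat \<times> nat) + nat \<Rightarrow> nat)"
  obtain P Q R where P: "realm P ** T_A q i = T_A q j" and Q: "realm P ** (T_A q i ** T_X q i) + realm Q ** ((1 / real q) *\<^sub>R transpose (T_Ainv q i)) = T_A q j ** T_X q j"
    and R: "realm R ** ((1 / real q) *\<^sub>R transpose (T_Ainv q i)) = (1 / real q) *\<^sub>R transpose (T_Ainv q j)"
    using upper_triangular_int[OF eq[unfolded T_rep_eq[OF \<open>q > 0\<close>]] T_A_Ainv[OF \<open>q > 0\<close>]] .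
  have dA: "det (T_A q i) * real q ^ 2 = real q ^ e i" for i :: "coset_index"
    using \<open>q > 0\<close> by (auto simp: T_A_def e_def lineM_def power2_eq_square split: sum.splits)
  have dD: "det ((1 / real q) *\<^sub>R transpose (T_Ainv q i)) * real q ^ 2 = real q ^ (2 - e i)" for i :: "coset_index"
    using \<open>q > 0\<close> by (auto simp: T_Ainv_def lineV_def e_def lineI_def power2_eq_square split: sum.splits)
  have "of_int (det P) * real q ^ e i = real q ^ e j"
    using arg_cong[OF P, of det] by (simp add: det_mul det_realm dA[symmetric])
  then have 1: "e i \<le> e j" using exponent_le_of_int \<open>q > 1\<close> by blast
  have "of_int (det R) * real q ^ (2 - e i) = real q ^ (2 - e j)"
    using arg_cong[OF R, of det] by (simp only: det_mul det_realm dD[symmetric]) simp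
  then have "2 - e i \<le> 2 - e j" using exponent_le_of_int \<open>q > 1\<close> by blast
  moreover have "e i \<le> 2" "e j \<le> 2" by (auto simp: e_def split: sum.splits)
  ultimately have e: "e i = e j" using 1 by linarith
  obtain q1 q2 q3 q4 where Qm: "Q = m22 q1 q2 q3 q4" using m22_cases .
  from i show ?thesis
  proof (cases rule: T_index_cases)
    case i1: (1 y1 y2 y3)
    from j show ?thesis
    proof (cases rule: T_index_cases)
      case (1 z1 z2 z3)
      have "P = mat 1"
      proof -
        obtain p1 p2 p3 p4 where Pm: "P = m22 p1 p2 p3 p4" using m22_cases .
        show ?thesis using P \<open>q > 0\<close> by (simp add: i1(1) 1(1) T_A_def Pm mat_m22)
      qed
      then have "real y1 + real q * of_int q1 = real z1" "real y2 + real q * of_int q2 = real z2" "real y3 + real q * of_int q4 = real z3"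
        using Q \<open>q > 0\<close> by (simp_all add: i1(1) 1(1) T_A_def T_X_def T_Ainv_def Qm mat_m22 field_simps)
      then show ?thesis using i1 1 eq_of_diff_multiple by blast
    qed (use e i1(1) in \<open>auto simp: e_def\<close>)
  next
    case i2: (2 t y)
    from j show ?thesis
    proof (cases rule: T_index_cases)
      case (2 t' y')
      have "t = t' \<and> P = mat 1"
        by (rule line_of_int[OF _ i2(2) 2(2) \<open>q > 1\<close>]) (use P in \<open>simp add: i2(1) 2(1) T_A_def\<close>)
      then have t: "t' = t" and Pm: "P = mat 1" by auto
      have "real y + real q * of_int q1 = real y'"
      proof (cases "t < q")
        case True
        then show ?thesis using Q \<open>q > 0\<close>
          by (auto simp: i2(1) 2(1) T_A_def T_X_def T_Ainv_def lineV_def Qm Pm t lineM_def lineI_def mat_m22 field_simps)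
      next
        case False
        then have "real q * real y' = real q * (real y + real q * of_int q1)" using Q \<open>q > 0\<close>
          by (simp add: i2(1) 2(1) T_A_def T_X_def T_Ainv_def lineV_def Qm Pm t lineM_def lineI_def mat_m22 field_simps)
        then show ?thesis using \<open>q > 0\<close> by simp
      qed
      then show ?thesis using i2 2 t eq_of_diff_multiple by blast
    qed (use e i2(1) in \<open>auto simp: e_def\<close>)
  next
    case i3: 3
    from j show ?thesis
      by (cases rule: T_index_cases) (use e i3(1) in \<open>auto simp: e_def\<close>)
  qed
qed

text \<open>The translations are integral and act trivially, so each class contributes one
  transformed index per line, weighted by its number of translations: \<open>q^3\<close>,
  \<open>q\<close> and 1.\<close>

lemma hecke_T_relation:
  assumes chi: "dirichlet_character N chi" and "N > 0" and "k > 0" and mf: "siegel_modular_form k N chi F"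
    and fe: "has_fourier_expansion F a" and q: "prime q" and eig: "eigenform (hecke_T q k N chi) F"
  shows "\<exists>c0 c1 c2 C. c0 \<noteq> 0 \<and> (q dvd N \<longrightarrow> c1 = 0) \<and> (\<forall>T\<in>fourier_index. c0 * coeff0 a (real q *\<^sub>R T)
      + c1 * (\<Sum>t\<le>q. coeff0 a ((1 / real q) *\<^sub>R (transpose (lineV q t) ** T ** lineV q t))) + c2 * coeff0 a ((1 / real q) *\<^sub>R T) = C * a T)"
proof -
  have "q > 0" "q > 1" using q prime_gt_0_nat prime_gt_1_nat by blast+
  obtain c where c: "\<And>\<tau>. \<tau> \<in> siegel_h2 \<Longrightarrow> hecke_op (delta q) q k N chi F \<tau> = c * F \<tau>"
    using eig by (auto simp: eigenform_def hecke_T_def)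
  define w where "w = case_sum (\<lambda>_ :: nat \<times> nat \<times> nat. 1) (case_sum (\<lambda>_. chi (int q)) (\<lambda>_. chi (int q) ^ 2) :: (nat \<times> nat) + nat \<Rightarrow> complex)"
  have d: "delta q ** T_base1 q = mat 1"
    using \<open>q > 0\<close> by (simp add: delta_def T_base1_def diag2_m22 zero_m22 mat_block mat_m22)
  have fin: "finite (T_index N q)" by (simp add: T_index_def)
  have "\<exists>C. \<forall>T\<in>fourier_index. (\<Sum>i\<in>T_index N q. w i * of_real (det ((1 / real q) *\<^sub>R transpose (T_Ainv q i))) powi (- int k) *
      (coeff0 a ((1 / real q) *\<^sub>R (transpose (T_Ainv q i) ** T ** T_Ainv q i)) * cis2pi (trace (T ** T_X q i)))) = C * a T"
  proof (rule hecke_coefficients[OF chi \<open>N > 0\<close> \<open>k > 0\<close> mf fe d fin \<open>q > 0\<close> T_X_sym \<open>q > 0\<close> T_A_Ainv[OF \<open>q > 0\<close>]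
        T_A_int[OF \<open>q > 0\<close>] T_unip_Gamma0 T_rep_eq[OF \<open>q > 0\<close>] _ T_coset_surj[OF q] T_coset_inj[OF \<open>q > 1\<close>] c])
    fix \<gamma> assume "\<gamma> \<in> Gamma0 N"
    then show "\<exists>i\<in>T_index N q. \<exists>g\<in>Gamma0 N. T_base1 q ** ratm (\<gamma> ** symp_inv (T_unip q i)) = ratm g ** T_base q i \<and>
       chi (det (blockD g)) = w i * chi (det (blockD (\<gamma> ** symp_inv (T_unip q i))))"
      using T_coset_exists[OF q _ chi] by (simp add: w_def)
  qed
  then obtain C where C: "\<And>T. T \<in> fourier_index \<Longrightarrow> (\<Sum>i\<in>T_index N q. w i * of_real (det ((1 / real q) *\<^sub>R transpose (T_Ainv q i))) powi (- int k) *
      (coeff0 a ((1 / real q) *\<^sub>R (transpose (T_Ainv q i) ** T ** T_Ainv q i)) * cis2pi (trace (T ** T_X q i)))) = C * a T"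
    by blast
  define c1 where "c1 = (if q dvd N then 0 else chi (int q) * of_real (1 / real q) powi (- int k) * of_nat q)"
  define c2 where "c2 = (if q dvd N then 0 else chi (int q) ^ 2 * of_real (1 / real q ^ 2) powi (- int k))"
  have rel: "of_nat q ^ 3 * coeff0 a (real q *\<^sub>R T)
      + c1 * (\<Sum>t\<le>q. coeff0 a ((1 / real q) *\<^sub>R (transpose (lineV q t) ** T ** lineV q t))) + c2 * coeff0 a ((1 / real q) *\<^sub>R T) = C * a T"
    if T: "T \<in> fourier_index" for T
  proof -
    define G where "G i = w i * of_real (det ((1 / real q) *\<^sub>R transpose (T_Ainv q i))) powi (- int k) *
      (coeff0 a ((1 / real q) *\<^sub>R (transpose (T_Ainv q i) ** T ** T_Ainv q i)) * cis2pi (trace (T ** T_X q i)))" for i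
    have G1: "G (Inl y) = coeff0 a (real q *\<^sub>R T)" for y
    proof -
      obtain y1 y2 y3 where y: "y = (y1, y2, y3)" using prod_cases3 .
      have "cis2pi (trace (T ** T_X q (Inl y))) = 1" unfolding T_X_def y using cis2pi_trace_int[OF T, of "int y1" "int y2" "int y3"] by simp
      moreover have "(1 / real q) *\<^sub>R (transpose (T_Ainv q (Inl y)) ** T ** T_Ainv q (Inl y)) = real q *\<^sub>R T"
        using \<open>q > 0\<close> by (cases T rule: m22_cases) (simp add: T_Ainv_def)
      ultimately show ?thesis using \<open>q > 0\<close> by (simp add: G_def w_def T_Ainv_def)
    qed
    have G2: "G (Inr (Inl (t, y))) = chi (int q) * of_real (1 / real q) powi (- int k) *
        coeff0 a ((1 / real q) *\<^sub>R (transpose (lineV q t) ** T ** lineV q t))" for t y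
    proof -
      have "cis2pi (trace (T ** T_X q (Inr (Inl (t, y))))) = 1"
      proof -
        have "\<exists>x1 x2 x3. lineI q t ** m22 (int y) 0 0 0 ** transpose (lineI q t) = m22 x1 x2 x2 x3"
          by (auto simp: lineI_def)
        then show ?thesis using cis2pi_trace_int[OF T] by (auto simp: T_X_def)
      qed
      moreover have "det ((1 / real q) *\<^sub>R transpose (lineV q t)) = 1 / real q"
        using \<open>q > 0\<close> by (auto simp: lineV_def lineI_def)
      ultimately show ?thesis by (simp add: G_def w_def T_Ainv_def)
    qed
    have G3: "G (Inr (Inr 0)) = chi (int q) ^ 2 * of_real (1 / real q ^ 2) powi (- int k) * coeff0 a ((1 / real q) *\<^sub>R T)"
    proof -
      have "cis2pi (trace (T ** T_X q (Inr (Inr 0)))) = 1" unfolding T_X_def using cis2pi_trace_int[OF T, of 0 0 0] by simp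
      moreover have "transpose (m22 1 0 0 1) ** T ** m22 1 0 0 1 = T" by (cases T rule: m22_cases) simp
      moreover have "det ((1 / real q) *\<^sub>R transpose (m22 1 0 0 1)) = 1 / real q ^ 2" by (simp add: power2_eq_square)
      ultimately show ?thesis by (simp add: G_def w_def T_Ainv_def)
    qed
    have "(\<Sum>i\<in>T_index N q. G i) = of_nat q ^ 3 * coeff0 a (real q *\<^sub>R T)
      + c1 * (\<Sum>t\<le>q. coeff0 a ((1 / real q) *\<^sub>R (transpose (lineV q t) ** T ** lineV q t))) + c2 * coeff0 a ((1 / real q) *\<^sub>R T)"
    proof -
      have "(\<Sum>x\<in>{..q} \<times> {..<q}. G (Inr (Inl x))) = chi (int q) * of_real (1 / real q) powi (- int k) * of_nat q *
          (\<Sum>t\<le>q. coeff0 a ((1 / real q) *\<^sub>R (transpose (lineV q t) ** T ** lineV q t)))"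
      proof -
        have "(\<Sum>x\<in>{..q} \<times> {..<q}. G (Inr (Inl x))) = (\<Sum>t\<le>q. \<Sum>y<q. G (Inr (Inl (t, y))))"
          by (simp add: sum.cartesian_product)
        then show ?thesis by (simp add: G2 sum_distrib_left mult_ac)
      qed
      then show ?thesis
        by (simp add: T_index_def sum.Plus o_def G1 G3 c1_def c2_def card_cartesian_product power3_eq_cube)
    qed
    then show ?thesis using C[OF T] by (simp add: G_def)
  qed
  show ?thesis
    by (intro exI[of _ "of_nat q ^ 3"] exI[of _ c1] exI[of _ c2] exI[of _ C] conjI ballI rel)
       (use \<open>q > 0\<close> in \<open>simp_all add: c1_def\<close>)
qed

section \<open>The operator \<open>T\<^sub>1(q\<^sup>2)\<close>\<close>

text \<open>
  Let \<open>a\<close>, \<open>b\<close> be the first rows of the upper blocks of \<open>\<gamma>\<close>.  The first summand is \<open>a \<noteq> 0\<close> modulo \<open>q\<close>;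
  otherwise it is the third if \<open>q\<^sup>2\<close> divides the inner product of \<open>a\<close> and \<open>b\<close>, and else the second.
\<close>

definition T1_unip :: "nat \<Rightarrow> coset_index \<Rightarrow> int mat4" where
  "T1_unip q = case_sum (\<lambda>(t, x1, x2). translation (m22 (int x1) (int x2) (int x2) 0) ** line_embed q t)
     (case_sum (\<lambda>(t, y). line_embed q t) (\<lambda>t. line_embed q t))"
definition T1_base :: "nat \<Rightarrow> coset_index \<Rightarrow> real mat4" where
  "T1_base q = case_sum (\<lambda>_. T1_base1 q) (case_sum (\<lambda>(t, y). T1_base2 q y) (\<lambda>_. T1_base3 q))"
definition T1_A :: "nat \<Rightarrow> coset_index \<Rightarrow> real mat2" where
  "T1_A q = case_sum (\<lambda>(t, x1, x2). m22 (1 / q) 0 0 1 ** lineM q t) (case_sum (\<lambda>(t, y). lineM q t) (\<lambda>t. m22 1 0 0 q ** lineM q t))"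
definition T1_Ainv :: "nat \<Rightarrow> coset_index \<Rightarrow> real mat2" where
  "T1_Ainv q = case_sum (\<lambda>(t, x1, x2). lineV q t) (case_sum (\<lambda>(t, y). lineI q t) (\<lambda>t. (1 / real q) *\<^sub>R lineV q t))"
definition T1_X :: "nat \<Rightarrow> coset_index \<Rightarrow> real mat2" where
  "T1_X q = case_sum (\<lambda>(t, x1, x2). lineI q t ** m22 x1 x2 x2 0 ** transpose (lineI q t))
     (case_sum (\<lambda>(t, y). lineI q t ** m22 0 0 0 (y / q) ** transpose (lineI q t)) (\<lambda>_. m22 0 0 0 0))"
text \<open>Altogether \<open>q (q + 1) (q^2 + 1)\<close> indices. The value \<open>y = 0\<close> is
  left out of the second class: \<open>T1_base2 q 0\<close> is the identity, which lies outside the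
  double coset.\<close>

definition T1_index :: "nat \<Rightarrow> coset_index set" where
  "T1_index q = ({..q} \<times> {..<q\<^sup>2} \<times> {..<q}) <+> (({..q} \<times> {1..<q}) <+> {..q})"

lemma T1_index_cases:
  assumes "i \<in> T1_index q"
  obtains (1) t x1 x2 where "i = Inl (t, x1, x2)" "t \<le> q" "x1 < q\<^sup>2" "x2 < q"
    | (2) t y where "i = Inr (Inl (t, y))" "t \<le> q" "1 \<le> y" "y < q"
    | (3) t where "i = Inr (Inr t)" "t \<le> q"
  using assms by (auto simp: T1_index_def)

lemma T1_indexI:
  "t \<le> q \<Longrightarrow> x1 < q\<^sup>2 \<Longrightarrow> x2 < q \<Longrightarrow> Inl (t, x1, x2) \<in> T1_index q"
  "t \<le> q \<Longrightarrow> 1 \<le> y \<Longrightarrow> y < q \<Longrightarrow> Inr (Inl (t, y)) \<in> T1_index q"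
  "t \<le> q \<Longrightarrow> Inr (Inr t) \<in> T1_index q"
  by (auto simp: T1_index_def)

lemma T1_A_Ainv: "q > 0 \<Longrightarrow> T1_A q i ** T1_Ainv q i = mat 1"
  by (auto simp: T1_A_def T1_Ainv_def lineV_def lineM_def lineI_def mat_m22 split: sum.splits)

lemma T1_A_int: "q > 0 \<Longrightarrow> real q * T1_A q i $ r $ c \<in> \<int>"
proof -
  assume "q > 0"
  then have "\<forall>r c. real q * T1_A q i $ r $ c \<in> \<int>"
    unfolding forall_2 by (auto simp: T1_A_def lineM_def split: sum.splits)
  then show ?thesis by blast
qed

lemma T1_X_sym: "transpose (T1_X q i) = T1_X q i"
  by (auto simp: T1_X_def lineI_def split: sum.splits)

lemma T1_unip_Gamma0: "T1_unip q i \<in> Gamma0 N" "det (blockD (T1_unip q i)) = 1"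
proof -
  show "T1_unip q i \<in> Gamma0 N"
    by (auto simp: T1_unip_def intro!: Gamma0_mult translation_Gamma0 line_embed_Gamma0 split: sum.splits)
  have "det (blockD (line_embed q t)) = 1" for t
    by (simp add: line_embed_def lineI_def)
  then show "det (blockD (T1_unip q i)) = 1"
    by (auto simp: T1_unip_def det_blockD_translation_line_embed split: sum.splits)
qed

lemma T1_rep_eq:
  assumes "q > 0"
  shows "T1_base q i ** ratm (T1_unip q i) = block (T1_A q i) (T1_A q i ** T1_X q i) 0 ((1 / real 1) *\<^sub>R transpose (T1_Ainv q i))"
  using assms
  by (auto simp: T1_base_def T1_unip_def T1_A_def T1_X_def T1_Ainv_def T1_base1_def T1_base2_def T1_base3_def translation_def line_embed_def lineV_def lineM_def lineI_def zero_m22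
      field_simps split: sum.splits)

lemma T1_coset_surj:
  assumes q: "prime q" and qN: "\<not> q dvd N" and i: "i \<in> T1_index q"
  shows "\<exists>\<gamma>\<in>Gamma0 N. \<exists>g\<in>Gamma0 N. T1_base1 q ** ratm \<gamma> = ratm g ** T1_base q i"
proof -
  have "q > 0" using q prime_gt_0_nat by blast
  have cop: "coprime (int q) (int N)"
    using coprime_primeI[OF q, of "int N"] qN by (simp add: coprime_commute)
  from i show ?thesis
  proof (cases rule: T1_index_cases)
    case 1
    have "T1_base1 q ** ratm (mat 1) = ratm (mat 1) ** T1_base q i" by (simp add: T1_base_def 1)
    then show ?thesis using Gamma0_one by blast
  next
    case (2 t y)
    have "\<not> int q dvd int y" using 2 by (auto dest: dvd_imp_le)
    then have "coprime (int q) (int y)" using coprime_primeI[OF q, of "int y"] by (simp add: coprime_commute)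
    then have "coprime (int q) (int y * int N)" using cop by simp
    then obtain b d where bd: "int q * d - b * (int y * int N) = 1" using bezout_coprime by blast
    \<comment> \<open>The two by two matrix with rows \<open>(q, y)\<close> and
      \<open>(N b, d)\<close>, embedded in the second coordinate, with the two coordinates swapped
      on the left.\<close>
    let ?\<gamma> = "block (m22 (int q * 0) (int q * 1) 1 (int q * 0)) (m22 (int q * 0) (int q * 0 + 1 * int y) 0 0)
      (m22 0 (int N * b) 0 (int q * 0)) (m22 0 d 1 0)"
    have mem: "?\<gamma> \<in> Gamma0 N" using bd by (simp add: Gamma0_m22_iff Sp2_def symp_J_m22 algebra_simps)
    have "T1_base q i = T1_base2 q y" by (simp add: T1_base_def 2)
    then show ?thesis using T1_base2_intertwine[OF \<open>q > 0\<close> refl mem cop] mem by metis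
  next
    case (3 t)
    have "coprime (int q * int q) (int N)" using cop by simp
    then obtain b d where bd: "int q * int q * d - b * int N = 1" using bezout_coprime by blast
    let ?\<gamma> = "block (m22 (int q * 0) (int q ^ 2 * 1) 1 (int q * 0)) (m22 (int q * 0) b 0 0)
      (m22 0 (int N) 0 (int q * 0)) (m22 0 d 1 0)"
    have mem: "?\<gamma> \<in> Gamma0 N" using bd by (simp add: Gamma0_m22_iff Sp2_def symp_J_m22 algebra_simps power2_eq_square)
    have "T1_base q i = T1_base3 q" by (simp add: T1_base_def 3)
    then show ?thesis using T1_base3_intertwine[OF \<open>q > 0\<close> refl mem cop] mem by metis
  qed
qed

lemma T1_coset_exists:
  assumes q: "prime q" and qN: "\<not> q dvd N" and \<gamma>: "\<gamma> \<in> Gamma0 N" and chi: "dirichlet_character N chi"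
  shows "\<exists>i\<in>T1_index q. \<exists>g\<in>Gamma0 N.
       T1_base1 q ** ratm (\<gamma> ** symp_inv (T1_unip q i)) = ratm g ** T1_base q i \<and>
       chi (det (blockD g)) = case_sum (\<lambda>_. 1) (case_sum (\<lambda>_. chi (int q)) (\<lambda>_. chi (int q) ^ 2)) i
          * chi (det (blockD (\<gamma> ** symp_inv (T1_unip q i))))"
proof -
  have "q > 0" "q > 1" using q prime_gt_0_nat prime_gt_1_nat by blast+
  have pq: "prime (int q)" using q by simp
  have cop: "coprime (int q) (int N)"
    using coprime_primeI[OF q, of "int N"] qN by (simp add: coprime_commute)
  obtain A B C D where gb: "\<gamma> = block A B C D" using mat4_cases .
  obtain a1 a2 a3 a4 where A: "A = m22 a1 a2 a3 a4" using m22_cases .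
  obtain b1 b2 b3 b4 where B: "B = m22 b1 b2 b3 b4" using m22_cases .
  obtain c1 c2 c3 c4 where C: "C = m22 c1 c2 c3 c4" using m22_cases .
  obtain d1 d2 d3 d4 where D: "D = m22 d1 d2 d3 d4" using m22_cases .
  note \<gamma>_eq = gb[unfolded A B C D]
  show ?thesis
  proof (cases "int q dvd a1 \<and> int q dvd a2")
    case nall: False
    \<comment> \<open>The line killed by the non-zero first row; afterwards the first row of the
      upper left block is \<open>(e1, e2)\<close> with \<open>e1\<close> a unit and
      \<open>e2\<close> zero modulo \<open>q\<close>.\<close>
    obtain t where t: "t \<le> q" "int q dvd a1 * lineI q t $ 1 $ 2 + a2 * lineI q t $ 2 $ 2"
      using line_exists[OF q] by blast
    define \<gamma>' where "\<gamma>' = \<gamma> ** symp_inv (line_embed q t)"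
    have \<gamma>': "\<gamma>' \<in> Gamma0 N" unfolding \<gamma>'_def by (intro Gamma0_mult \<gamma> Gamma0_symp_inv line_embed_Gamma0)
    obtain A' B' C' D' where gb': "\<gamma>' = block A' B' C' D'" using mat4_cases .
    have A'_eq: "A' = m22 a1 a2 a3 a4 ** lineI q t"
      using gb' by (simp add: \<gamma>'_def \<gamma>_eq line_embed_def symp_inv_def lineI_def split: if_splits)
    obtain e1 e2 e3 e4 where A': "A' = m22 e1 e2 e3 e4" using m22_cases .
    obtain f1 f2 f3 f4 where B': "B' = m22 f1 f2 f3 f4" using m22_cases .
    obtain u1 u2 u3 u4 where C': "C' = m22 u1 u2 u3 u4" using m22_cases .
    obtain v1 v2 v3 v4 where D': "D' = m22 v1 v2 v3 v4" using m22_cases .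
    note \<gamma>'_eq = gb'[unfolded A' B' C' D']
    obtain g1 g2 g3 g4 where gg: "lineI q t = (m22 g1 g2 g3 g4 :: int mat2)" using m22_cases .
    have "int q dvd e2"
    proof -
      have "e2 = a1 * lineI q t $ 1 $ 2 + a2 * lineI q t $ 2 $ 2"
        using A'_eq by (simp add: A' gg)
      then show ?thesis using t by simp
    qed
    then obtain e2' where e2': "e2 = int q * e2'" by (elim dvdE)
    have e1: "\<not> int q dvd e1"
    proof
      assume "int q dvd e1"
      then obtain e1' where "e1 = int q * e1'" by (elim dvdE)
      moreover have "m22 a1 a2 a3 a4 = A' ** lineM q t" by (simp add: A'_eq matrix_mul_assoc[symmetric])
      ultimately have "int q dvd a1 \<and> int q dvd a2"
        using e2' by (cases "lineM q t :: int mat2" rule: m22_cases)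
           (simp add: A' distrib_left[symmetric] mult.assoc)
      then show False using nall by blast
    qed
    then have cop1: "coprime e1 (int q)" using q by (simp add: coprime_primeI)
    \<comment> \<open>The translation makes the first row of the upper right block divisible by
      \<open>q^2\<close> and by \<open>q\<close>. Since \<open>e1\<close> is a unit,
      \<open>x2\<close> can be found first and then \<open>x1\<close>.\<close>
    obtain x2 where x2: "x2 < q" "int q dvd e1 * int x2 + - f2"
      using lin_solve[OF cop1 \<open>q > 0\<close>] by blast
    have cop2: "coprime e1 (int (q\<^sup>2))" using cop1 by simp
    obtain x1 where x1: "x1 < q\<^sup>2" "int (q\<^sup>2) dvd e1 * int x1 + (e2 * int x2 - f1)"
      using lin_solve[OF cop2] \<open>q > 0\<close> by (metis zero_less_power)
    let ?i = "Inl (t, x1, x2) :: coset_index"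
    have p: "\<gamma> ** symp_inv (T1_unip q ?i) = \<gamma>' ** translation (m22 (- int x1) (- int x2) (- int x2) (- 0))"
      using symp_inv_translation_line_embed[of "int x1" "int x2" 0] by (simp add: T1_unip_def \<gamma>'_def matrix_mul_assoc)
    have mem: "\<gamma> ** symp_inv (T1_unip q ?i) \<in> Gamma0 N" unfolding p by (intro Gamma0_mult \<gamma>' translation_Gamma0)
    define h3 k3 where "h3 = f3 - (e3 * int x1 + e4 * int x2)" and "k3 = v3 - (u3 * int x1 + u4 * int x2)"
    define h4 k4 where "h4 = f4 - (e3 * int x2 + e4 * 0)" and "k4 = v4 - (u3 * int x2 + u4 * 0)"
    define k1 k2 where "k1 = v1 - (u1 * int x1 + u2 * int x2)" and "k2 = v2 - (u1 * int x2 + u2 * 0)"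
    have "int q ^ 2 dvd f1 - (e1 * int x1 + e2 * int x2)"
    proof -
      have "f1 - (e1 * int x1 + e2 * int x2) = - (e1 * int x1 + (e2 * int x2 - f1))" by simp
      then show ?thesis using x1(2) by (simp only: dvd_minus_iff of_nat_power)
    qed
    then obtain h1 where h1: "f1 - (e1 * int x1 + e2 * int x2) = int q ^ 2 * h1" by (elim dvdE)
    have "int q dvd f2 - (e1 * int x2 + e2 * 0)"
    proof -
      have "f2 - (e1 * int x2 + e2 * 0) = - (e1 * int x2 + - f2)" by simp
      then show ?thesis using x2(2) by (simp only: dvd_minus_iff)
    qed
    then obtain h2 where h2: "f2 - (e1 * int x2 + e2 * 0) = int q * h2" by (elim dvdE)
    have form: "\<gamma> ** symp_inv (T1_unip q ?i) = block (m22 e1 (int q * e2') e3 e4) (m22 (int q ^ 2 * h1) (int q * h2) h3 h4)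
           (m22 u1 u2 u3 u4) (m22 k1 k2 k3 k4)"
      unfolding p \<gamma>'_eq mult_translation_uminus h1 h2 h3_def h4_def k1_def k2_def k3_def k4_def by (simp only: e2')
    have sp: "block (m22 e1 (int q * e2') e3 e4) (m22 (int q ^ 2 * h1) (int q * h2) h3 h4)
           (m22 u1 u2 u3 u4) (m22 k1 k2 k3 k4) \<in> Sp2"
      using mem unfolding form by (simp add: Gamma0_def)
    \<comment> \<open>The remaining divisibilities of the pattern, for \<open>h3\<close> and
      \<open>k3\<close>, come for free from the symplectic relations, as \<open>e1\<close> is a unit
      modulo \<open>q\<close>.\<close>
    have "e1 * h3 = int q * (int q * h1 * e3 + h2 * e4 - e2' * h4)"
      using Sp2_entries(1)[OF sp] by (simp add: algebra_simps power2_eq_square)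
    then have "int q dvd e1 * h3" by simp
    then have "int q dvd h3" using e1 pq by (simp add: prime_dvd_mult_iff)
    then obtain h3' where h3': "h3 = int q * h3'" by (elim dvdE)
    have "e1 * k3 = int q * (int q * h1 * u3 + h2 * u4 - e2' * k4)"
      using Sp2_entries(3)[OF sp] by (simp add: algebra_simps power2_eq_square)
    then have "int q dvd e1 * k3" by simp
    then have "int q dvd k3" using e1 pq by (simp add: prime_dvd_mult_iff)
    then obtain k3' where k3': "k3 = int q * k3'" by (elim dvdE)
    obtain g where "g \<in> Gamma0 N" "T1_base1 q ** ratm (\<gamma> ** symp_inv (T1_unip q ?i)) = ratm g ** T1_base1 q"
        "det (blockD g) = det (blockD (\<gamma> ** symp_inv (T1_unip q ?i)))"
      using T1_base1_intertwine[OF \<open>q > 0\<close> form[unfolded h3' k3'] mem] by blast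
    then show ?thesis
      using T1_indexI(1)[OF t(1) x1(1) x2(1)]
      by (intro bexI[of _ ?i] bexI[of _ g]) (simp_all add: T1_base_def)
  next
    case all: True
    \<comment> \<open>Now the first row of the upper left block vanishes modulo \<open>q\<close>,
      and the line is chosen to contain the first row of the upper right block.\<close>
    obtain t where t: "t \<le> q" "int q dvd b1 * lineM q t $ 1 $ 1 + b2 * lineM q t $ 1 $ 2"
      using dual_line_exists[OF q] by blast
    define \<gamma>' where "\<gamma>' = \<gamma> ** symp_inv (line_embed q t)"
    have \<gamma>': "\<gamma>' \<in> Gamma0 N" unfolding \<gamma>'_def by (intro Gamma0_mult \<gamma> Gamma0_symp_inv line_embed_Gamma0)
    obtain A' B' C' D' where gb': "\<gamma>' = block A' B' C' D'" using mat4_cases .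
    have A'_eq: "A' = m22 a1 a2 a3 a4 ** lineI q t" and B'_eq: "B' = m22 b1 b2 b3 b4 ** transpose (lineM q t)"
      using gb' by (simp_all add: \<gamma>'_def \<gamma>_eq line_embed_def symp_inv_def lineI_def lineM_def split: if_splits)
    obtain e1 e2 e3 e4 where A': "A' = m22 e1 e2 e3 e4" using m22_cases .
    obtain f1 f2 f3 f4 where B': "B' = m22 f1 f2 f3 f4" using m22_cases .
    obtain u1 u2 u3 u4 where C': "C' = m22 u1 u2 u3 u4" using m22_cases .
    obtain v1 v2 v3 v4 where D': "D' = m22 v1 v2 v3 v4" using m22_cases .
    note \<gamma>'_eq = gb'[unfolded A' B' C' D']
    obtain g1 g2 g3 g4 where gg: "lineI q t = (m22 g1 g2 g3 g4 :: int mat2)" using m22_cases .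
    obtain l1 l2 l3 l4 where ll: "lineM q t = (m22 l1 l2 l3 l4 :: int mat2)" using m22_cases .
    have "int q dvd e1" "int q dvd e2"
      using A'_eq all by (simp_all add: A' gg)
    then obtain e1' e2' where e': "e1 = int q * e1'" "e2 = int q * e2'" by (elim dvdE)
    have "int q dvd f1"
      using B'_eq t(2) by (simp add: B' ll)
    then obtain f1' where f1': "f1 = int q * f1'" by (elim dvdE)
    have sp: "block (m22 e1 e2 e3 e4) (m22 f1 f2 f3 f4) (m22 u1 u2 u3 u4) (m22 v1 v2 v3 v4) \<in> Sp2"
      using \<gamma>' by (simp add: Gamma0_def \<gamma>'_eq)
    \<comment> \<open>Otherwise both first rows of the upper blocks vanish modulo \<open>q\<close>,
      against \<open>A D^t - B C^t = 1\<close>.\<close>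
    have f2: "\<not> int q dvd f2"
    proof
      assume "int q dvd f2"
      then obtain f2' where "f2 = int q * f2'" by (elim dvdE)
      then have "1 = int q * (e1' * v1 + e2' * v2 - f1' * u1 - f2' * u2)"
        using Sp2_entries(2)[OF sp] by (simp add: e' f1' algebra_simps)
      then have "int q dvd 1" by (metis dvd_triv_left)
      then show False using \<open>q > 1\<close> by simp
    qed
    have "f2 * e4 = int q * (e1' * f3 + e2' * f4 - f1' * e3)"
      using Sp2_entries(1)[OF sp] by (simp add: e' f1' algebra_simps)
    then have "int q dvd f2 * e4" by simp
    then have "int q dvd e4" using f2 pq by (simp add: prime_dvd_mult_iff)
    then obtain e4' where e4': "e4 = int q * e4'" by (elim dvdE)
    have "f2 * u4 = int q * (e1' * v3 + e2' * v4 - f1' * u3)"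
      using Sp2_entries(3)[OF sp] by (simp add: e' f1' algebra_simps)
    then have "int q dvd f2 * u4" by simp
    then have "int q dvd u4" using f2 pq by (simp add: prime_dvd_mult_iff)
    then obtain u4' where u4': "u4 = int q * u4'" by (elim dvdE)
    show ?thesis
    \<comment> \<open>The inner product of the two first rows is \<open>q e2' f2\<close> modulo
      \<open>q^2\<close>, so this is the distinction between the third and the second class.\<close>
    proof (cases "int q dvd e2'")
      case True
      then obtain e2'' where e2'': "e2' = int q * e2''" by (elim dvdE)
      let ?i = "Inr (Inr t) :: coset_index"
      have p: "\<gamma> ** symp_inv (T1_unip q ?i) = \<gamma>'" by (simp add: T1_unip_def \<gamma>'_def)
      have form: "\<gamma>' = block (m22 (int q * e1') (int q ^ 2 * e2'') e3 (int q * e4')) (m22 (int q * f1') f2 f3 f4)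
         (m22 u1 u2 u3 (int q * u4')) (m22 v1 v2 v3 v4)"
        by (simp add: \<gamma>'_eq e' e2'' f1' e4' u4' power2_eq_square)
      obtain g where "g \<in> Gamma0 N" "T1_base1 q ** ratm \<gamma>' = ratm g ** T1_base3 q"
        "det (blockD g) = int q ^ 2 * det (blockD \<gamma>')"
        using T1_base3_intertwine[OF \<open>q > 0\<close> form \<gamma>' cop] by blast
      then show ?thesis
        using T1_indexI(3)[OF t(1)] chi_mult[OF chi]
        by (intro bexI[of _ ?i] bexI[of _ g]) (simp_all add: T1_base_def p power2_eq_square)
    next
      case False
      then have "coprime e2' (int q)" using q by (simp add: coprime_primeI)
      \<comment> \<open>The quotient of \<open>f2\<close> by \<open>e2'\<close> modulo
        \<open>q\<close>; it is non-zero because \<open>f2\<close> is.\<close>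
      then obtain y where y: "y < q" "int q dvd e2' * int y + - f2" using lin_solve[OF _ \<open>q > 0\<close>] by blast
      have "y \<noteq> 0" using y(2) f2 by (intro notI) simp
      obtain z where "e2' * int y + - f2 = int q * z" using y(2) by (elim dvdE)
      then have z: "f2 = int q * (- z) + e2' * int y" by (simp add: algebra_simps)
      let ?i = "Inr (Inl (t, y)) :: coset_index"
      have p: "\<gamma> ** symp_inv (T1_unip q ?i) = \<gamma>'" by (simp add: T1_unip_def \<gamma>'_def)
      have form: "\<gamma>' = block (m22 (int q * e1') (int q * e2') e3 (int q * e4')) (m22 (int q * f1') (int q * (- z) + e2' * int y) f3 f4)
         (m22 u1 u2 u3 (int q * u4')) (m22 v1 v2 v3 v4)"
        by (simp add: \<gamma>'_eq e' z f1' e4' u4')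
      obtain g where "g \<in> Gamma0 N" "T1_base1 q ** ratm \<gamma>' = ratm g ** T1_base2 q y"
        "[det (blockD g) = int q * det (blockD \<gamma>')] (mod int N)"
        using T1_base2_intertwine[OF \<open>q > 0\<close> form \<gamma>' cop] by blast
      moreover from this(3) have "chi (det (blockD g)) = chi (int q) * chi (det (blockD \<gamma>'))"
        using chi_cong[OF chi] chi_mult[OF chi] by metis
      ultimately show ?thesis
        using T1_indexI(2)[OF t(1) _ y(1)] \<open>y \<noteq> 0\<close>
        by (intro bexI[of _ ?i] bexI[of _ g]) (simp_all add: T1_base_def p)
    qed
  qed
qed

lemma T1_coset_inj:
  assumes q: "prime q" and i: "i \<in> T1_index q" and j: "j \<in> T1_index q"
    and eq: "ratm g ** (T1_base q i ** ratm (T1_unip q i)) = T1_base q j ** ratm (T1_unip q j)"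
  shows "i = j"
proof -
  have "q > 0" "q > 1" using q prime_gt_0_nat prime_gt_1_nat by blast+
  \<comment> \<open>Again the type: \<open>det (T1_A q i)\<close> is \<open>q\<close> to the power
    \<open>e i - 1\<close>.\<close>
  define e where "e = case_sum (\<lambda>_ :: nat \<times> nat \<times> nat. 0 :: nat) (case_sum (\<lambda>_. 1) (\<lambda>_. 2) :: (nat \<times> nat) + nat \<Rightarrow> nat)"
  obtain P Q R where P: "realm P ** T1_A q i = T1_A q j" and Q': "realm P ** (T1_A q i ** T1_X q i) + realm Q ** ((1 / real 1) *\<^sub>R transpose (T1_Ainv q i)) = T1_A q j ** T1_X q j"
    and R: "realm R ** ((1 / real 1) *\<^sub>R transpose (T1_Ainv q i)) = (1 / real 1) *\<^sub>R transpose (T1_Ainv q j)"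
    using upper_triangular_int[OF eq[unfolded T1_rep_eq[OF \<open>q > 0\<close>]] T1_A_Ainv[OF \<open>q > 0\<close>]] .
  have Q: "realm P ** (T1_A q i ** T1_X q i) + realm Q ** transpose (T1_Ainv q i) = T1_A q j ** T1_X q j" using Q' by simp
  have dA: "det (T1_A q i) * real q = real q ^ e i" for i :: coset_index
    using \<open>q > 0\<close> by (auto simp: T1_A_def e_def lineM_def power2_eq_square split: sum.splits)
  have dD: "det (transpose (T1_Ainv q i)) * real q = real q ^ (2 - e i)" for i :: coset_index
    using \<open>q > 0\<close> by (auto simp: T1_Ainv_def lineV_def e_def lineI_def power2_eq_square split: sum.splits)
  have "of_int (det P) * real q ^ e i = real q ^ e j"
    using arg_cong[OF P, of det] by (simp add: det_mul det_realm dA[symmetric])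
  then have 1: "e i \<le> e j" using exponent_le_of_int \<open>q > 1\<close> by blast
  have "realm R ** transpose (T1_Ainv q i) = transpose (T1_Ainv q j)" using R by simp
  then have "of_int (det R) * real q ^ (2 - e i) = real q ^ (2 - e j)"
    unfolding dD[symmetric] by (metis det_mul det_realm mult.assoc)
  then have "2 - e i \<le> 2 - e j" using exponent_le_of_int \<open>q > 1\<close> by blast
  moreover have "e i \<le> 2" "e j \<le> 2" by (auto simp: e_def split: sum.splits)
  ultimately have e: "e i = e j" using 1 by linarith
  obtain q1 q2 q3 q4 where Qm: "Q = m22 q1 q2 q3 q4" using m22_cases .
  have tr: "transpose (lineI q t) ** transpose (lineM q t) = (mat 1 :: real mat2)" for t
    by (simp add: matrix_transpose_mul[symmetric])
  have canc: "M ** lineM q t ** (lineI q t ** X ** transpose (lineI q t)) = M ** X ** transpose (lineI q t)" for M X :: "real mat2" and t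
  proof -
    have "M ** lineM q t ** (lineI q t ** X ** transpose (lineI q t)) = M ** (lineM q t ** lineI q t) ** X ** transpose (lineI q t)"
      by (simp only: matrix_mul_assoc)
    then show ?thesis by simp
  qed
  note canc1 = canc[of "mat 1", unfolded matrix_mul_lid]
  from i show ?thesis
  proof (cases rule: T1_index_cases)
    case i1: (1 t x1 x2)
    from j show ?thesis
    proof (cases rule: T1_index_cases)
      case (1 t' z1 z2)
      have "t = t' \<and> P = mat 1"
        by (rule line_of_int[OF _ i1(2) 1(2) \<open>q > 1\<close>]) (use P in \<open>simp add: i1(1) 1(1) T1_A_def\<close>)
      then have t: "t' = t" and Pm: "P = mat 1" by auto
      have "realm P = mat 1" by (simp add: Pm mat_m22)
      then have "m22 (1 / q) 0 0 1 ** m22 x1 x2 x2 0 ** transpose (lineI q t) + realm Q ** (m22 q 0 0 1 ** transpose (lineI q t))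
         = m22 (1 / q) 0 0 1 ** m22 z1 z2 z2 0 ** transpose (lineI q t)"
        using Q by (simp only: i1(1) 1(1) T1_A_def T1_X_def T1_Ainv_def lineV_def matrix_transpose_mul t sum.case prod.case canc
              matrix_mul_lid m22_transpose)
      from arg_cong[OF this, of "\<lambda>M. M ** transpose (lineM q t)"]
      have "m22 (1 / q) 0 0 1 ** m22 x1 x2 x2 0 + realm Q ** m22 q 0 0 1 = m22 (1 / q) 0 0 1 ** m22 z1 z2 z2 0"
        by (simp only: matrix_add_rdistrib matrix_mul_assoc[symmetric] tr matrix_mul_rid)
      then have "real x1 / q + q1 * q = real z1 / q" "real x2 / q + q2 = real z2 / q"
        by (simp_all add: Qm)
      then have "real x1 + real (q\<^sup>2) * of_int q1 = real z1" "real x2 + real q * of_int q2 = real z2"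
        using \<open>q > 0\<close> by (simp_all add: field_simps power2_eq_square)
      then show ?thesis using i1 1 t eq_of_diff_multiple by blast
    qed (use e i1(1) in \<open>auto simp: e_def\<close>)
  next
    case i2: (2 t y)
    from j show ?thesis
    proof (cases rule: T1_index_cases)
      case (2 t' y')
      have "realm P ** lineM q t = lineM q t'" using P by (simp add: i2(1) 2(1) T1_A_def)
      then have "realm P ** lineM q t ** lineI q t = lineM q t' ** lineI q t" by simp
      then have "realm P = realm (lineM q t' ** lineI q t)" by (simp only: realm_mult realm_lineM matrix_mul_assoc[symmetric] line_mat_inverse matrix_mul_rid)
      then have Pm: "P = lineM q t' ** lineI q t" by (simp add: vec_eq_iff)
      have "realm P ** lineM q t ** (lineI q t ** m22 0 0 0 (y / q) ** transpose (lineI q t)) + realm Q ** transpose (lineI q t)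
         = mat 1 ** lineM q t' ** (lineI q t' ** m22 0 0 0 (y' / q) ** transpose (lineI q t'))"
        using Q by (simp only: i2(1) 2(1) T1_A_def T1_X_def T1_Ainv_def sum.case prod.case matrix_mul_lid matrix_mul_assoc)
      then have "realm P ** m22 0 0 0 (y / q) ** transpose (lineI q t) + realm Q ** transpose (lineI q t)
         = m22 0 0 0 (y' / q) ** transpose (lineI q t')" by (simp only: canc canc1 matrix_mul_lid)
      from arg_cong[OF this, of "\<lambda>M. M ** transpose (lineM q t)"]
      have Q3: "realm P ** m22 0 0 0 (y / q) + realm Q = m22 0 0 0 (y' / q) ** (transpose (lineI q t') ** transpose (lineM q t))"
        by (simp only: matrix_add_rdistrib matrix_mul_assoc[symmetric] tr matrix_mul_rid)
      obtain p1 p2 p3 p4 where Pp: "P = m22 p1 p2 p3 p4" using m22_cases .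
      obtain w1 w2 w3 w4 where W: "transpose (lineI q t') ** transpose (lineM q t) = (m22 w1 w2 w3 w4 :: real mat2)" using m22_cases .
      have "of_int p2 * (real y / q) + of_int q2 = 0" using Q3 unfolding W by (simp add: Pp Qm)
      then have "real_of_int (p2 * int y + int q * q2) = 0" using \<open>q > 0\<close> by (simp add: field_simps)
      then have "p2 * int y + int q * q2 = 0" by (simp only: of_int_eq_0_iff)
      \<comment> \<open>In the second class the diagonal blocks do not detect the line. The
        translation does: \<open>y\<close> is a unit modulo \<open>q\<close>, so \<open>q\<close>
        divides the upper right entry of \<open>P\<close>.\<close>
      then have "int y * p2 = int q * (- q2)" by (simp add: algebra_simps)
      then have "int q dvd int y * p2" by simp
      moreover have "\<not> int q dvd int y" using i2 by (auto dest: dvd_imp_le)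
      ultimately have "int q dvd p2" using q by (simp add: prime_dvd_mult_iff)
      then obtain z where z: "p2 = int q * z" by (elim dvdE)
      have tt: "t = t'"
        by (rule line_unique[OF i2(2) 2(2) \<open>q > 1\<close>, of z]) (simp add: Pm[symmetric] Pp z)
      then have "realm P = mat 1" using Pm by (simp add: mat_m22)
      moreover have "transpose (lineI q t') ** transpose (lineM q t) = (mat 1 :: real mat2)" using tr tt by simp
      ultimately have "m22 0 0 0 (y / q) + realm Q = m22 0 0 0 (y' / q)" using Q3 by simp
      then have "real y / q + of_int q4 = real y' / q" by (simp add: Qm)
      then have "real y + real q * of_int q4 = real y'" using \<open>q > 0\<close> by (simp add: field_simps)
      then show ?thesis using i2 2 tt eq_of_diff_multiple by blast
    qed (use e i2(1) in \<open>auto simp: e_def\<close>)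
  next
    case i3: (3 t)
    from j show ?thesis
    proof (cases rule: T1_index_cases)
      case (3 t')
      \<comment> \<open>The third class has the diagonal blocks of \<open>line_of_int\<close> up to
        the scalar \<open>q\<close>, which cancels.\<close>
      have sc: "m22 1 0 0 (real q) ** M = real q *\<^sub>R (m22 (1 / q) 0 0 1 ** M)" "M' ** (real q *\<^sub>R M) = real q *\<^sub>R (M' ** M)" for M M' :: "real mat2"
        by (cases M rule: m22_cases, cases M' rule: m22_cases, use \<open>q > 0\<close> in \<open>simp add: algebra_simps\<close>)+
      have "realm P ** (m22 1 0 0 (real q) ** lineM q t) = m22 1 0 0 (real q) ** lineM q t'" using P by (simp only: i3(1) 3(1) T1_A_def sum.case)
      then have "realm P ** (m22 (1 / q) 0 0 1 ** lineM q t) = m22 (1 / q) 0 0 1 ** lineM q t'"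
        using \<open>q > 0\<close> by (simp only: sc) simp
      then have "t = t'" using line_of_int[OF _ i3(2) 3(2) \<open>q > 1\<close>] by blast
      then show ?thesis using i3 3 by simp
    qed (use e i3(1) in \<open>auto simp: e_def\<close>)
  qed
qed

text \<open>The slash by \<open>line_embed q t\<close> is computed twice, by modularity and by
  \<open>slash_ratm_mult_upper\<close>; as the lower right determinant is 1, \<open>F\<close> is
  invariant under \<open>\<tau>\<close> to \<open>U \<tau> U^t\<close> with
  \<open>U = lineM q t\<close>.\<close>

lemma coefficient_invariant:
  assumes chi: "dirichlet_character N chi" and "k > 0" and mf: "siegel_modular_form k N chi F"
    and fe: "has_fourier_expansion F a" and T: "T \<in> fourier_index"
  shows "coeff0 a (transpose (lineI q t) ** T ** lineI q t) = a T"
proof -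
  have eq: "F (cmplx (lineM q t) ** (\<tau> + cmplx (realm Z2)) ** cmplx (transpose (lineM q t))) = F \<tau>"
    if \<tau>: "\<tau> \<in> siegel_h2" for \<tau>
  proof -
    let ?\<tau> = "cmplx (lineM q t) ** (\<tau> + cmplx (realm Z2)) ** cmplx (transpose (lineM q t))"
    have h2: "?\<tau> \<in> siegel_h2"
      using siegel_h2_move[OF \<tau>, of "realm Z2" 1 "lineM q t" "lineI q t"] by simp
    have \<tau>': "?\<tau> = (cmplx (lineM q t) ** \<tau> + cmplx (realm Z2)) ** cmplx (transpose (lineM q t))"
    proof -
      have "cmplx (realm Z2) = 0" by (simp add: zero_m22)
      then show ?thesis by (simp only: add_0_right)
    qed
    have M: "ratm (line_embed q t) = ratm (mat 1) ** block (lineM q t) (realm Z2) 0 (transpose (lineI q t))"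
      by (simp add: line_embed_def lineM_def lineI_def zero_m22)
    have D: "transpose (lineI q t) ** transpose (lineM q t) = (mat 1 :: real mat2)"
      by (simp add: matrix_transpose_mul[symmetric])
    have "det (ratm (line_embed q t)) ^ 2 = 1"
      using line_embed_Gamma0[of q t N] Sp2_iff_ratm[of "line_embed q t"] by (intro Sp2_det_sq) (simp add: Gamma0_def)
    then have "det (ratm (line_embed q t)) = 1 \<or> det (ratm (line_embed q t)) = -1" by (simp add: power2_eq_1_iff)
    then have "det (ratm (line_embed q t)) powr x = 1" for x by (auto simp: powr_def ln_minus)
    moreover have "det (transpose (lineI q t)) = (1 :: real)" by (simp add: lineI_def)
    moreover have "det (blockD (mat 1 :: int mat4)) = 1" by (simp add: mat_block)
    ultimately have "slash k F (ratm (line_embed q t)) \<tau> = F ?\<tau>"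
      using slash_ratm_mult_upper[OF mf Gamma0_one \<open>k > 0\<close> M D \<tau>' h2] chi_1[OF chi] by simp
    moreover have "slash k F (ratm (line_embed q t)) \<tau> = chi (det (blockD (line_embed q t))) * F \<tau>"
      using mf line_embed_Gamma0 \<tau> by (simp add: siegel_modular_form_def)
    moreover have "det (blockD (line_embed q t)) = 1" by (simp add: line_embed_def lineI_def)
    ultimately show ?thesis using chi_1[OF chi] by simp
  qed
  have int: "real 1 * lineM q t $ r $ c \<in> \<int>" for r c
  proof -
    have "\<forall>r c. real 1 * lineM q t $ r $ c \<in> \<int>" unfolding forall_2 by (simp add: lineM_def)
    then show ?thesis by blast
  qed
  have "(\<Sum>i\<in>{()}. 1 * (coeff0 a ((1 / real 1) *\<^sub>R (transpose (lineI q t) ** T ** lineI q t)) * cis2pi (trace (T ** realm Z2)))) = 1 * a T"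
    by (rule coefficient_identity[OF fe _ zero_less_one _ _ _ int _ T]) (use eq in simp_all)
  then show ?thesis using cis2pi_trace_int[OF T, of 0 0 0] by simp
qed

text \<open>The second class preserves \<open>a T\<close> by \<open>coefficient_invariant\<close>
  and leaves an exponential sum over its fractional translations; the first and third classes yield
  the sums over the sublattices.\<close>

lemma hecke_T1_relation:
  assumes chi: "dirichlet_character N chi" and "N > 0" and "k > 0" and mf: "siegel_modular_form k N chi F"
    and fe: "has_fourier_expansion F a" and q: "prime q" and qN: "\<not> q dvd N"
    and eig: "eigenform (hecke_T1_tilde q k N chi) F"
  shows "\<exists>c0 c1 c2 C. c0 \<noteq> 0 \<and> (\<forall>T\<in>fourier_index. c0 * (\<Sum>t\<le>q. coeff0 a (transpose (lineV q t) ** T ** lineV q t))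
      + c1 * (\<Sum>t\<le>q. \<Sum>y=1..<q. cis2pi (trace (T ** (lineI q t ** m22 0 0 0 (real y / q) ** transpose (lineI q t))))) * a T
      + c2 * (\<Sum>t\<le>q. coeff0 a ((1 / real q ^ 2) *\<^sub>R (transpose (lineV q t) ** T ** lineV q t))) = C * a T)"
proof -
  have "q > 0" "q > 1" using q prime_gt_0_nat prime_gt_1_nat by blast+
  obtain c' where c': "\<And>\<tau>. \<tau> \<in> siegel_h2 \<Longrightarrow> hecke_T1_tilde q k N chi F \<tau> = c' * F \<tau>"
    using eig by (auto simp: eigenform_def)
  \<comment> \<open>The shift in \<open>hecke_T1_tilde\<close> is what the omitted translations
    \<open>y = 0\<close> would contribute, one for each of the \<open>q + 1\<close> lines. Being a
    scalar, it only changes the eigenvalue.\<close>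
  define c where "c = c' - chi (int q) * of_nat q powi (int k - 3) * (of_nat q + 1)"
  have c: "hecke_op (delta1 q) q k N chi F \<tau> = c * F \<tau>" if "\<tau> \<in> siegel_h2" for \<tau>
    using c'[OF that] by (simp add: hecke_T1_tilde_def hecke_T1_def c_def algebra_simps)
  define w where "w = case_sum (\<lambda>_ :: nat \<times> nat \<times> nat. 1) (case_sum (\<lambda>_. chi (int q)) (\<lambda>_. chi (int q) ^ 2) :: (nat \<times> nat) + nat \<Rightarrow> complex)"
  have d: "delta1 q ** T1_base1 q = mat 1"
    using \<open>q > 0\<close> by (simp add: delta1_def T1_base1_def diag2_m22 zero_m22 mat_block mat_m22)
  have fin: "finite (T1_index q)" by (simp add: T1_index_def)
  have "\<exists>C. \<forall>T\<in>fourier_index. (\<Sum>i\<in>T1_index q. w i * of_real (det ((1 / real 1) *\<^sub>R transpose (T1_Ainv q i))) powi (- int k) *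
      (coeff0 a ((1 / real 1) *\<^sub>R (transpose (T1_Ainv q i) ** T ** T1_Ainv q i)) * cis2pi (trace (T ** T1_X q i)))) = C * a T"
  proof (rule hecke_coefficients[OF chi \<open>N > 0\<close> \<open>k > 0\<close> mf fe d fin \<open>q > 0\<close> T1_X_sym zero_less_one T1_A_Ainv[OF \<open>q > 0\<close>]
        T1_A_int[OF \<open>q > 0\<close>] T1_unip_Gamma0 T1_rep_eq[OF \<open>q > 0\<close>] _ T1_coset_surj[OF q qN] T1_coset_inj[OF q] c])
    fix \<gamma> assume "\<gamma> \<in> Gamma0 N"
    then show "\<exists>i\<in>T1_index q. \<exists>g\<in>Gamma0 N. T1_base1 q ** ratm (\<gamma> ** symp_inv (T1_unip q i)) = ratm g ** T1_base q i \<and>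
       chi (det (blockD g)) = w i * chi (det (blockD (\<gamma> ** symp_inv (T1_unip q i))))"
      using T1_coset_exists[OF q qN _ chi] by (simp add: w_def)
  qed
  then obtain C where C: "\<And>T. T \<in> fourier_index \<Longrightarrow> (\<Sum>i\<in>T1_index q. w i * of_real (det ((1 / real 1) *\<^sub>R transpose (T1_Ainv q i))) powi (- int k) *
      (coeff0 a ((1 / real 1) *\<^sub>R (transpose (T1_Ainv q i) ** T ** T1_Ainv q i)) * cis2pi (trace (T ** T1_X q i)))) = C * a T"
    by blast
  \<comment> \<open>The factor \<open>q^2 q\<close> counts the translations \<open>x1\<close>,
    \<open>x2\<close> attached to each line.\<close>
  define c0 where "c0 = complex_of_real (real q) powi (- int k) * of_nat (q\<^sup>2 * q)"
  define c1 where "c1 = chi (int q)"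
  define c2 where "c2 = chi (int q) ^ 2 * of_real (1 / real q) powi (- int k)"
  have rel: "c0 * (\<Sum>t\<le>q. coeff0 a (transpose (lineV q t) ** T ** lineV q t))
      + c1 * (\<Sum>t\<le>q. \<Sum>y=1..<q. cis2pi (trace (T ** (lineI q t ** m22 0 0 0 (real y / q) ** transpose (lineI q t))))) * a T
      + c2 * (\<Sum>t\<le>q. coeff0 a ((1 / real q ^ 2) *\<^sub>R (transpose (lineV q t) ** T ** lineV q t))) = C * a T"
    if T: "T \<in> fourier_index" for T
  proof -
    define G where "G i = w i * of_real (det ((1 / real 1) *\<^sub>R transpose (T1_Ainv q i))) powi (- int k) *
      (coeff0 a ((1 / real 1) *\<^sub>R (transpose (T1_Ainv q i) ** T ** T1_Ainv q i)) * cis2pi (trace (T ** T1_X q i)))" for i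
    have G1: "G (Inl (t, x1, x2)) = complex_of_real (real q) powi (- int k) * coeff0 a (transpose (lineV q t) ** T ** lineV q t)" for t x1 x2
    proof -
      have "cis2pi (trace (T ** T1_X q (Inl (t, x1, x2)))) = 1"
      proof -
        have "\<exists>z1 z2 z3. lineI q t ** m22 (int x1) (int x2) (int x2) 0 ** transpose (lineI q t) = m22 z1 z2 z2 z3"
          by (auto simp: lineI_def)
        then obtain z1 z2 z3 where z: "lineI q t ** m22 (int x1) (int x2) (int x2) 0 ** transpose (lineI q t) = m22 z1 z2 z2 z3" by blast
        have "T1_X q (Inl (t, x1, x2)) = realm (lineI q t ** m22 (int x1) (int x2) (int x2) 0 ** transpose (lineI q t))"
          by (auto simp: T1_X_def lineI_def)
        then show ?thesis unfolding z by (simp only: cis2pi_trace_int[OF T])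
      qed
      moreover have "det (transpose (lineV q t)) = real q" by (auto simp: lineV_def lineI_def)
      ultimately show ?thesis by (simp add: G_def w_def T1_Ainv_def)
    qed
    have G2: "G (Inr (Inl (t, y))) = c1 * a T * cis2pi (trace (T ** (lineI q t ** m22 0 0 0 (real y / q) ** transpose (lineI q t))))" for t y
    proof -
      have "det (transpose (lineI q t)) = (1 :: real)" by (simp add: lineI_def)
      then show ?thesis using coefficient_invariant[OF chi \<open>k > 0\<close> mf fe T, of q t]
        by (simp add: G_def w_def T1_Ainv_def T1_X_def c1_def)
    qed
    have G3: "G (Inr (Inr t)) = c2 * coeff0 a ((1 / real q ^ 2) *\<^sub>R (transpose (lineV q t) ** T ** lineV q t))" for t
    proof -
      have "cis2pi (trace (T ** T1_X q (Inr (Inr t)))) = 1" unfolding T1_X_def using cis2pi_trace_int[OF T, of 0 0 0] by simp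
      moreover have "transpose ((1 / real q) *\<^sub>R lineV q t) ** T ** ((1 / real q) *\<^sub>R lineV q t) = (1 / real q ^ 2) *\<^sub>R (transpose (lineV q t) ** T ** lineV q t)"
        by (cases T rule: m22_cases, cases "lineV q t" rule: m22_cases) (simp add: algebra_simps power2_eq_square add_divide_distrib)
      moreover have "det (transpose ((1 / real q) *\<^sub>R lineV q t)) = 1 / real q"
        using \<open>q > 0\<close> by (auto simp: lineV_def lineI_def)
      ultimately show ?thesis by (simp add: G_def w_def T1_Ainv_def c2_def)
    qed
    have "(\<Sum>x\<in>{..q} \<times> {..<q\<^sup>2} \<times> {..<q}. G (Inl x)) = c0 * (\<Sum>t\<le>q. coeff0 a (transpose (lineV q t) ** T ** lineV q t))"
    proof -
      have "(\<Sum>x\<in>{..q} \<times> {..<q\<^sup>2} \<times> {..<q}. G (Inl x)) = (\<Sum>t\<le>q. \<Sum>x1<q\<^sup>2. \<Sum>x2<q. G (Inl (t, x1, x2)))"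
        by (simp add: sum.cartesian_product)
      then show ?thesis by (simp add: G1 c0_def sum_distrib_left mult_ac)
    qed
    moreover have "(\<Sum>x\<in>{..q} \<times> {1..<q}. G (Inr (Inl x))) = c1 * (\<Sum>t\<le>q. \<Sum>y=1..<q. cis2pi (trace (T ** (lineI q t ** m22 0 0 0 (real y / q) ** transpose (lineI q t))))) * a T"
    proof -
      have "(\<Sum>x\<in>{..q} \<times> {1..<q}. G (Inr (Inl x))) = (\<Sum>t\<le>q. \<Sum>y=1..<q. G (Inr (Inl (t, y))))"
        by (simp add: sum.cartesian_product)
      then show ?thesis by (simp add: G2 sum_distrib_left sum_distrib_right mult_ac)
    qed
    ultimately have "(\<Sum>i\<in>T1_index q. G i) = c0 * (\<Sum>t\<le>q. coeff0 a (transpose (lineV q t) ** T ** lineV q t))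
      + c1 * (\<Sum>t\<le>q. \<Sum>y=1..<q. cis2pi (trace (T ** (lineI q t ** m22 0 0 0 (real y / q) ** transpose (lineI q t))))) * a T
      + c2 * (\<Sum>t\<le>q. coeff0 a ((1 / real q ^ 2) *\<^sub>R (transpose (lineV q t) ** T ** lineV q t)))"
      by (simp add: T1_index_def sum.Plus o_def G3 sum_distrib_left)
    then show ?thesis using C[OF T] by (simp only: G_def)
  qed
  show ?thesis
    by (intro exI[of _ c0] exI[of _ c1] exI[of _ c2] exI[of _ C] conjI ballI rel)
       (use \<open>q > 0\<close> in \<open>simp_all add: c0_def\<close>)
qed

section \<open>Recursion along the powers of a prime\<close>

lemma fourier_index_diag:
  fixes x y :: nat
  shows "m22 (real x) 0 0 (real y) \<in> fourier_index"
proof -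
  have "0 \<le> v \<bullet> (m22 (real x) 0 0 (real y) *v v)" for v :: "real ^ 2"
    by (simp add: inner_vec_def sum_2 matrix_vector_mult_def mult.left_commute)
  moreover have "\<forall>r s. 2 * m22 (real x) 0 0 (real y) $ r $ s \<in> \<int>" "\<forall>r. m22 (real x) 0 0 (real y) $ r $ r \<in> \<int>"
    unfolding forall_2 by simp_all
  ultimately show ?thesis by (simp add: fourier_index_def pos_semidef_def)
qed

text \<open>The value of the form \<open>x^2 + p y^2\<close> of \<open>D\<close> on the second
  column of \<open>lineI q t\<close>; \<open>q\<close> divides it exactly when the line
  \<open>t\<close> is isotropic modulo \<open>q\<close>.\<close>

definition line_norm :: "nat \<Rightarrow> nat \<Rightarrow> nat \<Rightarrow> nat" where
  "line_norm p q t = (if t < q then t\<^sup>2 + p else 1)"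

text \<open>The Gram matrix of \<open>x^2 + p y^2\<close> on the sublattice spanned by the columns
  of \<open>lineV q t\<close>.\<close>

definition line_gram :: "nat \<Rightarrow> nat \<Rightarrow> nat \<Rightarrow> real mat2" where
  "line_gram p q t = (if t < q then m22 (real q ^ 2) (real q * real t) (real q * real t) (real (line_norm p q t))
     else m22 (real p * real q ^ 2) 0 0 (real (line_norm p q t)))"

lemma line_gram_eq: "transpose (lineV q t) ** (x *\<^sub>R m22 1 0 0 (real p)) ** lineV q t = x *\<^sub>R line_gram p q t"
  by (simp add: lineV_def lineI_def line_gram_def line_norm_def algebra_simps power2_eq_square)

lemma gauss_term: "trace ((x *\<^sub>R m22 1 0 0 (real p)) ** (lineI q t ** m22 0 0 0 (real y / q) ** transpose (lineI q t)))
    = x * real y * real (line_norm p q t) / real q"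
  by (simp add: lineI_def line_norm_def algebra_simps power2_eq_square add_divide_distrib)

lemma int_div_iff: "q > 0 \<Longrightarrow> real m / real q \<in> \<int> \<longleftrightarrow> q dvd m"
proof
  assume "q > 0" "real m / real q \<in> \<int>"
  then obtain z where "real m / real q = of_int z" by (elim Ints_cases)
  then have "real_of_int (int m) = real_of_int (int q * z)" using \<open>q > 0\<close> by (simp add: field_simps)
  then have "int m = int q * z" by (simp only: of_int_eq_iff)
  then have "int q dvd int m" by simp
  then show "q dvd m" by simp
qed (auto simp: real_of_nat_div[symmetric])

text \<open>For \<open>q\<close> different from \<open>p\<close>, an isotropic line would make
  \<open>-p\<close> a square modulo \<open>q\<close>. For \<open>q = p\<close> only
  \<open>t = 0\<close> is isotropic, and there the value is \<open>p\<close> itself, which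
  \<open>p^2\<close> does not divide.\<close>

lemma line_norm_dvd:
  assumes q: "prime q" and p: "prime p" and cond: "q = p \<or> Legendre (- int p) (int q) = - 1"
  shows "q dvd line_norm p q t \<longleftrightarrow> q = p \<and> t = 0" "\<not> q\<^sup>2 dvd line_norm p q t"
proof -
  have "q > 1" "p > 0" using q p prime_gt_1_nat prime_gt_0_nat by blast+
  show 1: "q dvd line_norm p q t \<longleftrightarrow> q = p \<and> t = 0"
  proof
    assume dvd: "q dvd line_norm p q t"
    then have t: "t < q" using \<open>q > 1\<close> by (auto simp: line_norm_def split: if_splits)
    then have dvd': "q dvd t\<^sup>2 + p" using dvd by (simp add: line_norm_def)
    have "q = p"
    proof (rule ccontr)
      assume "q \<noteq> p"
      then have leg: "Legendre (- int p) (int q) = - 1" using cond by blast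
      have "int q dvd (int t)\<^sup>2 - (- int p)" using dvd' by (metis of_nat_dvd_iff of_nat_add of_nat_power diff_minus_eq_add)
      then have "[(int t)\<^sup>2 = - int p] (mod int q)" by (simp only: cong_iff_dvd_diff)
      then have "QuadRes (int q) (- int p)" by (auto simp: QuadRes_def)
      then show False using leg by (simp add: Legendre_def split: if_splits)
    qed
    moreover have "t = 0"
    proof -
      have "q dvd t\<^sup>2" using dvd' \<open>q = p\<close> by simp
      then have "q dvd t" using q by (simp add: prime_dvd_power_iff)
      then show ?thesis using t by (auto dest: dvd_imp_le)
    qed
    ultimately show "q = p \<and> t = 0" by blast
  qed (use \<open>q > 1\<close> in \<open>auto simp: line_norm_def\<close>)
  show "\<not> q\<^sup>2 dvd line_norm p q t"
  proof
    assume dvd: "q\<^sup>2 dvd line_norm p q t"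
    then have "q dvd line_norm p q t" by (metis dvd_mult_left power2_eq_square)
    then have "q = p \<and> t = 0" using 1 by blast
    then have "q * q dvd q * 1" using dvd \<open>p > 0\<close> by (simp add: line_norm_def power2_eq_square)
    then show False using \<open>q > 1\<close> by (simp del: mult_1_right)
  qed
qed

lemma coeff0_line_gram_0:
  assumes "q > 0" "\<not> q dvd m * line_norm p q t"
  shows "coeff0 a ((real m / real q) *\<^sub>R line_gram p q t) = 0"
proof -
  have "((real m / real q) *\<^sub>R line_gram p q t) $ 2 $ 2 = real (m * line_norm p q t) / real q"
    by (simp add: line_gram_def)
  moreover have "real (m * line_norm p q t) / real q \<notin> \<int>"
    using assms int_div_iff[OF assms(1), of "m * line_norm p q t"] by blast
  ultimately have "((real m / real q) *\<^sub>R line_gram p q t) $ 2 $ 2 \<notin> \<int>" by (simp only: not_False_eq_True)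
  then show ?thesis by (auto simp: coeff0_def fourier_index_def)
qed

text \<open>Induction on \<open>r\<close> with four claims at once: the step from
  \<open>T(q)\<close> needs the coefficients at \<open>r\<close> and \<open>r - 1\<close> and one
  sublattice sum, and the step from \<open>T_1(q^2)\<close> reaches two sublattice sums
  back.\<close>

lemma prime_power_multiplier:
  assumes chi: "dirichlet_character N chi" and "N > 0" and "k > 0" and mf: "siegel_modular_form k N chi F"
    and fe: "has_fourier_expansion F a" and p: "prime p" and q: "prime q"
    and T: "eigenform (hecke_T q k N chi) F" and T1: "eigenform (hecke_T1_tilde q k N chi) F"
    and cond: "q = p \<or> Legendre (- int p) (int q) = - 1"
  defines "D \<equiv> m22 1 0 0 (real p)"
  shows "\<exists>P. \<forall>m. coprime m q \<longrightarrow> a (real (q ^ r * m) *\<^sub>R D) = P * a (real m *\<^sub>R D)"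
proof -
  have "q > 0" "q > 1" using q prime_gt_0_nat prime_gt_1_nat by blast+
  have DFI: "real x *\<^sub>R D \<in> fourier_index" for x
    using fourier_index_diag[of x "x * p"] by (simp add: D_def)
  define ok where "ok m \<longleftrightarrow> coprime m q" for m
  have ok_dvd: "q dvd m * x \<longleftrightarrow> q dvd x" if "ok m" for m x
    using that coprime_dvd_mult_right_iff[of q m x] by (simp add: ok_def coprime_commute)
  \<comment> \<open>The multiplier is one constant for all \<open>m\<close> prime to
    \<open>q\<close>, and this property is stable under linear combinations with coefficients free
    of \<open>m\<close>.\<close>
  define L where "L f \<longleftrightarrow> (\<exists>P. \<forall>m. ok m \<longrightarrow> f m = P * a (real m *\<^sub>R D))" for f
  have L_lin: "L (\<lambda>m. x * f m + y * g m + z * h m)" if "L f" "L g" "L h" for f g h x y z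
  proof -
    obtain P Q R where "\<And>m. ok m \<Longrightarrow> f m = P * a (real m *\<^sub>R D)" "\<And>m. ok m \<Longrightarrow> g m = Q * a (real m *\<^sub>R D)"
       "\<And>m. ok m \<Longrightarrow> h m = R * a (real m *\<^sub>R D)"
      using \<open>L f\<close> \<open>L g\<close> \<open>L h\<close> unfolding L_def by blast
    then have "\<forall>m. ok m \<longrightarrow> x * f m + y * g m + z * h m = (x * P + y * Q + z * R) * a (real m *\<^sub>R D)"
      by (simp add: algebra_simps)
    then show ?thesis unfolding L_def by blast
  qed
  have L_cong: "L f" if "L g" "\<And>m. ok m \<Longrightarrow> f m = g m" for f g
    using that unfolding L_def by auto
  have L_0: "L (\<lambda>_. 0)" unfolding L_def by (intro exI[of _ 0]) simp
  txt \<open>The index of \<open>b\<close> is shifted by two: \<open>b (r + 2)\<close> is the sum over the sublattices of index \<open>q\<close> at \<open>q ^ r * m\<close>.\<close>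
  define A where "A r m = a (real (q ^ r * m) *\<^sub>R D)" for r m
  define A' where "A' r m = coeff0 a ((real (q ^ r * m) / real q) *\<^sub>R D)" for r m
  define b where "b r m = (\<Sum>t\<le>q. coeff0 a ((real (q ^ r * m) / real q ^ 2) *\<^sub>R line_gram p q t))" for r m
  obtain c0 c1 c2 C where "c0 \<noteq> 0" and c1: "q dvd N \<longrightarrow> c1 = 0"
    and rel: "\<forall>T\<in>fourier_index. c0 * coeff0 a (real q *\<^sub>R T)
      + c1 * (\<Sum>t\<le>q. coeff0 a ((1 / real q) *\<^sub>R (transpose (lineV q t) ** T ** lineV q t))) + c2 * coeff0 a ((1 / real q) *\<^sub>R T) = C * a T"
    using hecke_T_relation[OF chi \<open>N > 0\<close> \<open>k > 0\<close> mf fe q T] by (elim exE conjE) (rule that)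
  have relT: "c0 * A (Suc r) m + c1 * b (Suc r) m + c2 * A' r m = C * A r m" for r m
  proof -
    have "real q *\<^sub>R real (q ^ r * m) *\<^sub>R D = real (q ^ Suc r * m) *\<^sub>R D"
      by (simp only: scaleR_scaleR of_nat_mult power_Suc mult.assoc)
    then have e: "coeff0 a (real q *\<^sub>R real (q ^ r * m) *\<^sub>R D) = A (Suc r) m"
      by (simp only: A_def coeff0_def DFI if_True)
    have "(1 / real q) *\<^sub>R (transpose (lineV q t) ** (real (q ^ r * m) *\<^sub>R D) ** lineV q t) = (real (q ^ Suc r * m) / real q ^ 2) *\<^sub>R line_gram p q t" for t
      unfolding D_def line_gram_eq using \<open>q > 0\<close> by (simp add: field_simps power2_eq_square)
    moreover have "(1 / real q) *\<^sub>R real (q ^ r * m) *\<^sub>R D = (real (q ^ r * m) / real q) *\<^sub>R D" by simp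
    ultimately show ?thesis using rel[rule_format, OF DFI[of "q ^ r * m"]] unfolding e by (simp only: b_def A'_def A_def)
  qed
  \<comment> \<open>The lower right entry of the index is \<open>m\<close> times a line value over
    \<open>q^2\<close>, never an integer.\<close>
  have b0: "b 0 m = 0" if "ok m" for m
  proof -
    have "\<not> q\<^sup>2 dvd m * line_norm p q t" for t
    proof -
      have "coprime (q\<^sup>2) m" using that by (simp add: ok_def coprime_commute)
      then have "q\<^sup>2 dvd m * line_norm p q t \<longleftrightarrow> q\<^sup>2 dvd line_norm p q t" by (simp add: coprime_dvd_mult_right_iff)
      then show ?thesis using line_norm_dvd(2)[OF q p cond] by blast
    qed
    then have "real (m * line_norm p q t) / real (q\<^sup>2) \<notin> \<int>" for t
      using int_div_iff[of "q\<^sup>2" "m * line_norm p q t"] \<open>q > 0\<close> by simp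
    moreover have "((real m / real (q\<^sup>2)) *\<^sub>R line_gram p q t) $ 2 $ 2 = real (m * line_norm p q t) / real (q\<^sup>2)" for t
      by (simp add: line_gram_def)
    ultimately have "((real m / real (q\<^sup>2)) *\<^sub>R line_gram p q t) $ 2 $ 2 \<notin> \<int>" for t
      by (simp only: not_False_eq_True)
    then have "coeff0 a ((real m / real (q\<^sup>2)) *\<^sub>R line_gram p q t) = 0" for t
      by (auto simp: coeff0_def fourier_index_def)
    then show ?thesis by (simp add: b_def)
  qed
  have b1: "b 1 m = (if q = p then 1 else 0) * a (real m *\<^sub>R D)" if "ok m" for m
  proof -
    have b1_eq: "b 1 m = (\<Sum>t\<le>q. coeff0 a ((real m / real q) *\<^sub>R line_gram p q t))"
      unfolding b_def using \<open>q > 0\<close> by (simp add: power2_eq_square)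
    have zero: "coeff0 a ((real m / real q) *\<^sub>R line_gram p q t) = 0" if "\<not> (q = p \<and> t = 0)" for t
      using that line_norm_dvd(1)[OF q p cond] ok_dvd[OF \<open>ok m\<close>] by (intro coeff0_line_gram_0 \<open>q > 0\<close>) blast
    show ?thesis
    proof (cases "q = p")
      case False
      then have "b 1 m = 0" unfolding b1_eq by (intro sum.neutral) (use zero in blast)
      then show ?thesis using False by simp
    next
      case True
      have "b 1 m = coeff0 a ((real m / real q) *\<^sub>R line_gram p q 0)"
      proof -
        have "b 1 m = (\<Sum>t\<in>{0}. coeff0 a ((real m / real q) *\<^sub>R line_gram p q t))"
          unfolding b1_eq by (intro sum.mono_neutral_right) (use zero in auto)
        then show ?thesis by simp
      qed
      \<comment> \<open>On the isotropic line for \<open>q = p\<close> the index is \<open>m\<close>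
        times the diagonal matrix with entries \<open>p\<close> and 1, which is \<open>D\<close>
        after the rotation \<open>lineI q q\<close> exchanging the coordinates.\<close>
      also have "(real m / real q) *\<^sub>R line_gram p q 0 = transpose (lineI q q) ** (real m *\<^sub>R D) ** lineI q q"
        using True \<open>q > 0\<close> by (simp add: line_gram_def line_norm_def D_def lineI_def power2_eq_square)
      also have "coeff0 a (transpose (lineI q q) ** (real m *\<^sub>R D) ** lineI q q) = a (real m *\<^sub>R D)"
        by (rule coefficient_invariant[OF chi \<open>k > 0\<close> mf fe DFI])
      finally show ?thesis using True by simp
    qed
  qed
  define gs where "gs r m = (\<Sum>t\<le>q. \<Sum>y=1..<q. cis2pi (trace ((real (q ^ r * m) *\<^sub>R D) ** (lineI q t ** m22 0 0 0 (real y / q) ** transpose (lineI q t)))))" for r m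
  \<comment> \<open>For each line the sum over \<open>y\<close> from 1 to \<open>q - 1\<close> is
    \<open>q - 1\<close> or \<open>-1\<close>, according to divisibility by \<open>q\<close> alone,
    which a factor \<open>m\<close> prime to \<open>q\<close> does not affect.\<close>
  have gs: "gs r m = gs r 1" if "ok m" for r m
  proof -
    have inner: "(\<Sum>y=1..<q. cis2pi (real x * real y * real (line_norm p q t) / real q)) = (if q dvd x * line_norm p q t then of_nat q else 0) - 1" for x t
    proof -
      let ?Z = "\<Sum>y=1..<q. cis2pi (real y * (of_int (int (x * line_norm p q t)) / real q))"
      have "(\<Sum>y<q. cis2pi (real y * (of_int (int (x * line_norm p q t)) / real q))) = (if int q dvd int (x * line_norm p q t) then of_nat q else 0)"
        by (rule sum_cis2pi[OF \<open>q > 0\<close>])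
      moreover have "(\<Sum>y<q. cis2pi (real y * (of_int (int (x * line_norm p q t)) / real q))) = 1 + ?Z"
        using sum.atLeast_Suc_lessThan[of 0 q "\<lambda>y. cis2pi (real y * (of_int (int (x * line_norm p q t)) / real q))"] \<open>q > 0\<close>
        by (simp only: lessThan_atLeast0 One_nat_def) simp
      ultimately have "1 + ?Z = (if q dvd x * line_norm p q t then of_nat q else 0)"
        by (simp only: of_nat_dvd_iff)
      then have "?Z = (if q dvd x * line_norm p q t then of_nat q else 0) - 1"
        by (simp only: eq_diff_eq add.commute)
      moreover have "(\<Sum>y=1..<q. cis2pi (real x * real y * real (line_norm p q t) / real q)) = ?Z"
        by (intro sum.cong refl) (simp add: mult_ac)
      ultimately show ?thesis by (simp only:)
    qed
    have "q dvd q ^ r * m * line_norm p q t \<longleftrightarrow> q dvd q ^ r * 1 * line_norm p q t" for t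
      using ok_dvd[OF that, of "q ^ r * line_norm p q t"] by (simp add: mult_ac)
    then show ?thesis unfolding gs_def D_def gauss_term inner by simp
  qed
  \<comment> \<open>The sums \<open>b\<close> are carried with the factor \<open>c1\<close>: the
    relation from \<open>T_1(q^2)\<close> is at hand only for \<open>q\<close> prime to the level,
    and otherwise \<open>c1 = 0\<close>.\<close>
  have main: "L (A r) \<and> L (A' r) \<and> L (\<lambda>m. c1 * b r m) \<and> L (\<lambda>m. c1 * b (Suc r) m)"
  proof (induction r)
    case 0
    have "L (A 0)" unfolding L_def A_def by (intro exI[of _ 1]) simp
    moreover have "L (A' 0)"
    proof (rule L_cong[OF L_0])
      fix m assume "ok m"
      have "\<not> q dvd m"
        using ok_dvd[OF \<open>ok m\<close>, of 1] \<open>q > 1\<close> by simp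
      then have "real m / real q \<notin> \<int>" using int_div_iff[OF \<open>q > 0\<close>] by blast
      moreover have "((real m / real q) *\<^sub>R D) $ 1 $ 1 = real m / real q" by (simp add: D_def)
      ultimately have "(real m / real q) *\<^sub>R D \<notin> fourier_index" unfolding fourier_index_def mem_Collect_eq by metis
      then show "A' 0 m = 0" by (simp add: A'_def coeff0_def)
    qed
    moreover have "L (\<lambda>m. c1 * b 0 m)" by (rule L_cong[OF L_0]) (simp add: b0)
    moreover have "L (\<lambda>m. c1 * b (Suc 0) m)"
      unfolding L_def using b1 by (intro exI[of _ "c1 * (if q = p then 1 else 0)"]) simp
    ultimately show ?case by blast
  next
    case (Suc r)
    have "L (A (Suc r))"
    proof (rule L_cong)
      show "L (\<lambda>m. (C / c0) * A r m + (- 1 / c0) * (c1 * b (Suc r) m) + (- c2 / c0) * A' r m)"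
        using Suc by (intro L_lin) blast+
      show "A (Suc r) m = (C / c0) * A r m + (- 1 / c0) * (c1 * b (Suc r) m) + (- c2 / c0) * A' r m" for m
      proof -
        have "A (Suc r) m * c0 = C * A r m - c1 * b (Suc r) m - c2 * A' r m"
          using relT[of r m] by (simp add: algebra_simps)
        then have eqn: "A (Suc r) m = (C * A r m - c1 * b (Suc r) m - c2 * A' r m) / c0"
          by (simp only: nonzero_eq_divide_eq[OF \<open>c0 \<noteq> 0\<close>])
        show ?thesis unfolding eqn by (simp add: diff_divide_distrib)
      qed
    qed
    moreover have "L (A' (Suc r))"
    proof (rule L_cong)
      show "L (A r)" using Suc by blast
      fix m
      have "(real (q ^ Suc r * m) / real q) *\<^sub>R D = real (q ^ r * m) *\<^sub>R D" using \<open>q > 0\<close> by simp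
      then show "A' (Suc r) m = A r m" using DFI by (simp only: A'_def A_def coeff0_def if_True)
    qed
    moreover have "L (\<lambda>m. c1 * b (Suc (Suc r)) m)"
    proof (cases "q dvd N")
      case True
      then show ?thesis using c1 L_0 by simp
    next
      case False
      obtain d0 d1 d2 C' where "d0 \<noteq> 0"
        and rel1: "\<forall>T\<in>fourier_index. d0 * (\<Sum>t\<le>q. coeff0 a (transpose (lineV q t) ** T ** lineV q t))
      + d1 * (\<Sum>t\<le>q. \<Sum>y=1..<q. cis2pi (trace (T ** (lineI q t ** m22 0 0 0 (real y / q) ** transpose (lineI q t))))) * a T
      + d2 * (\<Sum>t\<le>q. coeff0 a ((1 / real q ^ 2) *\<^sub>R (transpose (lineV q t) ** T ** lineV q t))) = C' * a T"
        using hecke_T1_relation[OF chi \<open>N > 0\<close> \<open>k > 0\<close> mf fe q False T1] by (elim exE conjE) (rule that)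
      have relT1: "d0 * b (Suc (Suc r)) m + d1 * gs r m * A r m + d2 * b r m = C' * A r m" for m
      proof -
        have "transpose (lineV q t) ** (real (q ^ r * m) *\<^sub>R D) ** lineV q t = (real (q ^ Suc (Suc r) * m) / real q ^ 2) *\<^sub>R line_gram p q t" for t
          unfolding D_def line_gram_eq using \<open>q > 0\<close> by (simp add: field_simps power2_eq_square)
        moreover have "(1 / real q ^ 2) *\<^sub>R (transpose (lineV q t) ** (real (q ^ r * m) *\<^sub>R D) ** lineV q t) = (real (q ^ r * m) / real q ^ 2) *\<^sub>R line_gram p q t" for t
          unfolding D_def line_gram_eq using \<open>q > 0\<close> by simp
        ultimately show ?thesis using rel1[rule_format, OF DFI[of "q ^ r * m"]] by (simp only: b_def A_def gs_def)
      qed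
      show ?thesis
      proof (rule L_cong)
        \<comment> \<open>Only two terms occur; the summand with coefficient 0 fills the third slot
          of \<open>L_lin\<close>.\<close>
        show "L (\<lambda>m. (c1 * (C' - d1 * gs r 1) / d0) * A r m + (- d2 / d0) * (c1 * b r m) + 0 * A r m)"
          using Suc by (intro L_lin) blast+
        show "c1 * b (Suc (Suc r)) m = (c1 * (C' - d1 * gs r 1) / d0) * A r m + (- d2 / d0) * (c1 * b r m) + 0 * A r m" if "ok m" for m
        proof -
          have "d0 * b (Suc (Suc r)) m = (C' - d1 * gs r 1) * A r m - d2 * b r m"
            using relT1[of m] gs[OF that, of r] by (simp add: algebra_simps)
          then have "b (Suc (Suc r)) m * d0 = (C' - d1 * gs r 1) * A r m - d2 * b r m"
            by (simp only: mult.commute)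
          then have eqn: "b (Suc (Suc r)) m = ((C' - d1 * gs r 1) * A r m - d2 * b r m) / d0"
            by (simp only: nonzero_eq_divide_eq[OF \<open>d0 \<noteq> 0\<close>])
          have "c1 * ((K * x - d2 * y) / d0) = (c1 * K / d0) * x + (- d2 / d0) * (c1 * y) + 0 * x" for K x y
            by (simp add: diff_divide_distrib right_diff_distrib mult_ac)
          then show ?thesis unfolding eqn .
        qed
      qed
    qed
    ultimately show ?case using Suc by blast
  qed
  then have "L (A r)" by blast
  then show ?thesis unfolding L_def A_def ok_def .
qed

theorem theorem1p2:
  fixes k N p m n :: nat and chi :: "int \<Rightarrow> complex"
    and F :: "complex mat2 \<Rightarrow> complex" and a :: "real mat2 \<Rightarrow> complex"
    and D :: "real mat2" and S :: "nat set"
  assumes "k > 0" and "N > 0" and "dirichlet_character N chi"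
    and "siegel_modular_form k N chi F"
    and "has_fourier_expansion F a"
    and "prime p" and "odd p"
    and "D = diag2 1 (real p)"
    and "S = {q. prime q \<and> odd q \<and>
           eigenform (hecke_T q k N chi) F \<and> eigenform (hecke_T1_tilde q k N chi) F \<and>
           (q = p \<or> Legendre (- int p) (int q) = - 1)}"
    and "n > 0" and "prime_factors n \<subseteq> S"
    and "m > 0" and "coprime m n"
  shows "a D * a (real (m * n) *\<^sub>R D) = a (real m *\<^sub>R D) * a (real n *\<^sub>R D)
       \<and> (a (real m *\<^sub>R D) = 0 \<longrightarrow> a D * a (real (m * n) *\<^sub>R D) = 0)"
proof -
  have mult: "\<exists>P. \<forall>m. coprime m q \<longrightarrow> a (real (q ^ r * m) *\<^sub>R D) = P * a (real m *\<^sub>R D)" if "q \<in> S" for q r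
    using prime_power_multiplier[OF assms(3,2,1,4,5,6), of q r] that by (simp add: assms(8,9) diag2_m22)
  \<comment> \<open>The constant is chosen before \<open>m\<close>: this allows splitting off one
    prime power, whose multiplier is then applied at \<open>m * n'\<close>.\<close>
  have "\<exists>P. \<forall>m. coprime m n \<longrightarrow> a (real (m * n) *\<^sub>R D) = P * a (real m *\<^sub>R D)"
    using \<open>n > 0\<close> \<open>prime_factors n \<subseteq> S\<close>
  proof (induction n rule: less_induct)
    case (less n)
    show ?case
    proof (cases "n = 1")
      case True
      then show ?thesis by (intro exI[of _ 1]) simp
    next
      case False
      then obtain q where q: "prime q" "q dvd n" using prime_factor_nat by blast
      then have "q \<in> S" using less.prems by (auto simp: prime_factors_dvd)
      obtain n' where n': "n = q ^ multiplicity q n * n'" "\<not> q dvd n'"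
        using multiplicity_decompose'[of n q] less.prems q(1) not_prime_unit by (metis not_gr_zero)
      define r where "r = multiplicity q n"
      have n_eq: "n = q ^ r * n'" using n' by (simp add: r_def)
      have "r > 0" using n_eq n'(2) q(2) by (cases r) auto
      have "n' > 0" using n_eq less.prems(1) by (cases n') auto
      have "n' < n"
      proof -
        have "q ^ r > 1" by (rule one_less_power[OF prime_gt_1_nat[OF q(1)] \<open>r > 0\<close>])
        then show ?thesis using \<open>n' > 0\<close> n_eq by simp
      qed
      moreover have "prime_factors n' \<subseteq> S"
        using less.prems by (auto simp: prime_factors_dvd n_eq)
      ultimately obtain P' where P': "\<And>m. coprime m n' \<Longrightarrow> a (real (m * n') *\<^sub>R D) = P' * a (real m *\<^sub>R D)"
        using less.IH \<open>n' > 0\<close> by blast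
      obtain P where P: "\<And>m. coprime m q \<Longrightarrow> a (real (q ^ r * m) *\<^sub>R D) = P * a (real m *\<^sub>R D)"
        using mult[OF \<open>q \<in> S\<close>] by blast
      have "a (real (m * n) *\<^sub>R D) = (P * P') * a (real m *\<^sub>R D)" if "coprime m n" for m
      proof -
        have "coprime m q" "coprime m n'"
          using that \<open>r > 0\<close> by (simp_all add: n_eq)
        moreover have "coprime n' q" using prime_imp_coprime[OF q(1) n'(2)] by (simp add: coprime_commute)
        ultimately have "coprime (m * n') q" by simp
        have "a (real (m * n) *\<^sub>R D) = a (real (q ^ r * (m * n')) *\<^sub>R D)" by (simp add: n_eq mult_ac)
        also have "\<dots> = P * a (real (m * n') *\<^sub>R D)" by (rule P[OF \<open>coprime (m * n') q\<close>])
        also have "\<dots> = (P * P') * a (real m *\<^sub>R D)" using P'[OF \<open>coprime m n'\<close>] by simp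
        finally show ?thesis .
      qed
      then show ?thesis by blast
    qed
  qed
  then obtain P where P: "\<And>m. coprime m n \<Longrightarrow> a (real (m * n) *\<^sub>R D) = P * a (real m *\<^sub>R D)"
    by blast
  \<comment> \<open>At \<open>m = 1\<close> the same constant satisfies
    \<open>a (n D) = P * a D\<close>; eliminating it gives both claims without dividing by
    \<open>a D\<close>.\<close>
  from P[OF \<open>coprime m n\<close>] P[of 1] show ?thesis by simp
qed

end
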